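(* Fix $h\ge0$, $D\in\mathbb R$. There exists $\beta_0>0$ such that for every $\beta\in(0,\beta_0)$, $$\nu(T_1^2)=A_1^2+O(N^{-3/2}),\qquad \nu(S_1^2)=B_1^2+O(N^{-3/2}),\qquad \nu(S_1T_1)=C_1^2+O(N^{-3/2}),$$ with implied constants independent of $N$.
   Context: Fix an integer $\mathcal S\ge1$ and $N\ge2$; $\Sigma_N=\{0,\pm1,\dots,\pm\mathcal S\}^N$. For $\beta>0$, $h\ge0$, $D\in\mathbb R$ and i.i.d. standard Gaussians $(g_{i,j})_{i<j}$, $H_N(\sigma)=\frac{\beta}{\sqrt N}\sum_{i<j}g_{i,j}\sigma_i\sigma_j+D\sum_i\sigma_i^2+h\sum_i\sigma_i$, Gibbs measure $G(\sigma)\propto e^{H_N(\sigma)}$ on $\Sigma_N$. Replicas are i.i.d. samples from $G$ given the disorder; $\langle\cdot\rangle$ is the product Gibbs average, $\nu(f)=\mathbb E\langle f\rangle$. $p,q$: for $\eta\sim N(0,1)$, $\langle\phi\rangle_\eta=\sum_s\phi(s)w_\eta(s)/\sum_sw_\eta(s)$, $w_\eta(s)=\exp(\beta\sqrt q\eta s+hs+(D+\frac{\beta^2}{2}(p-q))s^2)$, $s\in\{0,\pm1,\dots,\pm\mathcal S\}$; $(p,q)$ solves $q=\mathbb E\langle s\rangle_\eta^2$, $p=\mathbb E\langle s^2\rangle_\eta$ (unique at high temperature). $b_i=\langle\sigma_i\rangle$, $\tilde b_i=\langle\sigma_i^2\rangle$; $T_1=\frac1N\sum_i(\sigma^1_i-b_i)b_i$,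 $S_1=\frac1N\sum_i((\sigma_i^1)^2-\tilde b_i)$. Constants: $m_j=\langle s^j\rangle_\eta$, expectations over $\eta$: $\mathcal D=\mathbb E[m_4-m_2^2]$, $F=\mathbb E[m_2^2-m_1^2m_2]$, $G=\mathbb E[m_1^2(m_2-m_1^2)]$, $\mathcal E=\mathbb E[m_1(m_3-m_1m_2)]$; $M_1=1-\beta^2(F-3G)$, $M_2=1-\frac{\beta^2}{2}\mathcal D$, $M_3=1-\beta^2(F-G)$, $M=M_1M_2+\beta^4\mathcal E^2$; $A_1^2=\frac{GM_2+\frac{\beta^2}{2}\mathcal E^2}{NMM_3}$, $B_1^2=\frac{\mathcal DM_1-2\beta^2\mathcal E^2}{NM}$, $C_1^2=\frac{\mathcal E}{NM}$. *)

theory Defs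
  imports "HOL-Probability.Probability"
begin

definition stdN :: "real measure" where
  "stdN = density lborel std_normal_density"

definition spins :: "nat \<Rightarrow> int set" where
  "spins S = {- int S .. int S}"

definition configs :: "nat \<Rightarrow> nat \<Rightarrow> (nat \<Rightarrow> int) set" where
  "configs S N = PiE {..<N} (\<lambda>_. spins S)"

definition pairs :: "nat \<Rightarrow> (nat \<times> nat) set" where
  "pairs N = {(i, j). i < j \<and> j < N}"

definition disorder :: "nat \<Rightarrow> ((nat \<times> nat) \<Rightarrow> real) measure" where
  "disorder N = PiM (pairs N) (\<lambda>_. stdN)"

definition Ham :: "nat \<Rightarrow> real \<Rightarrow> real \<Rightarrow> real \<Rightarrow> ((nat \<times> nat) \<Rightarrow> real) \<Rightarrow> (nat \<Rightarrow> int) \<Rightarrow> real" where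
  "Ham N \<beta> h D g \<sigma> =
     \<beta> / sqrt (real N) * (\<Sum>(i, j)\<in>pairs N. g (i, j) * real_of_int (\<sigma> i) * real_of_int (\<sigma> j))
     + D * (\<Sum>i<N. real_of_int (\<sigma> i) ^ 2) + h * (\<Sum>i<N. real_of_int (\<sigma> i))"

definition gibbs :: "nat \<Rightarrow> nat \<Rightarrow> real \<Rightarrow> real \<Rightarrow> real \<Rightarrow> ((nat \<times> nat) \<Rightarrow> real) \<Rightarrow> ((nat \<Rightarrow> int) \<Rightarrow> real) \<Rightarrow> real" where
  "gibbs S N \<beta> h D g f =
     (\<Sum>\<sigma>\<in>configs S N. f \<sigma> * exp (Ham N \<beta> h D g \<sigma>)) / (\<Sum>\<sigma>\<in>configs S N. exp (Ham N \<beta> h D g \<sigma>))"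

definition bmag :: "nat \<Rightarrow> nat \<Rightarrow> real \<Rightarrow> real \<Rightarrow> real \<Rightarrow> ((nat \<times> nat) \<Rightarrow> real) \<Rightarrow> nat \<Rightarrow> real" where
  "bmag S N \<beta> h D g i = gibbs S N \<beta> h D g (\<lambda>\<sigma>. real_of_int (\<sigma> i))"

definition bsq :: "nat \<Rightarrow> nat \<Rightarrow> real \<Rightarrow> real \<Rightarrow> real \<Rightarrow> ((nat \<times> nat) \<Rightarrow> real) \<Rightarrow> nat \<Rightarrow> real" where
  "bsq S N \<beta> h D g i = gibbs S N \<beta> h D g (\<lambda>\<sigma>. real_of_int (\<sigma> i) ^ 2)"

(* T_1 and S_1 evaluated at the first replica sigma^1 = sigma *)
definition T1 :: "nat \<Rightarrow> nat \<Rightarrow> real \<Rightarrow> real \<Rightarrow> real \<Rightarrow> ((nat \<times> nat) \<Rightarrow> real) \<Rightarrow> (nat \<Rightarrow> int) \<Rightarrow> real" where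
  "T1 S N \<beta> h D g \<sigma> =
     (1 / real N) * (\<Sum>i<N. (real_of_int (\<sigma> i) - bmag S N \<beta> h D g i) * bmag S N \<beta> h D g i)"

definition S1 :: "nat \<Rightarrow> nat \<Rightarrow> real \<Rightarrow> real \<Rightarrow> real \<Rightarrow> ((nat \<times> nat) \<Rightarrow> real) \<Rightarrow> (nat \<Rightarrow> int) \<Rightarrow> real" where
  "S1 S N \<beta> h D g \<sigma> =
     (1 / real N) * (\<Sum>i<N. real_of_int (\<sigma> i) ^ 2 - bsq S N \<beta> h D g i)"

definition nu :: "nat \<Rightarrow> nat \<Rightarrow> real \<Rightarrow> real \<Rightarrow> real \<Rightarrow> (((nat \<times> nat) \<Rightarrow> real) \<Rightarrow> (nat \<Rightarrow> int) \<Rightarrow> real) \<Rightarrow> real" where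
  "nu S N \<beta> h D f = (\<integral>g. gibbs S N \<beta> h D g (f g) \<partial>disorder N)"

definition wsite :: "real \<Rightarrow> real \<Rightarrow> real \<Rightarrow> real \<Rightarrow> real \<Rightarrow> real \<Rightarrow> int \<Rightarrow> real" where
  "wsite \<beta> h D p q \<eta> s =
     exp (\<beta> * sqrt q * \<eta> * real_of_int s + h * real_of_int s
          + (D + \<beta>^2 / 2 * (p - q)) * real_of_int s ^ 2)"

definition site_avg :: "nat \<Rightarrow> real \<Rightarrow> real \<Rightarrow> real \<Rightarrow> real \<Rightarrow> real \<Rightarrow> real \<Rightarrow> (int \<Rightarrow> real) \<Rightarrow> real" where
  "site_avg S \<beta> h D p q \<eta> \<phi> =
     (\<Sum>s\<in>spins S. \<phi> s * wsite \<beta> h D p q \<eta> s) / (\<Sum>s\<in>spins S. wsite \<beta> h D p q \<eta> s)"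

definition mom :: "nat \<Rightarrow> real \<Rightarrow> real \<Rightarrow> real \<Rightarrow> real \<Rightarrow> real \<Rightarrow> nat \<Rightarrow> real \<Rightarrow> real" where
  "mom S \<beta> h D p q j \<eta> = site_avg S \<beta> h D p q \<eta> (\<lambda>s. real_of_int s ^ j)"

definition Eeta :: "(real \<Rightarrow> real) \<Rightarrow> real" where
  "Eeta f = (\<integral>\<eta>. f \<eta> \<partial>stdN)"

definition fixed_point :: "nat \<Rightarrow> real \<Rightarrow> real \<Rightarrow> real \<Rightarrow> real \<Rightarrow> real \<Rightarrow> bool" where
  "fixed_point S \<beta> h D p q \<longleftrightarrow>
     q = Eeta (\<lambda>\<eta>. (mom S \<beta> h D p q 1 \<eta>)^2) \<and> p = Eeta (\<lambda>\<eta>. mom S \<beta> h D p q 2 \<eta>)"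

definition cD :: "nat \<Rightarrow> real \<Rightarrow> real \<Rightarrow> real \<Rightarrow> real \<Rightarrow> real \<Rightarrow> real" where
  "cD S \<beta> h D p q = Eeta (\<lambda>\<eta>. let m = mom S \<beta> h D p q in m 4 \<eta> - (m 2 \<eta>)^2)"

definition cF :: "nat \<Rightarrow> real \<Rightarrow> real \<Rightarrow> real \<Rightarrow> real \<Rightarrow> real \<Rightarrow> real" where
  "cF S \<beta> h D p q = Eeta (\<lambda>\<eta>. let m = mom S \<beta> h D p q in (m 2 \<eta>)^2 - (m 1 \<eta>)^2 * m 2 \<eta>)"

definition cG :: "nat \<Rightarrow> real \<Rightarrow> real \<Rightarrow> real \<Rightarrow> real \<Rightarrow> real \<Rightarrow> real" where
  "cG S \<beta> h D p q = Eeta (\<lambda>\<eta>. let m = mom S \<beta> h D p q in (m 1 \<eta>)^2 * (m 2 \<eta> - (m 1 \<eta>)^2))"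

definition cE :: "nat \<Rightarrow> real \<Rightarrow> real \<Rightarrow> real \<Rightarrow> real \<Rightarrow> real \<Rightarrow> real" where
  "cE S \<beta> h D p q = Eeta (\<lambda>\<eta>. let m = mom S \<beta> h D p q in m 1 \<eta> * (m 3 \<eta> - m 1 \<eta> * m 2 \<eta>))"

definition cM1 :: "nat \<Rightarrow> real \<Rightarrow> real \<Rightarrow> real \<Rightarrow> real \<Rightarrow> real \<Rightarrow> real" where
  "cM1 S \<beta> h D p q = 1 - \<beta>^2 * (cF S \<beta> h D p q - 3 * cG S \<beta> h D p q)"

definition cM2 :: "nat \<Rightarrow> real \<Rightarrow> real \<Rightarrow> real \<Rightarrow> real \<Rightarrow> real \<Rightarrow> real" where
  "cM2 S \<beta> h D p q = 1 - \<beta>^2 / 2 * cD S \<beta> h D p q"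

definition cM3 :: "nat \<Rightarrow> real \<Rightarrow> real \<Rightarrow> real \<Rightarrow> real \<Rightarrow> real \<Rightarrow> real" where
  "cM3 S \<beta> h D p q = 1 - \<beta>^2 * (cF S \<beta> h D p q - cG S \<beta> h D p q)"

definition cM :: "nat \<Rightarrow> real \<Rightarrow> real \<Rightarrow> real \<Rightarrow> real \<Rightarrow> real \<Rightarrow> real" where
  "cM S \<beta> h D p q = cM1 S \<beta> h D p q * cM2 S \<beta> h D p q + \<beta>^4 * (cE S \<beta> h D p q)^2"

definition A1sq :: "nat \<Rightarrow> nat \<Rightarrow> real \<Rightarrow> real \<Rightarrow> real \<Rightarrow> real \<Rightarrow> real \<Rightarrow> real" where
  "A1sq S N \<beta> h D p q =
     (cG S \<beta> h D p q * cM2 S \<beta> h D p q + \<beta>^2 / 2 * (cE S \<beta> h D p q)^2)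
     / (real N * cM S \<beta> h D p q * cM3 S \<beta> h D p q)"

definition B1sq :: "nat \<Rightarrow> nat \<Rightarrow> real \<Rightarrow> real \<Rightarrow> real \<Rightarrow> real \<Rightarrow> real \<Rightarrow> real" where
  "B1sq S N \<beta> h D p q =
     (cD S \<beta> h D p q * cM1 S \<beta> h D p q - 2 * \<beta>^2 * (cE S \<beta> h D p q)^2)
     / (real N * cM S \<beta> h D p q)"

definition C1sq :: "nat \<Rightarrow> nat \<Rightarrow> real \<Rightarrow> real \<Rightarrow> real \<Rightarrow> real \<Rightarrow> real \<Rightarrow> real" where
  "C1sq S N \<beta> h D p q = cE S \<beta> h D p q / (real N * cM S \<beta> h D p q)"

end

theory Submission
  imports Defs "HOL-Real_Asymp.Real_Asymp"
begin

text \<open>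
  Both \<open>T1\<close> and \<open>S1\<close> are centred replica overlaps, so the three quantities are differences of two-point functions
  \<open>\<nu> (x x')\<close> of overlaps \<open>x = R - q\<close> (off-diagonal) or \<open>x = R - p\<close> (diagonal). Writing an overlap as an average over sites
  and decoupling one site at a time by a Gaussian interpolation, the fixed point equations kill the zeroth order,
  and the first order expresses \<open>\<nu> (x x')\<close> through the single-site covariances and the other two-point functions.
  At high temperature the same cavity argument bounds the second and fourth moments of overlaps by \<open>O(1/N)\<close> and
  \<open>O(1/N\<^sup>2)\<close>, so all remainders are \<open>O(N\<^sup>-\<^sup>3\<^sup>/\<^sup>2)\<close>. Replica symmetry leaves four unknown differences, and they satisfy
  a linear system with determinants \<open>M\<close>, \<open>M1\<close> and \<open>M3\<close>, whose solution gives the stated constants.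
  Existence and uniqueness of \<open>(p, q)\<close> is a contraction estimate obtained from the same interpolation.
\<close>

section \<open>Gaussian integration by parts\<close>

text \<open>The remainders of the cavity expansion are averages along the path, at angles where
  nothing is known about overlaps. Since overlaps are bounded, a nonnegative average changes along
  the path by a bounded factor at most, so it is dominated by the same average in the full system;
  all estimates then need only moments of the full system.

  The moment bound is self-referential: the first-order term returns the moment being estimated with
  a factor of order \<beta>^2, and small \<beta> absorbs it on the left.

  Centring by a Gibbs average is expressed through an independent replica: replacing replica 0 by
  replica 1 in one factor and subtracting turns a two-point function into a covariance. The equation
  for \<open>\<nu> (T1^2)\<close> brings in the overlap of two centred replicas, which is the fourth
  unknown; its own equation is closed.

  The threshold is \<open>1 / L\<close>, where \<open>L\<close> depends on \<open>S\<close> only: it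
  collects the contraction, the absorption of moments and lower bounds for \<open>M1\<close>,
  \<open>M2\<close>, \<open>M3\<close>.\<close>

lemma DERIV_lebesgue_integral:
  fixes f f' :: "real \<Rightarrow> 'a \<Rightarrow> real"
  assumes int: "\<And>t. integrable M (f t)"
    and der: "\<And>t x. x \<in> space M \<Longrightarrow> ((\<lambda>t. f t x) has_real_derivative f' t x) (at t)"
    and meas: "\<And>t. f' t \<in> borel_measurable M"
    and w: "integrable M w"
    and bound: "\<And>t x. x \<in> space M \<Longrightarrow> \<bar>f' t x\<bar> \<le> w x"
  shows "((\<lambda>t. \<integral>x. f t x \<partial>M) has_real_derivative (\<integral>x. f' t x \<partial>M)) (at t)"
proof -
  have "((\<lambda>y. ((\<integral>x. f y x \<partial>M) - (\<integral>x. f t x \<partial>M)) / (y - t)) \<longlongrightarrow> (\<integral>x. f' t x \<partial>M)) (at t)"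
    unfolding tendsto_at_iff_sequentially comp_def
  proof (intro allI impI)
    fix X :: "nat \<Rightarrow> real" assume X: "\<forall>i. X i \<in> UNIV - {t}" and lim: "X \<longlonglongrightarrow> t"
    let ?s = "\<lambda>i x. (f (X i) x - f t x) / (X i - t)"
    have eq: "((\<integral>x. f (X i) x \<partial>M) - (\<integral>x. f t x \<partial>M)) / (X i - t) = (\<integral>x. ?s i x \<partial>M)" for i
      by (simp add: int)
    have "(\<lambda>i. \<integral>x. ?s i x \<partial>M) \<longlonglongrightarrow> (\<integral>x. f' t x \<partial>M)"
    proof (rule integral_dominated_convergence[where w = w])
      show "AE x in M. (\<lambda>i. ?s i x) \<longlonglongrightarrow> f' t x"
      proof (rule AE_I2)
        fix x assume "x \<in> space M"
        from der[OF this, of t] have "((\<lambda>y. (f y x - f t x) / (y - t)) \<longlongrightarrow> f' t x) (at t)"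
          by (simp add: has_field_derivative_iff)
        then show "(\<lambda>i. ?s i x) \<longlonglongrightarrow> f' t x"
          unfolding tendsto_at_iff_sequentially comp_def using X lim by blast
      qed
      show "AE x in M. norm (?s i x) \<le> w x" for i
      proof (rule AE_I2)
        fix x assume x: "x \<in> space M"
        \<comment> \<open>By the mean value theorem every difference quotient inherits the bound
          \<open>w\<close>, uniformly along the sequence.\<close>
        have "norm (f (X i) x - f t x) \<le> w x * norm (X i - t)"
          by (rule field_differentiable_bound[where S = UNIV and f' = "\<lambda>t. f' t x"])
            (use der[OF x] bound[OF x] in auto)
        then show "norm (?s i x) \<le> w x" using X by (auto simp: field_simps)
      qed
    qed (use int w meas in auto)
    then show "(\<lambda>i. ((\<integral>x. f (X i) x \<partial>M) - (\<integral>x. f t x \<partial>M)) / (X i - t)) \<longlonglongrightarrow> (\<integral>x. f' t x \<partial>M)"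
      by (simp add: eq)
  qed
  then show ?thesis by (simp add: has_field_derivative_iff)
qed

lemma sets_stdN [simp]: "sets stdN = sets borel"
  by (simp add: stdN_def)

lemma borel_measurable_stdN [simp]: "borel_measurable stdN = borel_measurable borel"
  by (rule measurable_cong_sets) auto

lemma space_stdN [simp]: "space stdN = UNIV"
  by (simp add: stdN_def)

lemma prob_space_stdN: "prob_space stdN"
  unfolding stdN_def by (rule prob_space_normal_density) simp

lemma integral_stdN:
  fixes f :: "real \<Rightarrow> real"
  assumes [measurable]: "f \<in> borel_measurable borel"
  shows "(\<integral>x. f x \<partial>stdN) = (\<integral>x. std_normal_density x * f x \<partial>lborel)"
  unfolding stdN_def by (subst integral_density) auto

lemma integrable_stdN_iff:
  fixes f :: "real \<Rightarrow> real"
  assumes [measurable]: "f \<in> borel_measurable borel"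
  shows "integrable stdN f \<longleftrightarrow> integrable lborel (\<lambda>x. std_normal_density x * f x)"
  unfolding stdN_def by (subst integrable_density) auto

lemma integrable_stdN_abs: "integrable stdN (\<lambda>x. \<bar>x\<bar>)"
  using integrable_std_normal_moment_abs[of 1] by (simp add: integrable_stdN_iff)

lemma integrable_stdN_mult_bounded:
  fixes f :: "real \<Rightarrow> real"
  assumes [measurable]: "f \<in> borel_measurable borel" and b: "\<And>x. \<bar>f x\<bar> \<le> B"
  shows "integrable stdN (\<lambda>x. x * f x)"
proof (rule Bochner_Integration.integrable_bound[where f = "\<lambda>x. B * \<bar>x\<bar>"])
  show "integrable stdN (\<lambda>x. B * \<bar>x\<bar>)" using integrable_stdN_abs by simp
  have "\<bar>x * f x\<bar> \<le> \<bar>B * \<bar>x\<bar>\<bar>" for x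
    using mult_mono[OF b[of x] order_refl, of "\<bar>x\<bar>"] b[of x] by (simp add: abs_mult mult.commute)
  then show "AE x in stdN. norm (x * f x) \<le> norm (B * \<bar>x\<bar>)" by simp
qed simp

lemma std_normal_density_tendsto:
  "(std_normal_density \<longlongrightarrow> 0) at_top" "(std_normal_density \<longlongrightarrow> 0) at_bot"
proof -
  have "((\<lambda>x::real. exp (- x\<^sup>2 / 2)) \<longlongrightarrow> 0) at_top" "((\<lambda>x::real. exp (- x\<^sup>2 / 2)) \<longlongrightarrow> 0) at_bot"
    by real_asymp+
  then show "(std_normal_density \<longlongrightarrow> 0) at_top" "(std_normal_density \<longlongrightarrow> 0) at_bot"
    unfolding std_normal_density_def by (auto dest: tendsto_mult_left[where c = "1 / sqrt (2 * pi)"])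
qed

text \<open>The density d satisfies d' = -x d, so the difference of the two integrands is the
  derivative of \<open>f x * std_normal_density x\<close>. This function vanishes at both ends of
  the line because \<open>f\<close> is bounded.\<close>

lemma stdN_integral_by_parts:
  fixes f f' :: "real \<Rightarrow> real"
  assumes der: "\<And>x. (f has_real_derivative f' x) (at x)"
    and cont: "\<And>x. isCont f' x"
    and b: "\<And>x. \<bar>f x\<bar> \<le> B" and b': "\<And>x. \<bar>f' x\<bar> \<le> B'"
  shows "(\<integral>x. x * f x \<partial>stdN) = (\<integral>x. f' x \<partial>stdN)"
proof -
  let ?d = std_normal_density
  interpret stdN: prob_space stdN by (rule prob_space_stdN)
  have contf: "isCont f x" for x using der DERIV_isCont by blast
  have [measurable]: "f \<in> borel_measurable borel" "f' \<in> borel_measurable borel"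
    using contf cont by (auto intro!: borel_measurable_continuous_onI simp: continuous_on_eq_continuous_at)
  have i1: "integrable stdN f'"
    by (rule stdN.integrable_const_bound[where B = B']) (use b' in auto)
  have i2: "integrable stdN (\<lambda>x. x * f x)"
    by (rule integrable_stdN_mult_bounded[where B = B]) (use b in auto)
  let ?F = "\<lambda>x. f x * ?d x" and ?g = "\<lambda>x. ?d x * f' x - ?d x * (x * f x)"
  have ig: "integrable lborel ?g"
    using i1 i2 by (auto simp: integrable_stdN_iff)
  have dd: "(?d has_real_derivative - x * ?d x) (at x)" for x
  proof -
    have "((\<lambda>x. exp (- x\<^sup>2 / 2)) has_real_derivative - x * exp (- x\<^sup>2 / 2)) (at x)"
      by (auto intro!: derivative_eq_intros)
    from DERIV_cmult[OF this, of "1 / sqrt (2 * pi)"] show ?thesis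
      unfolding std_normal_density_def by (simp add: mult_ac)
  qed
  have "(LBINT x=-\<infinity>..\<infinity>. ?g x) = 0 - 0"
  proof (rule interval_integral_FTC_integrable[where F = ?F])
    fix x
    have "(?F has_real_derivative ?g x) (at x)"
      using DERIV_mult[OF der[of x] dd[of x]] by (simp add: algebra_simps)
    then show "(?F has_vector_derivative ?g x) (at x)"
      by (simp add: has_real_derivative_iff_has_vector_derivative)
    have "isCont ?d x" using dd DERIV_isCont by blast
    then show "isCont ?g x" using contf cont by (intro continuous_intros) auto
  next
    show "set_integrable lborel (einterval (-\<infinity>) \<infinity>) ?g"
      using ig by (simp add: set_integrable_def)
    have "((\<lambda>x. f x * ?d x) \<longlongrightarrow> 0) F" if "(?d \<longlongrightarrow> 0) F" for F
    proof (rule Lim_null_comparison[where g = "\<lambda>x. B * ?d x"])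
      show "\<forall>\<^sub>F x in F. norm (f x * ?d x) \<le> B * ?d x"
        using b by (intro always_eventually) (auto simp: abs_mult intro!: mult_right_mono)
      show "((\<lambda>x. B * ?d x) \<longlongrightarrow> 0) F" using tendsto_mult[OF tendsto_const[of B] that] by simp
    qed
    from this[OF std_normal_density_tendsto(1)] this[OF std_normal_density_tendsto(2)]
    show "((?F \<circ> real_of_ereal) \<longlongrightarrow> 0) (at_right (-\<infinity>))"
      "((?F \<circ> real_of_ereal) \<longlongrightarrow> 0) (at_left \<infinity>)"
      by (simp_all add: ereal_tendsto_simps)
  qed simp
  then have "(\<integral>x. ?g x \<partial>lborel) = 0"
    by (simp add: interval_lebesgue_integral_def set_lebesgue_integral_def)
  also have "(\<integral>x. ?g x \<partial>lborel) = (\<integral>x. f' x \<partial>stdN) - (\<integral>x. x * f x \<partial>stdN)"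
    using i1 i2 by (subst Bochner_Integration.integral_diff) (auto simp: integrable_stdN_iff integral_stdN)
  finally show ?thesis by simp
qed

section \<open>Independent standard Gaussians over an index set\<close>

definition gaussians :: "'j set \<Rightarrow> ('j \<Rightarrow> real) measure" where
  "gaussians J = PiM J (\<lambda>_. stdN)"

lemma sets_gaussians: "sets (gaussians J) = sets (PiM J (\<lambda>_. borel))"
  unfolding gaussians_def by (intro sets_PiM_cong) auto

lemma prob_space_gaussians: "prob_space (gaussians J)"
  unfolding gaussians_def by (intro prob_space_PiM prob_space_stdN)

lemma distr_gaussians_component:
  "j \<in> J \<Longrightarrow> distr (gaussians J) stdN (\<lambda>g. g j) = stdN"
  unfolding gaussians_def by (rule distr_PiM_component) (auto intro: prob_space_stdN)

lemma measurable_gaussians_component: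
  "j \<in> J \<Longrightarrow> (\<lambda>g. g j) \<in> borel_measurable (gaussians J)"
  by (subst measurable_cong_sets[OF sets_gaussians refl]) simp

lemma integral_gaussians_component:
  fixes f :: "real \<Rightarrow> real"
  assumes "j \<in> J" and [measurable]: "f \<in> borel_measurable borel"
  shows "(\<integral>g. f (g j) \<partial>gaussians J) = (\<integral>x. f x \<partial>stdN)"
  by (subst distr_gaussians_component[OF assms(1), symmetric], subst integral_distr)
    (use assms in \<open>auto simp: measurable_cong_sets[OF refl sets_stdN] measurable_gaussians_component\<close>)

lemma integrable_gaussians_component_abs:
  assumes "j \<in> J" shows "integrable (gaussians J) (\<lambda>g. \<bar>g j\<bar>)"
proof -
  have "integrable (distr (gaussians J) stdN (\<lambda>g. g j)) (\<lambda>x. \<bar>x\<bar>)"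
    by (simp add: distr_gaussians_component[OF assms] integrable_stdN_abs)
  then show ?thesis
    by (subst (asm) integrable_distr_eq) (use assms in \<open>auto simp: measurable_cong_sets[OF refl sets_stdN] measurable_gaussians_component\<close>)
qed

lemma integrable_gaussians_component_mult:
  fixes F :: "('j \<Rightarrow> real) \<Rightarrow> real"
  assumes j: "j \<in> J" and [measurable]: "F \<in> borel_measurable (gaussians J)"
    and b: "\<And>g. \<bar>F g\<bar> \<le> B"
  shows "integrable (gaussians J) (\<lambda>g. g j * F g)"
proof (rule Bochner_Integration.integrable_bound[where f = "\<lambda>g. B * \<bar>g j\<bar>"])
  show "integrable (gaussians J) (\<lambda>g. B * \<bar>g j\<bar>)" using integrable_gaussians_component_abs[OF j] by simp
  have "\<bar>g j * F g\<bar> \<le> \<bar>B * \<bar>g j\<bar>\<bar>" for g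
    using mult_mono[OF b[of g] order_refl, of "\<bar>g j\<bar>"] b[of g] by (simp add: abs_mult mult.commute)
  then show "AE g in gaussians J. norm (g j * F g) \<le> norm (B * \<bar>g j\<bar>)" by simp
qed (intro borel_measurable_times measurable_gaussians_component j assms(2))

lemma integral_gaussians_insert:
  fixes F :: "('j \<Rightarrow> real) \<Rightarrow> real"
  assumes "finite I" "i \<notin> I" "integrable (gaussians (insert i I)) F"
  shows "(\<integral>g. F g \<partial>gaussians (insert i I)) = (\<integral>g. (\<integral>y. F (g(i := y)) \<partial>stdN) \<partial>gaussians I)"
proof -
  interpret stdN: prob_space stdN by (rule prob_space_stdN)
  interpret product_sigma_finite "\<lambda>_. stdN" by unfold_locales
  show ?thesis using assms unfolding gaussians_def by (rule product_integral_insert)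
qed

text \<open>Fubini isolates coordinate \<open>j\<close>; for every value of the others the
  one-dimensional formula applies with the same bounds.\<close>

lemma gaussians_integral_by_parts:
  fixes F F' :: "('j \<Rightarrow> real) \<Rightarrow> real"
  assumes fin: "finite J" and j: "j \<in> J"
    and [measurable]: "F \<in> borel_measurable (gaussians J)" "F' \<in> borel_measurable (gaussians J)"
    and der: "\<And>g x. ((\<lambda>x. F (g(j := x))) has_real_derivative F' (g(j := x))) (at x)"
    and cont: "\<And>g x. isCont (\<lambda>x. F' (g(j := x))) x"
    and b: "\<And>g. \<bar>F g\<bar> \<le> B" and b': "\<And>g. \<bar>F' g\<bar> \<le> B'"
  shows "(\<integral>g. g j * F g \<partial>gaussians J) = (\<integral>g. F' g \<partial>gaussians J)"
proof -
  interpret prob_space "gaussians J" by (rule prob_space_gaussians)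
  define I where "I = J - {j}"
  have J: "J = insert j I" "finite I" "j \<notin> I" using fin j by (auto simp: I_def)
  have int: "integrable (gaussians J) (\<lambda>g. g j * F g)"
    by (rule integrable_gaussians_component_mult[OF j assms(3)]) (rule b)
  have int': "integrable (gaussians J) F'"
    by (rule integrable_const_bound[where B = B', OF AE_I2 assms(4)]) (simp add: b')
  have eq: "(\<integral>y. y * F (g(j := y)) \<partial>stdN) = (\<integral>y. F' (g(j := y)) \<partial>stdN)" for g
    by (rule stdN_integral_by_parts[where f = "\<lambda>y. F (g(j := y))" and f' = "\<lambda>y. F' (g(j := y))"
          and B = B and B' = B']) (rule der cont b b')+
  show ?thesis
    using integral_gaussians_insert[OF J(2,3), of "\<lambda>g. g j * F g"]
      integral_gaussians_insert[OF J(2,3), of F'] int int'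
    unfolding J(1)[symmetric] by (simp add: eq)
qed

section \<open>Replica averages\<close>

definition prb :: "'x set \<Rightarrow> ('x \<Rightarrow> real) \<Rightarrow> 'x \<Rightarrow> real" where
  "prb X H x = exp (H x) / (\<Sum>y\<in>X. exp (H y))"

text \<open>The weights may differ between replicas, so that Gibbs measures can be exchanged one replica at a time.\<close>

definition rep :: "nat \<Rightarrow> 'x set \<Rightarrow> (nat \<Rightarrow> 'x \<Rightarrow> real) \<Rightarrow> ((nat \<Rightarrow> 'x) \<Rightarrow> real) \<Rightarrow> real" where
  "rep R X w F = (\<Sum>\<sigma>\<in>PiE {..<R} (\<lambda>_. X). (\<Prod>r<R. w r (\<sigma> r)) * F \<sigma>)"

lemma rep_add: "rep R X w (\<lambda>\<sigma>. F \<sigma> + G \<sigma>) = rep R X w F + rep R X w G"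
  by (simp add: rep_def algebra_simps sum.distrib)

lemma rep_diff: "rep R X w (\<lambda>\<sigma>. F \<sigma> - G \<sigma>) = rep R X w F - rep R X w G"
  by (simp add: rep_def algebra_simps sum_subtractf)

lemma rep_cmult: "rep R X w (\<lambda>\<sigma>. c * F \<sigma>) = c * rep R X w F"
  by (simp add: rep_def sum_distrib_left mult_ac)

lemma rep_sum: "rep R X w (\<lambda>\<sigma>. \<Sum>i\<in>I. F i \<sigma>) = (\<Sum>i\<in>I. rep R X w (F i))"
  unfolding rep_def by (subst sum.swap) (simp add: sum_distrib_left)

lemma rep_cong:
  "(\<And>\<sigma>. \<sigma> \<in> PiE {..<R} (\<lambda>_. X) \<Longrightarrow> F \<sigma> = G \<sigma>) \<Longrightarrow> rep R X w F = rep R X w G"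
  by (simp add: rep_def)

lemma rep_mono:
  assumes "\<And>r x. x \<in> X \<Longrightarrow> 0 \<le> w r x"
    and "\<And>\<sigma>. \<sigma> \<in> PiE {..<R} (\<lambda>_. X) \<Longrightarrow> F \<sigma> \<le> G \<sigma>"
  shows "rep R X w F \<le> rep R X w G"
  unfolding rep_def using assms by (intro sum_mono mult_left_mono prod_nonneg) (auto simp: PiE_def Pi_def)

lemma sum_PiE_split:
  assumes b: "b \<in> I"
  shows "(\<Sum>\<sigma>\<in>PiE I (\<lambda>_. X). F \<sigma>) = (\<Sum>\<sigma>\<in>PiE (I - {b}) (\<lambda>_. X). \<Sum>x\<in>X. F (\<sigma>(b := x)))"
proof -
  let ?I = "I - {b}"
  have ins: "I = insert b ?I" using b by auto
  have "(\<Sum>\<sigma>\<in>PiE I (\<lambda>_. X). F \<sigma>) = (\<Sum>\<sigma>\<in>PiE (insert b ?I) (\<lambda>_. X). F \<sigma>)"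
    using ins by simp
  also have "\<dots> = (\<Sum>(x, \<sigma>)\<in>X \<times> PiE ?I (\<lambda>_. X). F (\<sigma>(b := x)))"
    unfolding PiE_insert_eq
    by (subst sum.reindex) (use inj_combinator[of b ?I "\<lambda>_. X"] in \<open>auto simp: case_prod_unfold intro!: sum.cong\<close>)
  also have "\<dots> = (\<Sum>\<sigma>\<in>PiE ?I (\<lambda>_. X). \<Sum>x\<in>X. F (\<sigma>(b := x)))"
    by (subst sum.cartesian_product[symmetric], subst sum.swap) simp
  finally show ?thesis .
qed

lemma rep_split:
  assumes b: "b < R"
  shows "rep R X w F = (\<Sum>\<sigma>\<in>PiE ({..<R} - {b}) (\<lambda>_. X).
    (\<Prod>r\<in>{..<R} - {b}. w r (\<sigma> r)) * (\<Sum>x\<in>X. w b x * F (\<sigma>(b := x))))"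
proof -
  have "(\<Prod>r<R. w r ((\<sigma>(b := x)) r)) = w b x * (\<Prod>r\<in>{..<R} - {b}. w r (\<sigma> r))" for \<sigma> x
    using b by (subst prod.remove[of _ b]) (auto intro!: prod.cong)
  moreover have "b \<in> {..<R}" using b by simp
  ultimately show ?thesis
    unfolding rep_def by (subst sum_PiE_split[where b = b]) (simp_all add: sum_distrib_left sum_distrib_right mult_ac)
qed

lemma rep_indep:
  assumes b: "b < R" and F: "\<And>\<sigma> x. F (\<sigma>(b := x)) = F \<sigma>" and w: "(\<Sum>x\<in>X. w b x) = 1"
  shows "rep R X w (\<lambda>\<sigma>. F \<sigma> * \<phi> (\<sigma> b)) = rep R X w F * (\<Sum>x\<in>X. w b x * \<phi> x)"
proof -
  have *: "(\<Sum>x\<in>X. w b x * (F (\<sigma>(b := x)) * \<phi> ((\<sigma>(b := x)) b))) = F \<sigma> * (\<Sum>x\<in>X. w b x * \<phi> x)" for \<sigma>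
    by (simp add: F sum_distrib_left mult_ac)
  have **: "(\<Sum>x\<in>X. w b x * F (\<sigma>(b := x))) = F \<sigma>" for \<sigma>
    by (simp add: F w flip: sum_distrib_right)
  show ?thesis
    unfolding rep_split[OF b] * ** by (subst sum_distrib_right) (simp add: mult.assoc)
qed

lemma rep_one:
  assumes "\<And>r. (\<Sum>x\<in>X. w r x) = 1"
  shows "rep R X w (\<lambda>_. 1) = 1"
proof (induction R)
  case 0 show ?case by (simp add: rep_def)
next
  case (Suc R)
  have eq: "{..<Suc R} - {R} = {..<R}" by auto
  show ?case using Suc rep_split[of R "Suc R" X w "\<lambda>_. 1"]
    by (simp add: eq assms) (simp add: rep_def)
qed

text \<open>The condition concerns a single replica with all others frozen, so the weights are
  exchanged one replica at a time: after \<open>m\<close> exchanges the replicas below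
  \<open>m\<close> carry \<open>w'\<close>.\<close>

lemma rep_change_weights:
  assumes eq: "\<And>b \<sigma>. b < R \<Longrightarrow> (\<Sum>x\<in>X. w b x * F (\<sigma>(b := x))) = (\<Sum>x\<in>X. w' b x * F (\<sigma>(b := x)))"
  shows "rep R X w F = rep R X w' F"
proof -
  have step: "m \<le> R \<Longrightarrow> rep R X (\<lambda>r. if r < m then w' r else w r) F = rep R X w F" for m
  proof (induction m)
    case (Suc m)
    let ?w = "\<lambda>m r. if r < m then w' r else w r"
    have m: "m < R" using Suc by simp
    have p: "(\<Prod>r\<in>{..<R} - {m}. ?w (Suc m) r (\<sigma> r)) = (\<Prod>r\<in>{..<R} - {m}. ?w m r (\<sigma> r))" for \<sigma>
      by (intro prod.cong) auto
    have q: "(\<Sum>x\<in>X. ?w (Suc m) m x * F (\<sigma>(m := x))) = (\<Sum>x\<in>X. ?w m m x * F (\<sigma>(m := x)))" for \<sigma>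
      using eq[OF m, of \<sigma>] by simp
    have "rep R X (?w (Suc m)) F = rep R X (?w m) F"
      unfolding rep_split[OF m] p q ..
    then show ?case using Suc by simp
  qed simp
  have "(\<Prod>r<R. (if r < R then w' r else w r) (\<sigma> r)) = (\<Prod>r<R. w' r (\<sigma> r))" for \<sigma>
    by (intro prod.cong) auto
  then show ?thesis using step[of R] by (simp add: rep_def)
qed

lemma rep_permute:
  assumes \<pi>: "\<pi> permutes {..<R}"
  shows "rep R X (\<lambda>_. w) (\<lambda>\<sigma>. F (\<sigma> \<circ> \<pi>)) = rep R X (\<lambda>_. w) F"
proof -
  let ?S = "PiE {..<R} (\<lambda>_. X)"
  have mem: "\<sigma> \<circ> \<pi> \<in> ?S" if "\<sigma> \<in> ?S" "\<pi> permutes {..<R}" for \<sigma> \<pi>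
    using that permutes_in_image[OF that(2)] permutes_not_in[OF that(2)]
    by (auto simp: PiE_def Pi_def extensional_def)
  have bij: "bij_betw (\<lambda>\<sigma>. \<sigma> \<circ> \<pi>) ?S ?S"
    by (rule bij_betw_byWitness[where f' = "\<lambda>\<sigma>. \<sigma> \<circ> inv \<pi>"])
      (use mem \<pi> permutes_inv[OF \<pi>] in \<open>auto simp: comp_assoc permutes_inv_o[OF \<pi>]\<close>)
  have "rep R X (\<lambda>_. w) F = (\<Sum>\<sigma>\<in>?S. (\<Prod>r<R. w ((\<sigma> \<circ> \<pi>) r)) * F (\<sigma> \<circ> \<pi>))"
    unfolding rep_def by (subst sum.reindex_bij_betw[OF bij, symmetric]) simp
  moreover have "(\<Prod>r<R. w ((\<sigma> \<circ> \<pi>) r)) = (\<Prod>r<R. w (\<sigma> r))" for \<sigma> :: "nat \<Rightarrow> 'a"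
    using prod.permute[OF \<pi>, of "\<lambda>r. w (\<sigma> r)"] by (simp add: comp_def)
  ultimately show ?thesis by (simp add: rep_def)
qed

section \<open>Derivatives of replica averages\<close>

definition depn :: "nat \<Rightarrow> ((nat \<Rightarrow> 'x) \<Rightarrow> real) \<Rightarrow> bool" where
  "depn n F \<longleftrightarrow> (\<forall>b\<ge>n. \<forall>\<sigma> x. F (\<sigma>(b := x)) = F \<sigma>)"

lemma depnD: "depn n F \<Longrightarrow> n \<le> b \<Longrightarrow> F (\<sigma>(b := x)) = F \<sigma>"
  by (simp add: depn_def)

text \<open>Differentiating a replica average brings down one new replica, with weight minus the number of old ones.\<close>

definition rc :: "nat \<Rightarrow> nat \<Rightarrow> real" where
  "rc n a = (if a < n then 1 else - real n)"

definition rsum :: "nat \<Rightarrow> ('x \<Rightarrow> real) \<Rightarrow> (nat \<Rightarrow> 'x) \<Rightarrow> real" where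
  "rsum n \<phi> \<sigma> = (\<Sum>a\<le>n. rc n a * \<phi> (\<sigma> a))"

lemma prb_nonneg: "0 \<le> prb X H x"
  by (simp add: prb_def sum_nonneg)

lemma sum_prb:
  assumes "finite X" "X \<noteq> {}" shows "(\<Sum>x\<in>X. prb X H x) = 1"
proof -
  have "(\<Sum>y\<in>X. exp (H y)) > 0" using assms by (intro sum_pos) auto
  then show ?thesis by (simp add: prb_def flip: sum_divide_distrib)
qed

definition gav :: "nat \<Rightarrow> 'x set \<Rightarrow> ('x \<Rightarrow> real) \<Rightarrow> ((nat \<Rightarrow> 'x) \<Rightarrow> real) \<Rightarrow> real" where
  "gav R X H F = rep R X (\<lambda>_. prb X H) F"

lemma gav_mono:
  "(\<And>\<sigma>. \<sigma> \<in> PiE {..<R} (\<lambda>_. X) \<Longrightarrow> F \<sigma> \<le> G \<sigma>) \<Longrightarrow> gav R X H F \<le> gav R X H G"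
  unfolding gav_def by (rule rep_mono) (auto simp: prb_nonneg)

lemma gav_const:
  assumes "finite X" "X \<noteq> {}" shows "gav R X H (\<lambda>_. c) = c"
  using rep_cmult[of R X "\<lambda>_. prb X H" c "\<lambda>_. 1"] rep_one[where X = X and w = "\<lambda>_. prb X H" and R = R] sum_prb[OF assms]
  by (simp add: gav_def)

lemma gav_abs_le: "\<bar>gav R X H F\<bar> \<le> gav R X H (\<lambda>\<sigma>. \<bar>F \<sigma>\<bar>)"
  unfolding gav_def rep_def
  by (rule order_trans[OF sum_abs]) (simp add: abs_mult abs_prod prb_nonneg)

lemma gav_bound:
  assumes "finite X" "X \<noteq> {}" "\<And>\<sigma>. \<sigma> \<in> PiE {..<R} (\<lambda>_. X) \<Longrightarrow> \<bar>F \<sigma>\<bar> \<le> B"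
  shows "\<bar>gav R X H F\<bar> \<le> B"
  using gav_abs_le[of R X H F] gav_mono[of R X "\<lambda>\<sigma>. \<bar>F \<sigma>\<bar>" "\<lambda>_. B" H] assms
  by (simp add: gav_const)

text \<open>Differentiating the normalised weights gives a factor
  \<open>\<phi> (\<sigma> r) - m\<close> for every replica. For \<open>r \<ge> n\<close> it is
  independent of \<open>F\<close> and averages to zero. For the \<open>n\<close> old replicas the
  mean \<open>m\<close> is represented by the fresh replica \<open>n\<close>, which turns the sum
  into \<open>rsum n \<phi>\<close>.\<close>

lemma gav_DERIV:
  fixes H :: "real \<Rightarrow> 'x \<Rightarrow> real" and \<phi> :: "'x \<Rightarrow> real"
  assumes X: "finite X" "X \<noteq> {}" and n: "n < R" and F: "depn n F"
    and H: "\<And>x. x \<in> X \<Longrightarrow> ((\<lambda>t. H t x) has_real_derivative \<phi> x) (at t)"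
  shows "((\<lambda>t. gav R X (H t) F) has_real_derivative gav R X (H t) (\<lambda>\<sigma>. F \<sigma> * rsum n \<phi> \<sigma>)) (at t)"
proof -
  let ?Z = "\<lambda>t. \<Sum>y\<in>X. exp (H t y)" and ?p = "prb X (H t)"
  define m where "m = (\<Sum>x\<in>X. ?p x * \<phi> x)"
  have Z: "?Z t > 0" for t using X by (intro sum_pos) auto
  have prb: "prb X (H t) x = exp (H t x - ln (?Z t))" for t x
    using Z[of t] by (simp add: prb_def exp_diff)
  have dZ: "(?Z has_real_derivative (\<Sum>x\<in>X. exp (H t x) * \<phi> x)) (at t)"
    by (auto intro!: derivative_eq_intros H)
  have "((\<lambda>t. ln (?Z t)) has_real_derivative (\<Sum>x\<in>X. exp (H t x) * \<phi> x) / ?Z t) (at t)"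
    using DERIV_chain2[OF DERIV_ln_divide[OF Z] dZ] by simp
  also have "(\<Sum>x\<in>X. exp (H t x) * \<phi> x) / ?Z t = m"
    by (simp add: m_def prb_def sum_divide_distrib)
  finally have dln: "((\<lambda>t. ln (?Z t)) has_real_derivative m) (at t)" .
  have "((\<lambda>t. (\<Prod>r<R. prb X (H t) (\<sigma> r)) * F \<sigma>) has_real_derivative
      (\<Prod>r<R. ?p (\<sigma> r)) * (F \<sigma> * (\<Sum>r<R. \<phi> (\<sigma> r) - m))) (at t)"
    if "\<sigma> \<in> PiE {..<R} (\<lambda>_. X)" for \<sigma>
  proof -
    have "\<And>r. r < R \<Longrightarrow> \<sigma> r \<in> X" using that by auto
    then have "((\<lambda>t. \<Sum>r<R. H t (\<sigma> r) - ln (?Z t)) has_real_derivative (\<Sum>r<R. \<phi> (\<sigma> r) - m)) (at t)"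
      by (intro DERIV_sum DERIV_diff H dln) auto
    from DERIV_cmult_right[OF DERIV_chain2[OF DERIV_exp this], of "F \<sigma>"]
    show ?thesis by (simp add: prb exp_sum mult_ac)
  qed
  then have "((\<lambda>t. gav R X (H t) F) has_real_derivative
      gav R X (H t) (\<lambda>\<sigma>. F \<sigma> * (\<Sum>r<R. \<phi> (\<sigma> r) - m))) (at t)"
    unfolding gav_def rep_def by (intro DERIV_sum)
  moreover have "gav R X (H t) (\<lambda>\<sigma>. F \<sigma> * (\<Sum>r<R. \<phi> (\<sigma> r) - m)) = gav R X (H t) (\<lambda>\<sigma>. F \<sigma> * rsum n \<phi> \<sigma>)"
  proof -
    let ?g = "gav R X (H t)"
    have ind: "?g (\<lambda>\<sigma>. F \<sigma> * \<phi> (\<sigma> r)) = ?g F * m" if "n \<le> r" "r < R" for r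
      unfolding gav_def m_def using that F by (intro rep_indep) (auto simp: sum_prb X depnD)
    have each: "?g (\<lambda>\<sigma>. F \<sigma> * (\<phi> (\<sigma> r) - m)) = (if r < n then ?g (\<lambda>\<sigma>. F \<sigma> * \<phi> (\<sigma> r)) - ?g F * m else 0)"
      if "r < R" for r
    proof -
      have "?g (\<lambda>\<sigma>. F \<sigma> * (\<phi> (\<sigma> r) - m)) = ?g (\<lambda>\<sigma>. F \<sigma> * \<phi> (\<sigma> r)) - ?g (\<lambda>\<sigma>. m * F \<sigma>)"
        by (simp add: gav_def algebra_simps flip: rep_diff)
      also have "?g (\<lambda>\<sigma>. m * F \<sigma>) = m * ?g F" by (simp add: gav_def rep_cmult)
      finally show ?thesis using ind[of r] that by auto
    qed
    have "?g (\<lambda>\<sigma>. F \<sigma> * (\<Sum>r<R. \<phi> (\<sigma> r) - m)) = (\<Sum>r<R. ?g (\<lambda>\<sigma>. F \<sigma> * (\<phi> (\<sigma> r) - m)))"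
      unfolding gav_def by (simp add: sum_distrib_left rep_sum del: sum_subtractf)
    also have "\<dots> = (\<Sum>r<R. if r < n then ?g (\<lambda>\<sigma>. F \<sigma> * \<phi> (\<sigma> r)) - ?g F * m else 0)"
      by (intro sum.cong refl each) auto
    also have "\<dots> = (\<Sum>r<n. ?g (\<lambda>\<sigma>. F \<sigma> * \<phi> (\<sigma> r)) - ?g F * m)"
      using n by (subst sum.inter_filter[symmetric]) (auto intro!: sum.cong)
    also have "\<dots> = (\<Sum>r<n. ?g (\<lambda>\<sigma>. F \<sigma> * \<phi> (\<sigma> r))) - n * ?g (\<lambda>\<sigma>. F \<sigma> * \<phi> (\<sigma> n))"
      using ind[of n] n by (simp add: sum_subtractf)
    also have "\<dots> = (\<Sum>r\<le>n. rc n r * ?g (\<lambda>\<sigma>. F \<sigma> * \<phi> (\<sigma> r)))"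
      by (simp add: lessThan_Suc_atMost[symmetric] rc_def)
    also have "\<dots> = ?g (\<lambda>\<sigma>. F \<sigma> * rsum n \<phi> \<sigma>)"
      unfolding gav_def rsum_def sum_distrib_left rep_sum
      by (simp add: mult.left_commute[of _ "rc n _"] rep_cmult)
    finally show ?thesis .
  qed
  ultimately show ?thesis by simp
qed

lemma depn_mono: "depn n F \<Longrightarrow> n \<le> m \<Longrightarrow> depn m F"
  by (auto simp: depn_def)

lemma depn_mult_rsum: "depn n F \<Longrightarrow> depn (Suc n) (\<lambda>\<sigma>. F \<sigma> * rsum n \<phi> \<sigma>)"
  by (auto simp: depn_def rsum_def intro!: sum.cong)


section \<open>Gaussian interpolation\<close>

lemma DERIV_upd_sum:
  fixes g :: "'j \<Rightarrow> real"
  assumes "finite J" "j \<in> J"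
  shows "((\<lambda>y. \<Sum>i\<in>J. b i * (g(j := y)) i * v i) has_real_derivative b j * v j) (at y)"
proof -
  have "(\<Sum>i\<in>J. b i * (g(j := y)) i * v i) = b j * y * v j + (\<Sum>i\<in>J - {j}. b i * g i * v i)" for y
    using assms by (subst sum.remove[of _ j]) (auto intro!: sum.cong)
  then show ?thesis by (auto intro!: derivative_eq_intros)
qed

text \<open>There are \<open>n + 1\<close> terms with coefficients of size at most
  \<open>n + 1\<close>; the sum over \<open>X\<close> is a crude bound for the values of
  \<open>\<phi>\<close>.\<close>

lemma rsum_abs_le:
  assumes "finite X" "\<sigma> \<in> PiE {..<R} (\<lambda>_. X)" "n < R"
  shows "\<bar>rsum n \<phi> \<sigma>\<bar> \<le> (real n + 1)\<^sup>2 * (\<Sum>x\<in>X. \<bar>\<phi> x\<bar>)"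
proof -
  have "\<bar>rsum n \<phi> \<sigma>\<bar> \<le> (\<Sum>a\<le>n. \<bar>rc n a\<bar> * \<bar>\<phi> (\<sigma> a)\<bar>)"
    unfolding rsum_def by (rule order_trans[OF sum_abs]) (simp add: abs_mult)
  also have "\<dots> \<le> (\<Sum>a\<le>n. (real n + 1) * (\<Sum>x\<in>X. \<bar>\<phi> x\<bar>))"
  proof (rule sum_mono, rule mult_mono)
    fix a assume "a \<in> {..n}"
    then have "a \<in> {..<R}" using assms(3) by simp
    then have "\<sigma> a \<in> X" by (rule PiE_mem[OF assms(2)])
    then show "\<bar>\<phi> (\<sigma> a)\<bar> \<le> (\<Sum>x\<in>X. \<bar>\<phi> x\<bar>)"
      using assms(1) by (intro member_le_sum[where f = "\<lambda>x. \<bar>\<phi> x\<bar>"]) auto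
  next
    fix a show "\<bar>rc n a\<bar> \<le> real n + 1" by (simp add: rc_def)
  qed simp_all
  also have "\<dots> = (real n + 1)\<^sup>2 * (\<Sum>x\<in>X. \<bar>\<phi> x\<bar>)"
    by (simp add: power2_eq_square algebra_simps)
  finally show ?thesis .
qed

lemma rsum_add: "rsum n (\<lambda>x. \<phi> x + \<psi> x) \<sigma> = rsum n \<phi> \<sigma> + rsum n \<psi> \<sigma>"
  by (simp add: rsum_def algebra_simps sum.distrib)

lemma rsum_cmult: "rsum n (\<lambda>x. k * \<phi> x) \<sigma> = k * rsum n \<phi> \<sigma>"
  by (simp add: rsum_def sum_distrib_left mult_ac)

lemma rsum_sum: "rsum n (\<lambda>x. \<Sum>j\<in>J. \<phi> j x) \<sigma> = (\<Sum>j\<in>J. rsum n (\<phi> j) \<sigma>)"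
  unfolding rsum_def by (subst sum.swap) (simp add: sum_distrib_left)

text \<open>A common frame for two interpolations: the cavity path on configurations, and the path
  between two parameter pairs on a single spin. The bounds on \<open>a'\<close> and
  \<open>c'\<close> are uniform in the parameter and provide the dominating function for
  differentiating under the Gaussian integral.\<close>

locale gaussian_family =
  fixes R :: nat and X :: "'x set" and J :: "'j set"
    and a a' :: "real \<Rightarrow> 'j \<Rightarrow> real" and u :: "'j \<Rightarrow> 'x \<Rightarrow> real"
    and c c' :: "real \<Rightarrow> 'x \<Rightarrow> real" and B :: real
  assumes X: "finite X" "X \<noteq> {}" and J: "finite J"
    and a: "\<And>t j. j \<in> J \<Longrightarrow> ((\<lambda>t. a t j) has_real_derivative a' t j) (at t)"
    and a': "\<And>t j. j \<in> J \<Longrightarrow> \<bar>a' t j\<bar> \<le> 1"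
    and c: "\<And>t x. x \<in> X \<Longrightarrow> ((\<lambda>t. c t x) has_real_derivative c' t x) (at t)"
    and c': "\<And>t x. x \<in> X \<Longrightarrow> \<bar>c' t x\<bar> \<le> B"
begin

definition ham :: "real \<Rightarrow> ('j \<Rightarrow> real) \<Rightarrow> 'x \<Rightarrow> real" where
  "ham t g x = (\<Sum>j\<in>J. a t j * g j * u j x) + c t x"

definition nui :: "real \<Rightarrow> ((nat \<Rightarrow> 'x) \<Rightarrow> real) \<Rightarrow> real" where
  "nui t F = (\<integral>g. gav R X (ham t g) F \<partial>gaussians J)"

lemma fin_rep: "finite (PiE {..<R} (\<lambda>_. X))"
  using X by (intro finite_PiE) auto

lemma measurable_ham: "(\<lambda>g. ham t g x) \<in> borel_measurable (gaussians J)"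
  unfolding ham_def
  by (intro borel_measurable_add borel_measurable_sum borel_measurable_times borel_measurable_const
      measurable_gaussians_component)

lemma measurable_gav:
  assumes "\<And>\<sigma>. (\<lambda>g. F g \<sigma>) \<in> borel_measurable (gaussians J)"
  shows "(\<lambda>g. gav R X (ham t g) (F g)) \<in> borel_measurable (gaussians J)"
  unfolding gav_def rep_def prb_def
  by (intro borel_measurable_sum borel_measurable_times borel_measurable_prod borel_measurable_divide
      measurable_compose[OF measurable_ham borel_measurable_exp] assms)

text \<open>A bound that grows with the number of configurations. It serves integrability and
  domination only and enters no quantitative estimate.\<close>

definition bnd :: "((nat \<Rightarrow> 'x) \<Rightarrow> real) \<Rightarrow> real" where
  "bnd F = (\<Sum>\<sigma>\<in>PiE {..<R} (\<lambda>_. X). \<bar>F \<sigma>\<bar>)"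

lemma bnd: "\<sigma> \<in> PiE {..<R} (\<lambda>_. X) \<Longrightarrow> \<bar>F \<sigma>\<bar> \<le> bnd F"
  unfolding bnd_def using fin_rep by (intro member_le_sum[where f = "\<lambda>\<sigma>. \<bar>F \<sigma>\<bar>"]) auto

lemma gav_bnd: "\<bar>gav R X (ham t g) F\<bar> \<le> bnd F"
  by (intro gav_bound X bnd)

lemma integrable_gav: "integrable (gaussians J) (\<lambda>g. gav R X (ham t g) F)"
proof -
  interpret prob_space "gaussians J" by (rule prob_space_gaussians)
  show ?thesis
    by (rule integrable_const_bound[where B = "bnd F", OF AE_I2 measurable_gav]) (auto simp: gav_bnd)
qed

lemma nui_add: "nui t (\<lambda>\<sigma>. F \<sigma> + G \<sigma>) = nui t F + nui t G"
  using integrable_gav unfolding nui_def gav_def rep_add by (intro Bochner_Integration.integral_add) auto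

lemma nui_diff: "nui t (\<lambda>\<sigma>. F \<sigma> - G \<sigma>) = nui t F - nui t G"
  using integrable_gav unfolding nui_def gav_def rep_diff by (intro Bochner_Integration.integral_diff) auto

lemma nui_cmult: "nui t (\<lambda>\<sigma>. k * F \<sigma>) = k * nui t F"
  unfolding nui_def gav_def rep_cmult by simp

lemma nui_sum: "nui t (\<lambda>\<sigma>. \<Sum>i\<in>I. F i \<sigma>) = (\<Sum>i\<in>I. nui t (F i))"
  using integrable_gav unfolding nui_def gav_def rep_sum by (intro Bochner_Integration.integral_sum) auto

lemma nui_cong:
  assumes "\<And>\<sigma>. \<sigma> \<in> PiE {..<R} (\<lambda>_. X) \<Longrightarrow> F \<sigma> = G \<sigma>"
  shows "nui t F = nui t G"
proof -
  have "gav R X (ham t g) F = gav R X (ham t g) G" for g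
    unfolding gav_def using assms by (rule rep_cong)
  then show ?thesis by (simp add: nui_def)
qed

lemma nui_mono:
  assumes "\<And>\<sigma>. \<sigma> \<in> PiE {..<R} (\<lambda>_. X) \<Longrightarrow> F \<sigma> \<le> G \<sigma>"
  shows "nui t F \<le> nui t G"
  unfolding nui_def by (intro integral_mono integrable_gav gav_mono assms)

lemma nui_const: "nui t (\<lambda>_. k) = k"
proof -
  interpret prob_space "gaussians J" by (rule prob_space_gaussians)
  show ?thesis unfolding nui_def using gav_const[OF X] by (simp add: prob_space)
qed

lemma nui_abs: "\<bar>nui t F\<bar> \<le> nui t (\<lambda>\<sigma>. \<bar>F \<sigma>\<bar>)"
proof -
  have "nui t F \<le> nui t (\<lambda>\<sigma>. \<bar>F \<sigma>\<bar>)" "nui t (\<lambda>\<sigma>. - 1 * F \<sigma>) \<le> nui t (\<lambda>\<sigma>. \<bar>F \<sigma>\<bar>)"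
    by (intro nui_mono; simp)+
  then show ?thesis unfolding nui_cmult by linarith
qed

lemma nui_permute:
  assumes "\<pi> permutes {..<R}"
  shows "nui t (\<lambda>\<sigma>. F (\<sigma> \<circ> \<pi>)) = nui t F"
  unfolding nui_def gav_def rep_permute[OF assms] ..

lemma ham_upd_DERIV:
  assumes "j \<in> J"
  shows "((\<lambda>y. ham t (g(j := y)) x) has_real_derivative a t j * u j x) (at y)"
  unfolding ham_def using DERIV_add[OF DERIV_upd_sum[OF J assms] DERIV_const] by simp

text \<open>The derivative of a replica average in \<open>g j\<close> is again a replica average,
  with \<open>a t j * u j\<close> brought down by \<open>gav_DERIV\<close>; Gaussian integration by
  parts trades the factor \<open>g j\<close> for it.\<close>

lemma nui_coordinate:
  assumes j: "j \<in> J" and n: "Suc (Suc n) < R" and F: "depn (Suc n) F"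
  shows "(\<integral>g. g j * gav R X (ham t g) F \<partial>gaussians J) = a t j * nui t (\<lambda>\<sigma>. F \<sigma> * rsum (Suc n) (u j) \<sigma>)"
proof -
  let ?F' = "\<lambda>\<sigma>. F \<sigma> * rsum (Suc n) (\<lambda>x. a t j * u j x) \<sigma>"
  have F': "depn (Suc (Suc n)) ?F'" by (rule depn_mult_rsum[OF F])
  have "(\<integral>g. g j * gav R X (ham t g) F \<partial>gaussians J) = (\<integral>g. gav R X (ham t g) ?F' \<partial>gaussians J)"
  proof (rule gaussians_integral_by_parts[OF J j, where B = "bnd F" and B' = "bnd ?F'"])
    fix g x
    show "((\<lambda>x. gav R X (ham t (g(j := x))) F) has_real_derivative gav R X (ham t (g(j := x))) ?F') (at x)"
      using n by (intro gav_DERIV X F ham_upd_DERIV j) simp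
    \<comment> \<open>This second derivative only yields continuity of the first. It consumes one
      more replica, whence \<open>Suc (Suc n) < R\<close>.\<close>
    have "((\<lambda>x. gav R X (ham t (g(j := x))) ?F') has_real_derivative
        gav R X (ham t (g(j := x))) (\<lambda>\<sigma>. ?F' \<sigma> * rsum (Suc (Suc n)) (\<lambda>x. a t j * u j x) \<sigma>)) (at x)"
      using n by (intro gav_DERIV X F' ham_upd_DERIV j) simp
    then show "isCont (\<lambda>x. gav R X (ham t (g(j := x))) ?F') x" by (rule DERIV_isCont)
  qed (auto intro!: measurable_gav gav_bnd)
  also have "\<dots> = nui t (\<lambda>\<sigma>. a t j * (F \<sigma> * rsum (Suc n) (u j) \<sigma>))"
    by (simp add: nui_def rsum_cmult mult.left_commute)
  finally show ?thesis by (simp add: nui_cmult)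
qed

text \<open>The derivative in the parameter adds replica \<open>n\<close> and leaves a factor
  \<open>g j\<close>; the integration by parts that removes this factor adds replica
  \<open>Suc n\<close>. The deterministic part \<open>c\<close> undergoes only the first operation,
  so it appears with a single \<open>rsum\<close>.\<close>

theorem nui_DERIV:
  assumes n: "Suc (Suc n) < R" and F: "depn n F"
  shows "((\<lambda>t. nui t F) has_real_derivative
    nui t (\<lambda>\<sigma>. F \<sigma> * ((\<Sum>j\<in>J. a t j * a' t j * (rsum n (u j) \<sigma> * rsum (Suc n) (u j) \<sigma>)) + rsum n (c' t) \<sigma>))) (at t)"
proof -
  define \<phi> where "\<phi> t g x = (\<Sum>j\<in>J. a' t j * g j * u j x) + c' t x" for t g x
  define f' where "f' t g = gav R X (ham t g) (\<lambda>\<sigma>. F \<sigma> * rsum n (\<phi> t g) \<sigma>)" for t g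
  \<comment> \<open>Linear in the absolute values of the coordinates, hence integrable, and free of
    \<open>t\<close>.\<close>
  define w where "w g = bnd F * ((real n + 1)\<^sup>2 * (\<Sum>x\<in>X. (\<Sum>j\<in>J. \<bar>g j\<bar> * \<bar>u j x\<bar>) + B))" for g
  interpret prob_space "gaussians J" by (rule prob_space_gaussians)
  have meas_rsum: "(\<lambda>g. F \<sigma> * rsum n (\<phi> t g) \<sigma>) \<in> borel_measurable (gaussians J)" for t \<sigma>
    unfolding rsum_def \<phi>_def
    by (intro borel_measurable_add borel_measurable_sum borel_measurable_times borel_measurable_const
        measurable_gaussians_component)
  have "((\<lambda>t. \<integral>g. gav R X (ham t g) F \<partial>gaussians J) has_real_derivative (\<integral>g. f' t g \<partial>gaussians J)) (at t)"
  proof (rule DERIV_lebesgue_integral[where w = w])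
    show "integrable (gaussians J) w"
      unfolding w_def using J X
      by (intro integrable_mult_right Bochner_Integration.integrable_sum Bochner_Integration.integrable_add
          integrable_mult_left integrable_gaussians_component_abs integrable_const)
    show "((\<lambda>t. gav R X (ham t g) F) has_real_derivative f' t g) (at t)" for t g
    proof -
      have "((\<lambda>t. ham t g x) has_real_derivative \<phi> t g x) (at t)" if "x \<in> X" for x
        unfolding ham_def \<phi>_def using that
        by (intro DERIV_add DERIV_sum c DERIV_cmult_right a)
      then show ?thesis unfolding f'_def using n by (intro gav_DERIV X F) auto
    qed
    show "f' t \<in> borel_measurable (gaussians J)" for t
      unfolding f'_def by (intro measurable_gav meas_rsum)
    show "\<bar>f' t g\<bar> \<le> w g" for t g
      unfolding f'_def
    proof (intro gav_bound X)
      fix \<sigma> assume \<sigma>: "\<sigma> \<in> PiE {..<R} (\<lambda>_. X)"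
      have \<phi>: "\<bar>\<phi> t g x\<bar> \<le> (\<Sum>j\<in>J. \<bar>g j\<bar> * \<bar>u j x\<bar>) + B" if "x \<in> X" for x
      proof -
        have "\<bar>\<Sum>j\<in>J. a' t j * g j * u j x\<bar> \<le> (\<Sum>j\<in>J. \<bar>g j\<bar> * \<bar>u j x\<bar>)"
        proof (rule order_trans[OF sum_abs], rule sum_mono)
          fix j assume "j \<in> J"
          from mult_right_mono[OF a'[OF this, of t], of "\<bar>g j\<bar> * \<bar>u j x\<bar>"]
          show "\<bar>a' t j * g j * u j x\<bar> \<le> \<bar>g j\<bar> * \<bar>u j x\<bar>" by (simp add: abs_mult mult.assoc)
        qed
        with c'[OF that, of t] show ?thesis unfolding \<phi>_def by linarith
      qed
      have "\<bar>rsum n (\<phi> t g) \<sigma>\<bar> \<le> (real n + 1)\<^sup>2 * (\<Sum>x\<in>X. \<bar>\<phi> t g x\<bar>)"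
        by (rule rsum_abs_le[OF X(1) \<sigma>]) (use n in simp)
      also have "\<dots> \<le> (real n + 1)\<^sup>2 * (\<Sum>x\<in>X. (\<Sum>j\<in>J. \<bar>g j\<bar> * \<bar>u j x\<bar>) + B)"
        by (intro mult_left_mono sum_mono \<phi>) auto
      finally show "\<bar>F \<sigma> * rsum n (\<phi> t g) \<sigma>\<bar> \<le> w g"
        unfolding w_def abs_mult by (intro mult_mono bnd[OF \<sigma>]) (use order_trans[OF abs_ge_zero bnd[OF \<sigma>, of F]] in simp_all)
    qed
  qed (rule integrable_gav)
  moreover have "(\<integral>g. f' t g \<partial>gaussians J) =
    nui t (\<lambda>\<sigma>. F \<sigma> * ((\<Sum>j\<in>J. a t j * a' t j * (rsum n (u j) \<sigma> * rsum (Suc n) (u j) \<sigma>)) + rsum n (c' t) \<sigma>))"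
  proof -
    let ?g = "\<lambda>g. gav R X (ham t g)"
    let ?F = "\<lambda>j \<sigma>. F \<sigma> * rsum n (u j) \<sigma>"
    have *: "rsum n (\<phi> t g) \<sigma> = (\<Sum>j\<in>J. a' t j * g j * rsum n (u j) \<sigma>) + rsum n (c' t) \<sigma>" for g \<sigma>
      unfolding \<phi>_def rsum_add rsum_sum rsum_cmult ..
    have "f' t g = (\<Sum>j\<in>J. a' t j * (g j * ?g g (?F j))) + ?g g (\<lambda>\<sigma>. F \<sigma> * rsum n (c' t) \<sigma>)" for g
    proof -
      have "F \<sigma> * rsum n (\<phi> t g) \<sigma> = (\<Sum>j\<in>J. a' t j * g j * (?F j \<sigma>)) + F \<sigma> * rsum n (c' t) \<sigma>" for \<sigma>
        unfolding * by (simp add: distrib_left sum_distrib_left mult_ac)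
      then show ?thesis unfolding f'_def gav_def by (simp only: rep_add rep_sum rep_cmult mult.assoc)
    qed
    then have "(\<integral>g. f' t g \<partial>gaussians J) =
      (\<integral>g. (\<Sum>j\<in>J. a' t j * (g j * ?g g (?F j))) + ?g g (\<lambda>\<sigma>. F \<sigma> * rsum n (c' t) \<sigma>) \<partial>gaussians J)"
      by simp
    also have "\<dots> = (\<Sum>j\<in>J. a' t j * (\<integral>g. g j * ?g g (?F j) \<partial>gaussians J)) + nui t (\<lambda>\<sigma>. F \<sigma> * rsum n (c' t) \<sigma>)"
    proof -
      have i: "integrable (gaussians J) (\<lambda>g. g j * ?g g (?F j))" if "j \<in> J" for j
        using integrable_gaussians_component_mult[OF that, of "\<lambda>g. ?g g (?F j)" "bnd (?F j)"] gav_bnd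
        by (simp add: measurable_gav)
      have "integrable (gaussians J) (\<lambda>g. \<Sum>j\<in>J. a' t j * (g j * ?g g (?F j)))"
        by (intro Bochner_Integration.integrable_sum integrable_mult_right i)
      then show ?thesis unfolding nui_def
        by (subst Bochner_Integration.integral_add[OF _ integrable_gav], assumption,
            subst Bochner_Integration.integral_sum) (auto intro: i)
    qed
    also have "(\<Sum>j\<in>J. a' t j * (\<integral>g. g j * ?g g (?F j) \<partial>gaussians J)) =
        (\<Sum>j\<in>J. a' t j * (a t j * nui t (\<lambda>\<sigma>. ?F j \<sigma> * rsum (Suc n) (u j) \<sigma>)))"
      using n by (intro sum.cong refl arg_cong2[where f = "(*)"] nui_coordinate depn_mult_rsum F)
    also have "\<dots> + nui t (\<lambda>\<sigma>. F \<sigma> * rsum n (c' t) \<sigma>) =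
        nui t (\<lambda>\<sigma>. (\<Sum>j\<in>J. a' t j * (a t j * (?F j \<sigma> * rsum (Suc n) (u j) \<sigma>))) + F \<sigma> * rsum n (c' t) \<sigma>)"
      by (simp only: nui_add nui_sum nui_cmult)
    also have "\<dots> = nui t (\<lambda>\<sigma>. F \<sigma> * ((\<Sum>j\<in>J. a t j * a' t j * (rsum n (u j) \<sigma> * rsum (Suc n) (u j) \<sigma>)) + rsum n (c' t) \<sigma>))"
      by (intro nui_cong) (simp add: distrib_left sum_distrib_left mult_ac)
    finally show ?thesis .
  qed
  ultimately show ?thesis by (simp add: nui_def)
qed

end

section \<open>The cavity path\<close>

text \<open>The l1 norm of the coefficients in the double replica sum of the generator.\<close>

definition rcc :: "nat \<Rightarrow> real" where
  "rcc n = (\<Sum>a\<le>n. \<Sum>b\<le>Suc n. \<bar>rc n a\<bar> * \<bar>rc (Suc n) b\<bar>)"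

lemma rcc_nonneg: "0 \<le> rcc n"
  unfolding rcc_def by (intro sum_nonneg) simp

text \<open>Twelve replicas are enough: four in the test functions and two more for every derivative along the path.\<close>

definition nuR :: "nat \<Rightarrow> nat \<Rightarrow> real \<Rightarrow> real \<Rightarrow> real \<Rightarrow> ((nat \<Rightarrow> nat \<Rightarrow> int) \<Rightarrow> real) \<Rightarrow> real" where
  "nuR S N \<beta> h D F = (\<integral>g. gav 12 (configs S N) (Ham N \<beta> h D g) F \<partial>disorder N)"

definition qab :: "real \<Rightarrow> real \<Rightarrow> nat \<Rightarrow> nat \<Rightarrow> real" where
  "qab p q a b = (if a = b then p else q)"

definition ovl :: "nat \<Rightarrow> real \<Rightarrow> real \<Rightarrow> nat \<Rightarrow> nat \<Rightarrow> (nat \<Rightarrow> nat \<Rightarrow> int) \<Rightarrow> real" where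
  "ovl N p q a b \<sigma> = (1 / real N) * (\<Sum>i<N. real_of_int (\<sigma> a i) * real_of_int (\<sigma> b i)) - qab p q a b"

lemma finite_spins: "finite (spins S)"
  by (simp add: spins_def)

lemma spins_bound: "s \<in> spins S \<Longrightarrow> \<bar>real_of_int s\<bar> \<le> real S"
  by (simp add: spins_def abs_le_iff)

lemma zero_in_spins: "0 \<in> spins S"
  by (simp add: spins_def)

lemma finite_configs: "finite (configs S N)"
  unfolding configs_def by (intro finite_PiE finite_spins) simp

lemma configs_nonempty: "configs S N \<noteq> {}"
  unfolding configs_def using zero_in_spins by (auto simp: PiE_eq_empty_iff)

lemma configs_spins: "x \<in> configs S N \<Longrightarrow> i < N \<Longrightarrow> x i \<in> spins S"
  using PiE_mem[of x "{..<N}" "\<lambda>_. spins S" i] by (simp add: configs_def)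

lemma replica_bound:
  assumes "\<sigma> \<in> PiE {..<R} (\<lambda>_. configs S N)" "a < R" "i < N"
  shows "\<bar>real_of_int (\<sigma> a i)\<bar> \<le> real S"
proof -
  have "\<sigma> a \<in> configs S N" by (rule PiE_mem[OF assms(1)]) (use assms(2) in simp)
  then show ?thesis using assms(3) by (intro spins_bound configs_spins)
qed

lemma replica_bound2:
  assumes "\<sigma> \<in> PiE {..<R} (\<lambda>_. configs S N)" "a < R" "b < R" "i < N"
  shows "\<bar>real_of_int (\<sigma> a i) * real_of_int (\<sigma> b i)\<bar> \<le> (real S)\<^sup>2"
  unfolding abs_mult power2_eq_square
  by (intro mult_mono replica_bound[OF assms(1)]) (use assms in simp_all)

lemma finite_pairs: "finite (pairs N)"
  by (rule finite_subset[of _ "{..<N} \<times> {..<N}"]) (auto simp: pairs_def)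

text \<open>Here \<open>p\<close> and \<open>q\<close> are any numbers in the range of overlaps; the
  fixed point equations are added in \<open>cavity_fp\<close>, where the decoupled endpoint has to
  be centred.\<close>

locale cavity =
  fixes S N k :: nat and \<beta> h D p q :: real
  assumes k: "k < N" and \<beta>: "0 \<le> \<beta>" "\<beta> \<le> 1"
    and q: "0 \<le> q" "q \<le> (real S)\<^sup>2" and p: "0 \<le> p" "p \<le> (real S)\<^sup>2"
begin

text \<open>The coordinate \<open>(0, 0)\<close>, which does not occur in \<^const>\<open>pairs\<close>, carries the Gaussian of the decoupled site.\<close>

abbreviation J :: "(nat \<times> nat) set" where "J \<equiv> insert (0, 0) (pairs N)"

definition amp :: "real \<Rightarrow> nat \<times> nat \<Rightarrow> real" where
  "amp \<theta> j = (if j = (0, 0) then cos \<theta> else if k = fst j \<or> k = snd j then sin \<theta> else 1)"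

definition amp' :: "real \<Rightarrow> nat \<times> nat \<Rightarrow> real" where
  "amp' \<theta> j = (if j = (0, 0) then - sin \<theta> else if k = fst j \<or> k = snd j then cos \<theta> else 0)"

definition cpl :: "nat \<times> nat \<Rightarrow> (nat \<Rightarrow> int) \<Rightarrow> real" where
  "cpl j x = (if j = (0, 0) then \<beta> * sqrt q * x k else \<beta> / sqrt N * (x (fst j) * x (snd j)))"

text \<open>A Gaussian field of variance \<beta>^2 q on site \<open>k\<close> imitates the overlap
  value \<open>q\<close> for every pair of replicas, even for a replica with itself, where
  \<open>p\<close> is wanted. The last term supplies the missing \<open>p - q\<close>, in agreement
  with the exponent of \<open>wsite\<close>.\<close>

definition fld :: "real \<Rightarrow> (nat \<Rightarrow> int) \<Rightarrow> real" where
  "fld \<theta> x = D * (\<Sum>i<N. real_of_int (x i) ^ 2) + h * (\<Sum>i<N. real_of_int (x i))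
     + (cos \<theta>)\<^sup>2 * (\<beta>\<^sup>2 / 2 * (p - q) * real_of_int (x k) ^ 2)"

definition fld' :: "real \<Rightarrow> (nat \<Rightarrow> int) \<Rightarrow> real" where
  "fld' \<theta> x = - (cos \<theta> * sin \<theta> * (\<beta>\<^sup>2 * (p - q))) * real_of_int (x k) ^ 2"

sublocale gaussian_family 12 "configs S N" J amp amp' cpl fld fld'
  "\<Sum>x\<in>configs S N. \<bar>\<beta>\<^sup>2 * (p - q) * real_of_int (x k) ^ 2\<bar>"
proof
  fix t :: real and j
  show "((\<lambda>t. amp t j) has_real_derivative amp' t j) (at t)"
    unfolding amp_def amp'_def by (auto intro!: derivative_eq_intros)
  show "\<bar>amp' t j\<bar> \<le> 1" unfolding amp'_def by simp
next
  fix t :: real and x assume x: "x \<in> configs S N"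
  show "((\<lambda>t. fld t x) has_real_derivative fld' t x) (at t)"
    unfolding fld_def fld'_def by (auto intro!: derivative_eq_intros)
  have "\<bar>cos t * sin t\<bar> \<le> 1 * 1" unfolding abs_mult by (intro mult_mono) auto
  then have "\<bar>cos t * sin t\<bar> * \<bar>\<beta>\<^sup>2 * (p - q) * real_of_int (x k) ^ 2\<bar> \<le> 1 * \<bar>\<beta>\<^sup>2 * (p - q) * real_of_int (x k) ^ 2\<bar>"
    by (intro mult_right_mono) auto
  then have "\<bar>fld' t x\<bar> \<le> \<bar>\<beta>\<^sup>2 * (p - q) * real_of_int (x k) ^ 2\<bar>"
    unfolding fld'_def abs_mult abs_minus_cancel by (simp add: mult_ac)
  also have "\<dots> \<le> (\<Sum>x\<in>configs S N. \<bar>\<beta>\<^sup>2 * (p - q) * real_of_int (x k) ^ 2\<bar>)"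
    using finite_configs x by (intro member_le_sum[where f = "\<lambda>x. \<bar>\<beta>\<^sup>2 * (p - q) * real_of_int (x k) ^ 2\<bar>"]) auto
  finally show "\<bar>fld' t x\<bar> \<le> (\<Sum>x\<in>configs S N. \<bar>\<beta>\<^sup>2 * (p - q) * real_of_int (x k) ^ 2\<bar>)" .
qed (auto simp: finite_configs configs_nonempty finite_pairs)

definition eps :: "nat \<Rightarrow> (nat \<Rightarrow> nat \<Rightarrow> int) \<Rightarrow> real" where
  "eps a \<sigma> = real_of_int (\<sigma> a k)"

text \<open>Removing a site keeps the factor \<open>1 / N\<close>, so the system without a site never has to be renormalised.\<close>

definition xm :: "nat \<Rightarrow> nat \<Rightarrow> (nat \<Rightarrow> nat \<Rightarrow> int) \<Rightarrow> real" where
  "xm a b \<sigma> = (1 / real N) * (\<Sum>i\<in>{..<N} - {k}. real_of_int (\<sigma> a i) * real_of_int (\<sigma> b i)) - qab p q a b"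

text \<open>The path is parametrised by an angle, which keeps the amplitudes of the two Gaussian fields smooth up to
  the endpoints; \<open>gen\<close> is the derivative with respect to the usual parameter \<open>t = sin\<^sup>2 \<theta>\<close>.\<close>

definition gen :: "nat \<Rightarrow> real \<Rightarrow> ((nat \<Rightarrow> nat \<Rightarrow> int) \<Rightarrow> real) \<Rightarrow> real" where
  "gen n \<theta> F = \<beta>\<^sup>2 / 2 * (\<Sum>a\<le>n. \<Sum>b\<le>Suc n. rc n a * rc (Suc n) b * nui \<theta> (\<lambda>\<sigma>. F \<sigma> * (eps a \<sigma> * eps b \<sigma>) * xm a b \<sigma>))"

lemma N: "0 < real N" using k by simp

lemma ovl_xm: "ovl N p q a b \<sigma> = xm a b \<sigma> + eps a \<sigma> * eps b \<sigma> / real N"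
  unfolding ovl_def xm_def eps_def using k by (subst sum.remove[of _ k]) (auto simp: algebra_simps add_divide_distrib)

lemma eps_bound:
  assumes "\<sigma> \<in> PiE {..<12::nat} (\<lambda>_. configs S N)" "a < 12" "b < 12"
  shows "\<bar>eps a \<sigma> * eps b \<sigma>\<bar> \<le> (real S)\<^sup>2"
  unfolding eps_def by (rule replica_bound2[OF assms k])

lemma qab_bound: "\<bar>qab p q a b\<bar> \<le> (real S)\<^sup>2"
  using p q by (simp add: qab_def)

lemma xm_bound:
  assumes "\<sigma> \<in> PiE {..<12::nat} (\<lambda>_. configs S N)" "a < 12" "b < 12"
  shows "\<bar>xm a b \<sigma>\<bar> \<le> 2 * (real S)\<^sup>2"
proof -
  have "\<bar>\<Sum>i\<in>{..<N} - {k}. real_of_int (\<sigma> a i) * real_of_int (\<sigma> b i)\<bar> \<le> (\<Sum>i\<in>{..<N} - {k}. (real S)\<^sup>2)"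
    by (rule order_trans[OF sum_abs], rule sum_mono, rule replica_bound2[OF assms]) simp
  also have "\<dots> \<le> (\<Sum>i<N. (real S)\<^sup>2)" by (rule sum_mono2) auto
  finally have "\<bar>(1 / real N) * (\<Sum>i\<in>{..<N} - {k}. real_of_int (\<sigma> a i) * real_of_int (\<sigma> b i))\<bar> \<le> (real S)\<^sup>2"
    using N by (simp add: field_simps)
  with qab_bound[of a b] show ?thesis unfolding xm_def by linarith
qed

lemma sum_site_pairs:
  fixes f :: "nat \<times> nat \<Rightarrow> real"
  assumes f: "\<And>j. j \<in> pairs N \<Longrightarrow> k \<noteq> fst j \<and> k \<noteq> snd j \<Longrightarrow> f j = 0"
  shows "(\<Sum>j\<in>pairs N. f j) = (\<Sum>i\<in>{..<N} - {k}. f (min i k, max i k))"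
proof -
  have "(\<Sum>j\<in>pairs N. f j) = (\<Sum>j\<in>{j\<in>pairs N. k = fst j \<or> k = snd j}. f j)"
    using f by (intro sum.mono_neutral_right finite_pairs) auto
  also have "\<dots> = (\<Sum>i\<in>{..<N} - {k}. f (min i k, max i k))"
    by (rule sum.reindex_bij_witness[where i = "\<lambda>i. (min i k, max i k)" and j = "\<lambda>j. if k = fst j then snd j else fst j"])
      (use k in \<open>auto simp: pairs_def min_def max_def split: if_splits\<close>)
  finally show ?thesis .
qed

lemma rsum_product:
  "rsum n \<phi> \<sigma> * rsum m \<psi> \<sigma> = (\<Sum>a\<le>n. \<Sum>b\<le>m. rc n a * rc m b * (\<phi> (\<sigma> a) * \<psi> (\<sigma> b)))"
  unfolding rsum_def sum_product by (intro sum.cong refl) (simp only: mult_ac)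

text \<open>The couplings of site \<open>k\<close> contribute
  \<open>sin \<theta> * cos \<theta>\<close> times the overlap over the other sites, the Gaussian of
  the site contributes \<open>q\<close> with the opposite sign, and the deterministic term corrects
  the diagonal by \<open>p - q\<close>. Together these are the centred overlaps
  \<open>xm\<close>.\<close>

lemma generator_pointwise:
  "(\<Sum>j\<in>J. amp \<theta> j * amp' \<theta> j * (rsum n (cpl j) \<sigma> * rsum (Suc n) (cpl j) \<sigma>)) + rsum n (fld' \<theta>) \<sigma> =
   2 * sin \<theta> * cos \<theta> * (\<beta>\<^sup>2 / 2 * (\<Sum>a\<le>n. \<Sum>b\<le>Suc n. rc n a * rc (Suc n) b * (eps a \<sigma> * eps b \<sigma> * xm a b \<sigma>)))"
proof -
  let ?sc = "sin \<theta> * cos \<theta> * \<beta>\<^sup>2"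
  let ?E = "\<lambda>f. \<Sum>a\<le>n. \<Sum>b\<le>Suc n. rc n a * rc (Suc n) b * (eps a \<sigma> * eps b \<sigma> * f a b)"
  have z: "(0, 0) \<notin> pairs N" by (simp add: pairs_def)
  have "rsum n (cpl (0, 0)) \<sigma> * rsum (Suc n) (cpl (0, 0)) \<sigma> = \<beta>\<^sup>2 * q * ?E (\<lambda>a b. 1)"
  proof -
    obtain s where s: "sqrt q = s" "q = s * s" using q by (metis real_sqrt_mult_self abs_of_nonneg)
    have "cpl (0, 0) x = \<beta> * s * real_of_int (x k)" for x by (simp add: cpl_def s(1))
    then show ?thesis
      unfolding rsum_product eps_def sum_distrib_left s(2)
      by (intro sum.cong refl) (simp add: power2_eq_square mult_ac)
  qed
  then have 1: "amp \<theta> (0, 0) * amp' \<theta> (0, 0) * (rsum n (cpl (0, 0)) \<sigma> * rsum (Suc n) (cpl (0, 0)) \<sigma>) =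
      - ?sc * ?E (\<lambda>a b. q)"
    by (simp add: amp_def amp'_def sum_distrib_left mult_ac sum_negf del: sum.atMost_Suc)
  have "(\<Sum>j\<in>pairs N. amp \<theta> j * amp' \<theta> j * (rsum n (cpl j) \<sigma> * rsum (Suc n) (cpl j) \<sigma>)) =
     (\<Sum>i\<in>{..<N} - {k}. ?sc * ?E (\<lambda>a b. real_of_int (\<sigma> a i) * real_of_int (\<sigma> b i) / real N))"
  proof (subst sum_site_pairs)
    fix j assume "j \<in> pairs N" "k \<noteq> fst j \<and> k \<noteq> snd j"
    then show "amp \<theta> j * amp' \<theta> j * (rsum n (cpl j) \<sigma> * rsum (Suc n) (cpl j) \<sigma>) = 0"
      using z by (auto simp: amp_def amp'_def)
  next
    show "(\<Sum>i\<in>{..<N} - {k}. amp \<theta> (min i k, max i k) * amp' \<theta> (min i k, max i k) *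
        (rsum n (cpl (min i k, max i k)) \<sigma> * rsum (Suc n) (cpl (min i k, max i k)) \<sigma>)) =
      (\<Sum>i\<in>{..<N} - {k}. ?sc * ?E (\<lambda>a b. real_of_int (\<sigma> a i) * real_of_int (\<sigma> b i) / real N))"
    proof (rule sum.cong[OF refl])
      fix i assume i: "i \<in> {..<N} - {k}"
      then have ne: "(min i k, max i k) \<noteq> (0, 0)" by (auto simp: min_def max_def split: if_splits)
      have cpl: "cpl (min i k, max i k) x = \<beta> / sqrt N * (x i * x k)" for x
        unfolding cpl_def using ne by (auto simp: min_def max_def)
      have "rsum n (cpl (min i k, max i k)) \<sigma> * rsum (Suc n) (cpl (min i k, max i k)) \<sigma> =
          \<beta>\<^sup>2 * ?E (\<lambda>a b. real_of_int (\<sigma> a i) * real_of_int (\<sigma> b i) / real N)"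
        unfolding rsum_product cpl eps_def sum_distrib_left
        using N by (intro sum.cong refl) (simp add: power2_eq_square field_simps)
      moreover have "amp \<theta> (min i k, max i k) * amp' \<theta> (min i k, max i k) = sin \<theta> * cos \<theta>"
        using ne by (auto simp: amp_def amp'_def min_def max_def)
      ultimately show "amp \<theta> (min i k, max i k) * amp' \<theta> (min i k, max i k) *
        (rsum n (cpl (min i k, max i k)) \<sigma> * rsum (Suc n) (cpl (min i k, max i k)) \<sigma>) =
        ?sc * ?E (\<lambda>a b. real_of_int (\<sigma> a i) * real_of_int (\<sigma> b i) / real N)"
        by (simp add: mult_ac)
    qed
  qed
  also have "\<dots> = ?sc * ?E (\<lambda>a b. (1 / real N) * (\<Sum>i\<in>{..<N} - {k}. real_of_int (\<sigma> a i) * real_of_int (\<sigma> b i)))"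
    unfolding sum_distrib_left[symmetric] by (subst sum.swap, subst sum.swap) (simp add: sum_distrib_left sum_divide_distrib del: sum.atMost_Suc)
  finally have 2: "(\<Sum>j\<in>pairs N. amp \<theta> j * amp' \<theta> j * (rsum n (cpl j) \<sigma> * rsum (Suc n) (cpl j) \<sigma>)) =
    ?sc * ?E (\<lambda>a b. (1 / real N) * (\<Sum>i\<in>{..<N} - {k}. real_of_int (\<sigma> a i) * real_of_int (\<sigma> b i)))" .
  have "?E (\<lambda>a b. if a = b then p - q else 0) = (\<Sum>a\<le>n. rc n a * ((eps a \<sigma>)\<^sup>2 * (p - q)))"
  proof (rule sum.cong[OF refl])
    fix a assume a: "a \<in> {..n}"
    have "(\<Sum>b\<le>Suc n. rc n a * rc (Suc n) b * (eps a \<sigma> * eps b \<sigma> * (if a = b then p - q else 0))) =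
        (\<Sum>b\<le>Suc n. if a = b then rc n a * rc (Suc n) b * (eps a \<sigma> * eps b \<sigma> * (p - q)) else 0)"
      by (intro sum.cong) auto
    \<comment> \<open>Since \<open>a \<le> n\<close>, the index \<open>a\<close> is an old replica
      for \<open>rc (Suc n)\<close> and has coefficient 1 there.\<close>
    also have "\<dots> = rc n a * ((eps a \<sigma>)\<^sup>2 * (p - q))"
      using a by (simp add: rc_def power2_eq_square)
    finally show "(\<Sum>b\<le>Suc n. rc n a * rc (Suc n) b * (eps a \<sigma> * eps b \<sigma> * (if a = b then p - q else 0))) =
      rc n a * ((eps a \<sigma>)\<^sup>2 * (p - q))" .
  qed
  then have 3: "rsum n (fld' \<theta>) \<sigma> = - ?sc * ?E (\<lambda>a b. if a = b then p - q else 0)"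
    by (simp add: rsum_def fld'_def eps_def sum_distrib_left mult_ac sum_negf del: sum.atMost_Suc)
  have "(\<Sum>j\<in>J. amp \<theta> j * amp' \<theta> j * (rsum n (cpl j) \<sigma> * rsum (Suc n) (cpl j) \<sigma>)) + rsum n (fld' \<theta>) \<sigma> =
    ?sc * (?E (\<lambda>a b. (1 / real N) * (\<Sum>i\<in>{..<N} - {k}. real_of_int (\<sigma> a i) * real_of_int (\<sigma> b i)))
      - ?E (\<lambda>a b. q) - ?E (\<lambda>a b. if a = b then p - q else 0))"
    using z by (subst sum.insert[OF finite_pairs z], subst 1, subst 2, subst 3) (simp add: algebra_simps del: sum.atMost_Suc)
  also have "(?E (\<lambda>a b. (1 / real N) * (\<Sum>i\<in>{..<N} - {k}. real_of_int (\<sigma> a i) * real_of_int (\<sigma> b i)))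
      - ?E (\<lambda>a b. q) - ?E (\<lambda>a b. if a = b then p - q else 0)) = ?E (\<lambda>a b. xm a b \<sigma>)"
    unfolding sum_subtractf[symmetric]
    by (intro sum.cong refl) (simp add: xm_def qab_def algebra_simps)
  finally show ?thesis by simp
qed

lemma nui_derivative:
  assumes n: "n < 10" and F: "depn n F"
  shows "((\<lambda>\<theta>. nui \<theta> F) has_real_derivative 2 * sin \<theta> * cos \<theta> * gen n \<theta> F) (at \<theta>)"
proof -
  have "nui \<theta> (\<lambda>\<sigma>. F \<sigma> * (2 * sin \<theta> * cos \<theta> * (\<beta>\<^sup>2 / 2 * (\<Sum>a\<le>n. \<Sum>b\<le>Suc n. rc n a * rc (Suc n) b * (eps a \<sigma> * eps b \<sigma> * xm a b \<sigma>))))) =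
    nui \<theta> (\<lambda>\<sigma>. 2 * sin \<theta> * cos \<theta> * (\<beta>\<^sup>2 / 2 * (\<Sum>a\<le>n. \<Sum>b\<le>Suc n. rc n a * rc (Suc n) b * (F \<sigma> * (eps a \<sigma> * eps b \<sigma>) * xm a b \<sigma>))))"
    by (intro nui_cong) (simp only: sum_distrib_left mult_ac)
  also have "\<dots> = 2 * sin \<theta> * cos \<theta> * gen n \<theta> F"
    unfolding nui_cmult nui_sum gen_def ..
  finally show ?thesis
    using nui_DERIV[OF _ F, of \<theta>] n unfolding generator_pointwise by simp
qed

lemma gen_bound:
  assumes n: "n < 11"
  shows "\<bar>gen n \<theta> F\<bar> \<le> \<beta>\<^sup>2 / 2 * (real S)\<^sup>2 *
    (\<Sum>a\<le>n. \<Sum>b\<le>Suc n. \<bar>rc n a\<bar> * \<bar>rc (Suc n) b\<bar> * nui \<theta> (\<lambda>\<sigma>. \<bar>F \<sigma>\<bar> * \<bar>xm a b \<sigma>\<bar>))"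
proof -
  have *: "\<bar>nui \<theta> (\<lambda>\<sigma>. F \<sigma> * (eps a \<sigma> * eps b \<sigma>) * xm a b \<sigma>)\<bar> \<le> (real S)\<^sup>2 * nui \<theta> (\<lambda>\<sigma>. \<bar>F \<sigma>\<bar> * \<bar>xm a b \<sigma>\<bar>)"
    if "a < 12" "b < 12" for a b
    unfolding nui_cmult[symmetric]
  proof (rule order_trans[OF nui_abs], rule nui_mono)
    fix \<sigma> assume "\<sigma> \<in> PiE {..<12::nat} (\<lambda>_. configs S N)"
    from mult_right_mono[OF eps_bound[OF this that], of "\<bar>F \<sigma>\<bar> * \<bar>xm a b \<sigma>\<bar>"]
    show "\<bar>F \<sigma> * (eps a \<sigma> * eps b \<sigma>) * xm a b \<sigma>\<bar> \<le> (real S)\<^sup>2 * (\<bar>F \<sigma>\<bar> * \<bar>xm a b \<sigma>\<bar>)"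
      by (simp add: abs_mult mult_ac)
  qed
  have "\<bar>\<Sum>a\<le>n. \<Sum>b\<le>Suc n. rc n a * rc (Suc n) b * nui \<theta> (\<lambda>\<sigma>. F \<sigma> * (eps a \<sigma> * eps b \<sigma>) * xm a b \<sigma>)\<bar>
    \<le> (\<Sum>a\<le>n. \<Sum>b\<le>Suc n. \<bar>rc n a\<bar> * \<bar>rc (Suc n) b\<bar> * ((real S)\<^sup>2 * nui \<theta> (\<lambda>\<sigma>. \<bar>F \<sigma>\<bar> * \<bar>xm a b \<sigma>\<bar>)))"
    by (rule order_trans[OF sum_abs], rule sum_mono, rule order_trans[OF sum_abs], rule sum_mono,
        unfold abs_mult, rule mult_left_mono, rule *) (use n in simp_all)
  also have "\<dots> = (real S)\<^sup>2 * (\<Sum>a\<le>n. \<Sum>b\<le>Suc n. \<bar>rc n a\<bar> * \<bar>rc (Suc n) b\<bar> * nui \<theta> (\<lambda>\<sigma>. \<bar>F \<sigma>\<bar> * \<bar>xm a b \<sigma>\<bar>))"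
    by (simp add: sum_distrib_left mult_ac del: sum.atMost_Suc)
  finally show ?thesis
    unfolding gen_def abs_mult mult.assoc using mult_left_mono[of _ _ "\<beta>\<^sup>2 / 2"] by simp
qed

lemma nui_half_pi: "nui (pi / 2) F = nuR S N \<beta> h D F"
proof -
  interpret stdN: prob_space stdN by (rule prob_space_stdN)
  have z: "(0, 0) \<notin> pairs N" by (simp add: pairs_def)
  have "ham (pi / 2) (g((0, 0) := y)) x = Ham N \<beta> h D g x" for g y x
  proof -
    have "(\<Sum>j\<in>pairs N. amp (pi / 2) j * (g((0, 0) := y)) j * cpl j x) =
      (\<Sum>(i, j)\<in>pairs N. \<beta> / sqrt N * (g (i, j) * real_of_int (x i) * real_of_int (x j)))"
      by (rule sum.cong[OF refl]) (use z in \<open>auto simp: amp_def cpl_def\<close>)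
    then show ?thesis
      unfolding ham_def Ham_def fld_def
      by (subst sum.insert[OF finite_pairs z]) (simp add: amp_def sum_distrib_left case_prod_unfold)
  qed
  then have ham: "ham (pi / 2) (g((0, 0) := y)) = Ham N \<beta> h D g" for g y by blast
  show ?thesis
    unfolding nui_def nuR_def disorder_def gaussians_def[symmetric]
    by (subst integral_gaussians_insert[OF finite_pairs z integrable_gav])
      (simp add: ham stdN.prob_space[simplified])
qed

text \<open>A Gronwall argument: \<open>xm\<close> is bounded, so the derivative along the path is
  at most \<open>C\<close> times the average itself, and
  \<open>exp (C * \<theta>) * nui \<theta> F\<close> is nondecreasing. The path is shorter than 2,
  which gives the exponent \<open>2 * C\<close>.\<close>

lemma nui_compare:
  assumes \<theta>: "0 \<le> \<theta>" "\<theta> \<le> pi / 2" and F: "depn 8 F" and pos: "\<And>\<sigma>. 0 \<le> F \<sigma>"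
  shows "nui \<theta> F \<le> exp (4 * rcc 8 * (real S) ^ 4) * nuR S N \<beta> h D F"
proof -
  define C where "C = 2 * rcc 8 * (real S) ^ 4"
  have C: "0 \<le> C" unfolding C_def using rcc_nonneg[of 8] by simp
  have bound: "\<bar>2 * sin t * cos t * gen 8 t F\<bar> \<le> C * nui t F" for t
  proof -
    have nn: "0 \<le> nui t F" using nui_mono[of "\<lambda>_. 0" F t] nui_const[of t 0] pos by simp
    have "nui t (\<lambda>\<sigma>. \<bar>F \<sigma>\<bar> * \<bar>xm a b \<sigma>\<bar>) \<le> 2 * (real S)\<^sup>2 * nui t F" if "a < 12" "b < 12" for a b
      unfolding nui_cmult[symmetric]
    proof (rule nui_mono)
      fix \<sigma> assume "\<sigma> \<in> PiE {..<12::nat} (\<lambda>_. configs S N)"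
      from mult_left_mono[OF xm_bound[OF this that], of "F \<sigma>"] pos[of \<sigma>]
      show "\<bar>F \<sigma>\<bar> * \<bar>xm a b \<sigma>\<bar> \<le> 2 * (real S)\<^sup>2 * F \<sigma>" by (simp add: mult_ac)
    qed
    then have "(\<Sum>a\<le>8. \<Sum>b\<le>Suc 8. \<bar>rc 8 a\<bar> * \<bar>rc (Suc 8) b\<bar> * nui t (\<lambda>\<sigma>. \<bar>F \<sigma>\<bar> * \<bar>xm a b \<sigma>\<bar>))
      \<le> (\<Sum>a\<le>8. \<Sum>b\<le>Suc 8. \<bar>rc 8 a\<bar> * \<bar>rc (Suc 8) b\<bar> * (2 * (real S)\<^sup>2 * nui t F))"
      by (intro sum_mono mult_left_mono) auto
    also have "\<dots> = rcc 8 * (2 * (real S)\<^sup>2 * nui t F)"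
      unfolding rcc_def sum_distrib_right ..
    finally have "\<bar>gen 8 t F\<bar> \<le> \<beta>\<^sup>2 / 2 * (real S)\<^sup>2 * (rcc 8 * (2 * (real S)\<^sup>2 * nui t F))"
      by (intro order_trans[OF gen_bound] mult_left_mono) auto
    also have "\<dots> = \<beta>\<^sup>2 * (C / 2 * nui t F)"
      by (simp add: C_def power2_eq_square eval_nat_numeral mult_ac)
    also have "\<dots> \<le> 1 * (C / 2 * nui t F)"
      using \<beta> C nn by (intro mult_right_mono) (auto simp: power_le_one)
    finally have g: "\<bar>gen 8 t F\<bar> \<le> C / 2 * nui t F" by simp
    have "\<bar>2 * sin t * cos t\<bar> \<le> 2 * (1 * 1)"
      unfolding abs_mult mult.assoc by (intro mult_mono) auto
    with g have "\<bar>2 * sin t * cos t\<bar> * \<bar>gen 8 t F\<bar> \<le> 2 * (C / 2 * nui t F)"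
      by (intro mult_mono) auto
    then show ?thesis by (simp add: abs_mult mult_ac)
  qed
  have "exp (C * \<theta>) * nui \<theta> F \<le> exp (C * (pi / 2)) * nui (pi / 2) F"
  proof (rule DERIV_nonneg_imp_nondecreasing[OF \<theta>(2)])
    fix t
    have "((\<lambda>t. exp (C * t) * nui t F) has_real_derivative
        exp (C * t) * (C * nui t F + 2 * sin t * cos t * gen 8 t F)) (at t)"
    proof -
      have "((\<lambda>t. exp (C * t)) has_real_derivative C * exp (C * t)) (at t)"
        by (auto intro!: derivative_eq_intros)
      from DERIV_mult[OF this nui_derivative[OF _ F]] show ?thesis by (simp add: algebra_simps)
    qed
    moreover have "0 \<le> C * nui t F + 2 * sin t * cos t * gen 8 t F"
      using bound[of t] by linarith
    ultimately show "\<exists>y. ((\<lambda>t. exp (C * t) * nui t F) has_real_derivative y) (at t) \<and> 0 \<le> y"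
      by (meson exp_ge_zero mult_nonneg_nonneg)
  qed
  moreover have nn: "0 \<le> nui t F" for t using nui_mono[of "\<lambda>_. 0" F t] nui_const[of t 0] pos by simp
  moreover have "1 * nui \<theta> F \<le> exp (C * \<theta>) * nui \<theta> F"
    using C \<theta> nn by (intro mult_right_mono) auto
  moreover have "exp (C * (pi / 2)) * nui (pi / 2) F \<le> exp (C * 2) * nui (pi / 2) F"
  proof (intro mult_right_mono nn)
    have "C * (pi / 2) \<le> C * 2" using C pi_half_less_two by (intro mult_left_mono) auto
    then show "exp (C * (pi / 2)) \<le> exp (C * 2)" by simp
  qed
  ultimately have "nui \<theta> F \<le> exp (C * 2) * nui (pi / 2) F" by linarith
  then show ?thesis by (simp add: C_def nui_half_pi mult_ac)
qed

end

section \<open>The decoupled endpoint\<close>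

lemma wsite_pos: "0 < wsite \<beta> h D p q \<eta> s"
  by (simp add: wsite_def)

lemma sum_wsite_pos: "0 < (\<Sum>s\<in>spins S. wsite \<beta> h D p q \<eta> s)"
  using zero_in_spins[of S] by (intro sum_pos finite_spins) (auto simp: wsite_pos)

lemma site_avg_mono:
  assumes "\<And>s. s \<in> spins S \<Longrightarrow> \<phi> s \<le> \<psi> s"
  shows "site_avg S \<beta> h D p q \<eta> \<phi> \<le> site_avg S \<beta> h D p q \<eta> \<psi>"
  unfolding site_avg_def
  by (intro divide_right_mono sum_mono mult_right_mono assms less_imp_le[OF sum_wsite_pos] less_imp_le[OF wsite_pos])

lemma site_avg_const: "site_avg S \<beta> h D p q \<eta> (\<lambda>_. c) = c"
  using sum_wsite_pos[where S = S and \<beta> = \<beta> and h = h and D = D and p = p and q = q and \<eta> = \<eta>]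
  by (simp add: site_avg_def flip: sum_distrib_left)

lemma mom_zero: "mom S \<beta> h D p q 0 \<eta> = 1"
  by (simp add: mom_def site_avg_const)

text \<open>In contrast to \<open>rep_indep\<close>, \<open>F\<close> may still depend on replica
  \<open>b\<close>: at the decoupled endpoint it sees the other sites of that replica, and only the
  spin at site \<open>k\<close> splits off.\<close>

lemma rep_factor:
  assumes b: "b < R"
    and m: "\<And>\<sigma>. (\<Sum>x\<in>X. w b x * (F (\<sigma>(b := x)) * \<phi> x)) = m * (\<Sum>x\<in>X. w b x * F (\<sigma>(b := x)))"
  shows "rep R X w (\<lambda>\<sigma>. F \<sigma> * \<phi> (\<sigma> b)) = m * rep R X w F"
proof -
  have *: "(\<Sum>x\<in>X. w b x * (F (\<sigma>(b := x)) * \<phi> ((\<sigma>(b := x)) b))) = m * (\<Sum>x\<in>X. w b x * F (\<sigma>(b := x)))" for \<sigma>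
    using m[of \<sigma>] by simp
  show ?thesis
    unfolding rep_split[OF b] * by (simp add: sum_distrib_left mult.left_commute)
qed

definition cnt :: "nat list \<Rightarrow> nat \<Rightarrow> nat" where
  "cnt as r = length (filter (\<lambda>a. a = r) as)"

lemma prod_power_cnt:
  fixes f :: "nat \<Rightarrow> real"
  assumes "set as \<subseteq> {..<R}"
  shows "(\<Prod>r<R. f r ^ cnt as r) = prod_list (map f as)"
  using assms
proof (induction as)
  case Nil show ?case by (simp add: cnt_def)
next
  case (Cons a as)
  have "(\<Prod>r<R. f r ^ cnt (a # as) r) = (\<Prod>r<R. (if a = r then f r else 1) * f r ^ cnt as r)"
    by (intro prod.cong) (auto simp: cnt_def)
  then show ?case using Cons by (simp add: prod.distrib)
qed

context cavity
begin

definition sindep :: "((nat \<Rightarrow> nat \<Rightarrow> int) \<Rightarrow> real) \<Rightarrow> bool" where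
  "sindep F \<longleftrightarrow> (\<forall>\<sigma> b s. F (\<sigma>(b := (\<sigma> b)(k := s))) = F \<sigma>)"

definition hm :: "(nat \<times> nat \<Rightarrow> real) \<Rightarrow> (nat \<Rightarrow> int) \<Rightarrow> real" where
  "hm g x = (\<Sum>j\<in>{j \<in> pairs N. k \<noteq> fst j \<and> k \<noteq> snd j}. g j * (\<beta> / sqrt N * (x (fst j) * x (snd j))))
     + D * (\<Sum>i\<in>{..<N} - {k}. real_of_int (x i) ^ 2) + h * (\<Sum>i\<in>{..<N} - {k}. real_of_int (x i))"

lemma hm_upd: "hm g (x(k := s)) = hm g x"
  unfolding hm_def by (intro arg_cong2[where f = "(+)"] arg_cong2[where f = "(*)"] sum.cong refl) auto

lemma hm_upd_z: "hm (g((0, 0) := y)) x = hm g x"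
  unfolding hm_def
  by (intro arg_cong2[where f = "(+)"] arg_cong2[where f = "(*)"] sum.cong refl) (auto simp: pairs_def)

text \<open>At angle 0 all couplings of site \<open>k\<close> are switched off, so the Gibbs weight
  splits into a weight of the other sites and the one-site weight with \<eta> equal to the extra
  Gaussian.\<close>

lemma exp_ham_zero: "exp (ham 0 g x) = exp (hm g x) * wsite \<beta> h D p q (g (0, 0)) (x k)"
proof -
  have z: "(0, 0) \<notin> pairs N" by (simp add: pairs_def)
  have kN: "k \<in> {..<N}" using k by simp
  have "(\<Sum>j\<in>pairs N. amp 0 j * g j * cpl j x) =
    (\<Sum>j\<in>{j \<in> pairs N. k \<noteq> fst j \<and> k \<noteq> snd j}. amp 0 j * g j * cpl j x)"
    by (rule sum.mono_neutral_right) (use z in \<open>auto simp: finite_pairs amp_def\<close>)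
  also have "\<dots> = (\<Sum>j\<in>{j \<in> pairs N. k \<noteq> fst j \<and> k \<noteq> snd j}. g j * (\<beta> / sqrt N * (x (fst j) * x (snd j))))"
    by (rule sum.cong[OF refl]) (use z in \<open>auto simp: amp_def cpl_def\<close>)
  finally have "ham 0 g x = hm g x + (\<beta> * sqrt q * g (0, 0) * real_of_int (x k) + h * real_of_int (x k)
      + (D + \<beta>\<^sup>2 / 2 * (p - q)) * real_of_int (x k) ^ 2)"
    unfolding ham_def hm_def fld_def
    by (subst sum.insert[OF finite_pairs z], subst (1 2) sum.remove[OF _ kN])
      (simp_all add: amp_def cpl_def algebra_simps)
  then show ?thesis by (simp add: exp_add wsite_def)
qed

definition rest :: "(nat \<times> nat \<Rightarrow> real) \<Rightarrow> ((nat \<Rightarrow> int) \<Rightarrow> real) \<Rightarrow> real" where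
  "rest g f = (\<Sum>y\<in>PiE ({..<N} - {k}) (\<lambda>_. spins S). exp (hm g y) * f y)"

lemma sum_site_factor:
  assumes f: "\<And>x s. f (x(k := s)) = f x"
  shows "(\<Sum>x\<in>configs S N. exp (ham 0 g x) * (f x * \<phi> (x k))) =
    rest g f * (\<Sum>s\<in>spins S. \<phi> s * wsite \<beta> h D p q (g (0, 0)) s)"
proof -
  have kN: "k \<in> {..<N}" using k by simp
  show ?thesis
    unfolding configs_def rest_def sum_PiE_split[OF kN] exp_ham_zero hm_upd f sum_product
    by (intro sum.cong refl) (simp add: mult_ac)
qed

lemma prb_site_factor:
  assumes f: "\<And>x s. f (x(k := s)) = f x"
  shows "(\<Sum>x\<in>configs S N. prb (configs S N) (ham 0 g) x * (f x * \<phi> (x k))) =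
    rest g f / rest g (\<lambda>_. 1) * site_avg S \<beta> h D p q (g (0, 0)) \<phi>"
  using sum_site_factor[OF f, where g = g and \<phi> = \<phi>] sum_site_factor[of "\<lambda>_. 1" g "\<lambda>_. 1"]
  by (simp add: prb_def site_avg_def sum_divide_distrib[symmetric])

lemma prb_site_indep:
  assumes f: "\<And>x s. f (x(k := s)) = f x"
  shows "(\<Sum>x\<in>configs S N. prb (configs S N) (ham 0 g) x * f x) = rest g f / rest g (\<lambda>_. 1)"
  using prb_site_factor[OF f, where g = g and \<phi> = "\<lambda>_. 1"] by (simp add: site_avg_const)

lemma sindep_upd:
  assumes "sindep F" shows "F (\<sigma>(b := x(k := s))) = F (\<sigma>(b := x))"
  using assms[unfolded sindep_def, rule_format, of "\<sigma>(b := x)" b s] by simp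

text \<open>The extra Gaussian changes the weight of every replica, but only through its factor at
  site \<open>k\<close>. That factor cancels against the normalisation when \<open>F\<close> ignores
  the site, one replica at a time.\<close>

lemma gav_zero_upd:
  assumes F: "sindep F"
  shows "gav 12 (configs S N) (ham 0 (g((0, 0) := y))) F = gav 12 (configs S N) (ham 0 g) F"
  unfolding gav_def
proof (rule rep_change_weights)
  fix b and \<sigma> :: "nat \<Rightarrow> nat \<Rightarrow> int"
  have "rest (g((0, 0) := y)) f = rest g f" for f by (simp add: rest_def hm_upd_z)
  then show "(\<Sum>x\<in>configs S N. prb (configs S N) (ham 0 (g((0, 0) := y))) x * F (\<sigma>(b := x))) =
    (\<Sum>x\<in>configs S N. prb (configs S N) (ham 0 g) x * F (\<sigma>(b := x)))"
    using prb_site_indep[of "\<lambda>x. F (\<sigma>(b := x))"] sindep_upd[OF F] by simp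
qed

lemma gav_zero_factor:
  assumes F: "sindep F" and A: "finite A" "A \<subseteq> {..<12}"
  shows "gav 12 (configs S N) (ham 0 g) (\<lambda>\<sigma>. F \<sigma> * (\<Prod>r\<in>A. \<phi> r (\<sigma> r k))) =
    gav 12 (configs S N) (ham 0 g) F * (\<Prod>r\<in>A. site_avg S \<beta> h D p q (g (0, 0)) (\<phi> r))"
  using A
proof (induction A rule: finite_induct)
  case (insert b A)
  let ?F = "\<lambda>\<sigma>. F \<sigma> * (\<Prod>r\<in>A. \<phi> r (\<sigma> r k))"
  have "gav 12 (configs S N) (ham 0 g) (\<lambda>\<sigma>. ?F \<sigma> * \<phi> b (\<sigma> b k)) =
    site_avg S \<beta> h D p q (g (0, 0)) (\<phi> b) * gav 12 (configs S N) (ham 0 g) ?F"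
    unfolding gav_def
  proof (rule rep_factor[where \<phi> = "\<lambda>x. \<phi> b (x k)"])
    show "b < 12" using insert by simp
    fix \<sigma> :: "nat \<Rightarrow> nat \<Rightarrow> int"
    have ind: "?F (\<sigma>(b := x(k := s))) = ?F (\<sigma>(b := x))" for x s
      using insert(2) sindep_upd[OF F] by (intro arg_cong2[where f = "(*)"] prod.cong) auto
    show "(\<Sum>x\<in>configs S N. prb (configs S N) (ham 0 g) x * (?F (\<sigma>(b := x)) * \<phi> b (x k))) =
      site_avg S \<beta> h D p q (g (0, 0)) (\<phi> b) * (\<Sum>x\<in>configs S N. prb (configs S N) (ham 0 g) x * ?F (\<sigma>(b := x)))"
      using prb_site_factor[of "\<lambda>x. ?F (\<sigma>(b := x))" g "\<phi> b", OF ind]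
        prb_site_indep[of "\<lambda>x. ?F (\<sigma>(b := x))" g, OF ind] by simp
  qed
  then show ?case using insert by (simp add: mult_ac)
qed simp

text \<open>The extra Gaussian governs the one-site averages and is independent of the disorder that
  governs \<open>F\<close>, so Fubini separates the two.\<close>

lemma nui_zero_factor:
  assumes F: "sindep F"
  shows "nui 0 (\<lambda>\<sigma>. F \<sigma> * (\<Prod>r<12. \<phi> r (\<sigma> r k))) =
    nui 0 F * Eeta (\<lambda>\<eta>. \<Prod>r<12. site_avg S \<beta> h D p q \<eta> (\<phi> r))"
proof -
  interpret stdN: prob_space stdN by (rule prob_space_stdN)
  have z: "(0, 0) \<notin> pairs N" by (simp add: pairs_def)
  have *: "gav 12 (configs S N) (ham 0 (g((0, 0) := y))) (\<lambda>\<sigma>. F \<sigma> * (\<Prod>r<12. \<phi> r (\<sigma> r k))) =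
    gav 12 (configs S N) (ham 0 g) F * (\<Prod>r<12. site_avg S \<beta> h D p q y (\<phi> r))" for g y
    by (subst gav_zero_factor[OF F]) (simp_all add: gav_zero_upd[OF F])
  show ?thesis
    unfolding nui_def Eeta_def
    by (subst (1 2) integral_gaussians_insert[OF finite_pairs z integrable_gav])
      (simp add: * gav_zero_upd[OF F] stdN.prob_space[simplified])
qed

definition mon :: "nat list \<Rightarrow> (nat \<Rightarrow> nat \<Rightarrow> int) \<Rightarrow> real" where
  "mon as \<sigma> = prod_list (map (\<lambda>a. eps a \<sigma>) as)"

text \<open>The limiting expectation of a monomial in the spins of one site. Given \<eta> the
  replicas are independent, so only the multiplicity of each replica matters, and it selects the
  moment.\<close>

definition W :: "nat list \<Rightarrow> real" where
  "W as = Eeta (\<lambda>\<eta>. \<Prod>r<12. mom S \<beta> h D p q (cnt as r) \<eta>)"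

lemma nui_zero_mon:
  assumes F: "sindep F" and as: "set as \<subseteq> {..<12}"
  shows "nui 0 (\<lambda>\<sigma>. F \<sigma> * mon as \<sigma>) = nui 0 F * W as"
  using nui_zero_factor[OF F, of "\<lambda>r s. real_of_int s ^ cnt as r"] prod_power_cnt[OF as]
  by (simp add: mon_def eps_def W_def mom_def)

lemma sindep_xm: "sindep (xm a b)"
  unfolding sindep_def xm_def
  by (intro allI arg_cong2[where f = "(-)"] arg_cong2[where f = "(*)"] sum.cong refl) auto

lemma sindep_mult: "sindep F \<Longrightarrow> sindep G \<Longrightarrow> sindep (\<lambda>\<sigma>. F \<sigma> * G \<sigma>)"
  by (simp add: sindep_def)

lemma sindep_power: "sindep F \<Longrightarrow> sindep (\<lambda>\<sigma>. F \<sigma> ^ m)"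
  by (simp add: sindep_def)

lemma sindep_const: "sindep (\<lambda>_. c)"
  by (simp add: sindep_def)

end

section \<open>Expansions along the path\<close>

text \<open>Brings any tuple of distinct replicas into standard position, which is how replica
  symmetry is applied.\<close>

lemma permutes_extend:
  assumes "distinct xs" "set xs \<subseteq> {..<R}"
  shows "\<exists>\<pi>. \<pi> permutes {..<R} \<and> (\<forall>i<length xs. \<pi> i = xs ! i)"
  using assms
proof (induction xs rule: rev_induct)
  case Nil
  show ?case by (rule exI[of _ id], rule conjI, rule permutes_id, simp)
next
  case (snoc x xs)
  then obtain \<pi> where \<pi>: "\<pi> permutes {..<R}" "\<And>i. i < length xs \<Longrightarrow> \<pi> i = xs ! i" by auto
  let ?n = "length xs"
  have "card (set (xs @ [x])) \<le> card {..<R}" using snoc.prems(2) by (intro card_mono) auto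
  then have n: "?n < R" using snoc.prems(1) by (simp add: distinct_card)
  have \<pi>n: "\<pi> ?n < R" using permutes_in_image[OF \<pi>(1), of ?n] n by simp
  have x: "x < R" using snoc.prems(2) by simp
  show ?case
  \<comment> \<open>The transposition redirects the value at \<open>?n\<close> to \<open>x\<close>.
    The earlier values differ from both exchanged points and stay in place.\<close>
  proof (intro exI[of _ "Transposition.transpose (\<pi> ?n) x \<circ> \<pi>"] conjI allI impI)
    show "Transposition.transpose (\<pi> ?n) x \<circ> \<pi> permutes {..<R}"
      by (intro permutes_compose \<pi>(1) permutes_swap_id) (use \<pi>n x in auto)
    fix i assume i: "i < length (xs @ [x])"
    show "(Transposition.transpose (\<pi> ?n) x \<circ> \<pi>) i = (xs @ [x]) ! i"
    proof (cases "i = ?n")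
      case False
      with i have i': "i < ?n" by simp
      have "\<pi> i \<noteq> \<pi> ?n" using permutes_inj[OF \<pi>(1)] False by (auto dest: injD)
      moreover have "\<pi> i \<noteq> x" using \<pi>(2)[OF i'] snoc.prems(1) i' by (auto simp: in_set_conv_nth)
      ultimately show ?thesis using \<pi>(2)[OF i'] i' by (simp add: nth_append Transposition.transpose_def)
    qed simp
  qed
qed

text \<open>The constant of a first-order estimate: the bound for the two spins at the site, the
  loss in \<open>nui_compare\<close>, and the coefficients of the generator.\<close>

definition Kc :: "nat \<Rightarrow> nat \<Rightarrow> real" where
  "Kc S n = (real S)\<^sup>2 * exp (4 * rcc 8 * (real S) ^ 4) * rcc n"

lemma Kc_nonneg: "0 \<le> Kc S n"
  by (simp add: Kc_def rcc_nonneg)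

text \<open>Diagonal and off-diagonal moments are added because the generator mixes them, so their
  bounds must be proved together.\<close>

definition ovm :: "nat \<Rightarrow> nat \<Rightarrow> real \<Rightarrow> real \<Rightarrow> real \<Rightarrow> real \<Rightarrow> real \<Rightarrow> nat \<Rightarrow> real" where
  "ovm S N \<beta> h D p q j = nuR S N \<beta> h D (\<lambda>\<sigma>. ovl N p q 0 0 \<sigma> ^ (2 * j)) + nuR S N \<beta> h D (\<lambda>\<sigma>. ovl N p q 0 1 \<sigma> ^ (2 * j))"

lemma depn_mult: "depn n F \<Longrightarrow> depn n G \<Longrightarrow> depn n (\<lambda>\<sigma>. F \<sigma> * G \<sigma>)"
  by (simp add: depn_def)

lemma depn_diff: "depn n F \<Longrightarrow> depn n G \<Longrightarrow> depn n (\<lambda>\<sigma>. F \<sigma> - G \<sigma>)"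
  by (simp add: depn_def)

lemma depn_const: "depn n (\<lambda>_. c)"
  by (simp add: depn_def)

lemma depn_power: "depn n F \<Longrightarrow> depn n (\<lambda>\<sigma>. F \<sigma> ^ m)"
  by (simp add: depn_def)

lemma depn_abs: "depn n F \<Longrightarrow> depn n (\<lambda>\<sigma>. \<bar>F \<sigma>\<bar>)"
  by (simp add: depn_def)

lemma even_power_add_le:
  fixes x y :: real
  shows "(x + y) ^ (2 * j) \<le> 4 ^ j * (x ^ (2 * j) + y ^ (2 * j))"
proof -
  have sq: "(x + y)\<^sup>2 \<le> 4 * (max (x\<^sup>2) (y\<^sup>2))"
    using sum_squares_ge_zero[of "x - y" 0] by (auto simp: max_def power2_eq_square algebra_simps)
  have "(x + y) ^ (2 * j) \<le> (4 * max (x\<^sup>2) (y\<^sup>2)) ^ j"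
    unfolding power_mult by (rule power_mono[OF sq]) simp
  also have "\<dots> = 4 ^ j * max (x\<^sup>2) (y\<^sup>2) ^ j" by (simp add: power_mult_distrib)
  also have "max (x\<^sup>2) (y\<^sup>2) ^ j \<le> x ^ (2 * j) + y ^ (2 * j)"
    unfolding power_mult by (auto simp: max_def)
  finally show ?thesis by simp
qed

lemma abs_power_mult_le:
  fixes x y :: real
  shows "\<bar>x\<bar> ^ (2 * m + 1) * \<bar>y\<bar> \<le> x ^ (2 * Suc m) + y ^ (2 * Suc m)"
proof -
  let ?z = "max \<bar>x\<bar> \<bar>y\<bar>"
  have "\<bar>x\<bar> ^ (2 * m + 1) * \<bar>y\<bar> \<le> ?z ^ (2 * m + 1) * ?z"
    by (intro mult_mono power_mono) auto
  also have "\<dots> = ?z ^ (2 * Suc m)" by simp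
  also have "\<dots> \<le> \<bar>x\<bar> ^ (2 * Suc m) + \<bar>y\<bar> ^ (2 * Suc m)"
    by (simp only: max_def split: if_split) (auto simp del: power_Suc)
  also have "\<dots> = x ^ (2 * Suc m) + y ^ (2 * Suc m)"
    by (simp only: power_even_abs even_mult_iff even_numeral simp_thms)
  finally show ?thesis .
qed

lemma ovl_permute:
  assumes "\<pi> permutes {..<R}"
  shows "ovl N p q a b (\<sigma> \<circ> \<pi>) = ovl N p q (\<pi> a) (\<pi> b) \<sigma>"
  using permutes_inj[OF assms] by (auto simp: ovl_def qab_def dest: injD)

context cavity
begin

abbreviation nu :: "((nat \<Rightarrow> nat \<Rightarrow> int) \<Rightarrow> real) \<Rightarrow> real" where
  "nu \<equiv> nuR S N \<beta> h D"

lemmas nu_add = nui_add[of "pi / 2", unfolded nui_half_pi]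
  and nu_diff = nui_diff[of "pi / 2", unfolded nui_half_pi]
  and nu_cmult = nui_cmult[of "pi / 2", unfolded nui_half_pi]
  and nu_sum = nui_sum[of "pi / 2", unfolded nui_half_pi]
  and nu_cong = nui_cong[where t = "pi / 2", unfolded nui_half_pi]
  and nu_mono = nui_mono[where t = "pi / 2", unfolded nui_half_pi]
  and nu_const = nui_const[of "pi / 2", unfolded nui_half_pi]
  and nu_abs = nui_abs[of "pi / 2", unfolded nui_half_pi]
  and nu_permute = nui_permute[where t = "pi / 2", unfolded nui_half_pi]

lemma nu_nonneg: "(\<And>\<sigma>. 0 \<le> F \<sigma>) \<Longrightarrow> 0 \<le> nu F"
  using nu_mono[of "\<lambda>_. 0" F] nu_const[of 0] by simp

lemma depn_xm: "a < n \<Longrightarrow> b < n \<Longrightarrow> depn n (xm a b)"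
  by (simp add: depn_def xm_def)

lemma depn_eps: "a < n \<Longrightarrow> depn n (eps a)"
  by (simp add: depn_def eps_def)

text \<open>\<open>nui_compare\<close> moves the average to the full system. It admits functions of
  8 replicas, and \<open>\<bar>F\<bar> * \<bar>xm a b\<bar>\<close> with
  \<open>b \<le> Suc n\<close> stays within this limit exactly for \<open>n \<le> 6\<close>.\<close>

lemma gen_le:
  assumes n: "n \<le> 6" and F: "depn n F" and t: "0 \<le> t" "t \<le> pi / 2"
    and M: "\<And>a b. a \<le> n \<Longrightarrow> b \<le> Suc n \<Longrightarrow> nu (\<lambda>\<sigma>. \<bar>F \<sigma>\<bar> * \<bar>xm a b \<sigma>\<bar>) \<le> M"
  shows "\<bar>gen n t F\<bar> \<le> \<beta>\<^sup>2 / 2 * Kc S n * M"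
proof -
  let ?L = "exp (4 * rcc 8 * (real S) ^ 4)"
  have le: "nui t (\<lambda>\<sigma>. \<bar>F \<sigma>\<bar> * \<bar>xm a b \<sigma>\<bar>) \<le> ?L * M" if "a \<le> n" "b \<le> Suc n" for a b
  proof -
    have "nui t (\<lambda>\<sigma>. \<bar>F \<sigma>\<bar> * \<bar>xm a b \<sigma>\<bar>) \<le> ?L * nu (\<lambda>\<sigma>. \<bar>F \<sigma>\<bar> * \<bar>xm a b \<sigma>\<bar>)"
      using that n by (intro nui_compare t depn_mult depn_abs depn_xm depn_mono[OF F]) auto
    also have "\<dots> \<le> ?L * M" using M[OF that] by simp
    finally show ?thesis .
  qed
  have "(\<Sum>a\<le>n. \<Sum>b\<le>Suc n. \<bar>rc n a\<bar> * \<bar>rc (Suc n) b\<bar> * nui t (\<lambda>\<sigma>. \<bar>F \<sigma>\<bar> * \<bar>xm a b \<sigma>\<bar>))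
    \<le> (\<Sum>a\<le>n. \<Sum>b\<le>Suc n. \<bar>rc n a\<bar> * \<bar>rc (Suc n) b\<bar> * (?L * M))"
    by (intro sum_mono mult_left_mono le) (use n in auto)
  also have "\<dots> = rcc n * (?L * M)"
    unfolding rcc_def sum_distrib_right ..
  finally have "\<bar>gen n t F\<bar> \<le> \<beta>\<^sup>2 / 2 * (real S)\<^sup>2 * (rcc n * (?L * M))"
    using n by (intro order_trans[OF gen_bound] mult_left_mono) auto
  then show ?thesis by (simp add: Kc_def mult_ac)
qed

lemma path_bound:
  assumes \<theta>: "0 \<le> \<theta>" "\<theta> \<le> pi / 2" and C: "0 \<le> C"
    and der: "\<And>t. (f has_real_derivative 2 * sin t * cos t * f' t) (at t)"
    and b: "\<And>t. 0 \<le> t \<Longrightarrow> t \<le> pi / 2 \<Longrightarrow> \<bar>f' t\<bar> \<le> C"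
  shows "\<bar>f \<theta> - f 0\<bar> \<le> 4 * C"
proof -
  have "norm (f \<theta> - f 0) \<le> 2 * C * norm (\<theta> - 0)"
  proof (rule field_differentiable_bound[where S = "{0..pi / 2}" and f' = "\<lambda>t. 2 * sin t * cos t * f' t"])
    fix t assume t: "t \<in> {0..pi / 2}"
    show "(f has_real_derivative 2 * sin t * cos t * f' t) (at t within {0..pi / 2})"
      using der by (rule has_field_derivative_at_within)
    have "\<bar>2 * sin t * cos t\<bar> \<le> 2 * (1 * 1)"
      unfolding abs_mult mult.assoc by (intro mult_mono) auto
    then have "\<bar>2 * sin t * cos t\<bar> * \<bar>f' t\<bar> \<le> 2 * C" using b[of t] t by (intro mult_mono) auto
    then show "norm (2 * sin t * cos t * f' t) \<le> 2 * C" by (simp add: abs_mult)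
  qed (use \<theta> in auto)
  also have "\<dots> \<le> 2 * C * 2" using \<theta> C pi_half_less_two by (intro mult_left_mono) auto
  finally show ?thesis by simp
qed

lemma first_order:
  assumes n: "n \<le> 6" and F: "depn n F" and \<theta>: "0 \<le> \<theta>" "\<theta> \<le> pi / 2"
    and M: "\<And>a b. a \<le> n \<Longrightarrow> b \<le> Suc n \<Longrightarrow> nu (\<lambda>\<sigma>. \<bar>F \<sigma>\<bar> * \<bar>xm a b \<sigma>\<bar>) \<le> M"
  shows "\<bar>nui \<theta> F - nui 0 F\<bar> \<le> 2 * \<beta>\<^sup>2 * Kc S n * M"
proof -
  have "0 \<le> M" using M[of 0 0] nu_nonneg[of "\<lambda>\<sigma>. \<bar>F \<sigma>\<bar> * \<bar>xm 0 0 \<sigma>\<bar>"] by simp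
  then have "\<bar>nui \<theta> F - nui 0 F\<bar> \<le> 4 * (\<beta>\<^sup>2 / 2 * Kc S n * M)"
    using n by (intro path_bound[OF \<theta>, where f' = "\<lambda>t. gen n t F"] nui_derivative F gen_le M)
      (auto simp: Kc_nonneg)
  then show ?thesis by (simp add: mult_ac)
qed

text \<open>What remains after subtracting the derivative at angle 0 is a difference of generators,
  to which \<open>first_order\<close> applies with the two replicas brought down by the first
  derivative. Hence the power \<beta>^4 and the index \<open>n + 2\<close>, which must not exceed
  6.\<close>

lemma second_order:
  assumes n: "n \<le> 4" and F: "depn n F"
    and M: "\<And>a b c d. a \<le> n \<Longrightarrow> b \<le> Suc n \<Longrightarrow> c \<le> n + 2 \<Longrightarrow> d \<le> n + 3 \<Longrightarrow>
      nu (\<lambda>\<sigma>. \<bar>F \<sigma> * (eps a \<sigma> * eps b \<sigma>) * xm a b \<sigma>\<bar> * \<bar>xm c d \<sigma>\<bar>) \<le> M"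
  shows "\<bar>nu F - nui 0 F - gen n 0 F\<bar> \<le> 4 * \<beta>^4 * rcc n * Kc S (n + 2) * M"
proof -
  let ?F = "\<lambda>a b \<sigma>. F \<sigma> * (eps a \<sigma> * eps b \<sigma>) * xm a b \<sigma>"
  have M0: "0 \<le> M" using M[of 0 0 0 0] nu_nonneg[of "\<lambda>\<sigma>. \<bar>?F 0 0 \<sigma>\<bar> * \<bar>xm 0 0 \<sigma>\<bar>"] by simp
  have diff: "\<bar>gen n t F - gen n 0 F\<bar> \<le> \<beta>^4 * rcc n * Kc S (n + 2) * M" if t: "0 \<le> t" "t \<le> pi / 2" for t
  proof -
    have 1: "\<bar>nui t (?F a b) - nui 0 (?F a b)\<bar> \<le> 2 * \<beta>\<^sup>2 * Kc S (n + 2) * M" if "a \<le> n" "b \<le> Suc n" for a b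
      by (rule first_order[OF _ _ t])
        (use that n in \<open>auto intro!: depn_mult depn_eps depn_xm depn_mono[OF F] M simp: eval_nat_numeral\<close>)
    define Y where "Y = (\<Sum>a\<le>n. \<Sum>b\<le>Suc n. rc n a * rc (Suc n) b * (nui t (?F a b) - nui 0 (?F a b)))"
    have "\<bar>Y\<bar> \<le> (\<Sum>a\<le>n. \<Sum>b\<le>Suc n. \<bar>rc n a\<bar> * \<bar>rc (Suc n) b\<bar> * (2 * \<beta>\<^sup>2 * Kc S (n + 2) * M))"
      unfolding Y_def
      by (rule order_trans[OF sum_abs], rule sum_mono, rule order_trans[OF sum_abs], rule sum_mono,
        unfold abs_mult, rule mult_left_mono, rule 1[unfolded abs_mult]) simp_all
    also have "\<dots> = rcc n * (2 * \<beta>\<^sup>2 * Kc S (n + 2) * M)"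
      unfolding rcc_def sum_distrib_right ..
    finally have "\<beta>\<^sup>2 / 2 * \<bar>Y\<bar> \<le> \<beta>\<^sup>2 / 2 * (rcc n * (2 * \<beta>\<^sup>2 * Kc S (n + 2) * M))"
      by (intro mult_left_mono) auto
    also have "\<dots> = \<beta>^4 * rcc n * Kc S (n + 2) * M"
      by (simp add: power4_eq_xxxx power2_eq_square)
    also have "\<beta>\<^sup>2 / 2 * \<bar>Y\<bar> = \<bar>\<beta>\<^sup>2 / 2 * Y\<bar>" by (simp add: abs_mult)
    also have "\<beta>\<^sup>2 / 2 * Y = gen n t F - gen n 0 F"
      unfolding gen_def Y_def right_diff_distrib[symmetric] by (simp only: sum_subtractf right_diff_distrib)
    finally show ?thesis .
  qed
  \<comment> \<open>The square of the sine is the usual parameter: its derivative cancels the value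
    of the generator at the decoupled end, and it runs from 0 to 1.\<close>
  have "\<bar>(nui (pi / 2) F - (sin (pi / 2))\<^sup>2 * gen n 0 F) - (nui 0 F - (sin 0)\<^sup>2 * gen n 0 F)\<bar>
    \<le> 4 * (\<beta>^4 * rcc n * Kc S (n + 2) * M)"
  proof (rule path_bound[where f' = "\<lambda>t. gen n t F - gen n 0 F" and f = "\<lambda>t. nui t F - (sin t)\<^sup>2 * gen n 0 F"])
    fix t
    have "((\<lambda>t. (sin t)\<^sup>2 * gen n 0 F) has_real_derivative 2 * sin t * cos t * gen n 0 F) (at t)"
      by (auto intro!: derivative_eq_intros)
    moreover have "((\<lambda>t. nui t F) has_real_derivative 2 * sin t * cos t * gen n t F) (at t)"
      using n by (intro nui_derivative F) auto
    ultimately show "((\<lambda>t. nui t F - (sin t)\<^sup>2 * gen n 0 F) has_real_derivative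
        2 * sin t * cos t * (gen n t F - gen n 0 F)) (at t)"
      using DERIV_diff by (fastforce simp: right_diff_distrib)
  qed (use M0 diff in \<open>auto simp: Kc_nonneg rcc_nonneg\<close>)
  then show ?thesis by (simp add: nui_half_pi algebra_simps)
qed

lemma nu_ovl_power_le:
  assumes "a < 12" "b < 12"
  shows "nu (\<lambda>\<sigma>. ovl N p q a b \<sigma> ^ (2 * j)) \<le> ovm S N \<beta> h D p q j"
proof -
  have nn: "0 \<le> nu (\<lambda>\<sigma>. ovl N p q a b \<sigma> ^ (2 * j))" for a b by (rule nu_nonneg) simp
  have perm: "nu (\<lambda>\<sigma>. ovl N p q (\<pi> a) (\<pi> b) \<sigma> ^ (2 * j)) = nu (\<lambda>\<sigma>. ovl N p q a b \<sigma> ^ (2 * j))"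
    if "\<pi> permutes {..<12}" for \<pi> a b
    using nu_permute[OF that, of "\<lambda>\<sigma>. ovl N p q a b \<sigma> ^ (2 * j)"] by (simp only: ovl_permute[OF that])
  show ?thesis
  proof (cases "a = b")
    case True
    obtain \<pi> where \<pi>: "\<pi> permutes {..<12}" "\<pi> 0 = a"
      using permutes_extend[of "[a]" 12] assms by auto
    from perm[OF \<pi>(1), of 0 0] \<pi>(2) True nn[of 0 1] show ?thesis by (simp add: ovm_def)
  next
    case False
    obtain \<pi> where \<pi>: "\<pi> permutes {..<12}" "\<forall>i<length [a, b]. \<pi> i = [a, b] ! i"
      using permutes_extend[of "[a, b]" 12] assms False by auto
    from \<pi>(2) have "\<pi> 0 = a" "\<pi> 1 = b" by auto
    with perm[OF \<pi>(1), of 0 1] nn[of 0 0] show ?thesis by (simp add: ovm_def)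
  qed
qed

lemma ovl_xm_diff:
  assumes "\<sigma> \<in> PiE {..<12::nat} (\<lambda>_. configs S N)" "a < 12" "b < 12"
  shows "\<bar>ovl N p q a b \<sigma> - xm a b \<sigma>\<bar> \<le> (real S)\<^sup>2 / N"
  using eps_bound[OF assms] N by (simp add: ovl_xm field_simps)

lemma nu_xm_power_le:
  assumes ab: "a < 12" "b < 12"
  shows "nu (\<lambda>\<sigma>. xm a b \<sigma> ^ (2 * j)) \<le> 4 ^ j * (ovm S N \<beta> h D p q j + ((real S)\<^sup>2 / N) ^ (2 * j))"
proof -
  have "nu (\<lambda>\<sigma>. xm a b \<sigma> ^ (2 * j)) \<le> nu (\<lambda>\<sigma>. 4 ^ j * (ovl N p q a b \<sigma> ^ (2 * j) + ((real S)\<^sup>2 / N) ^ (2 * j)))"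
  proof (rule nu_mono)
    fix \<sigma> assume \<sigma>: "\<sigma> \<in> PiE {..<12::nat} (\<lambda>_. configs S N)"
    have "\<bar>xm a b \<sigma> - ovl N p q a b \<sigma>\<bar> ^ (2 * j) \<le> ((real S)\<^sup>2 / N) ^ (2 * j)"
      using ovl_xm_diff[OF \<sigma> ab] by (intro power_mono) (auto simp: abs_minus_commute)
    then have "(xm a b \<sigma> - ovl N p q a b \<sigma>) ^ (2 * j) \<le> ((real S)\<^sup>2 / N) ^ (2 * j)"
      by (simp add: power_even_abs)
    moreover have "xm a b \<sigma> ^ (2 * j) \<le> 4 ^ j * (ovl N p q a b \<sigma> ^ (2 * j) + (xm a b \<sigma> - ovl N p q a b \<sigma>) ^ (2 * j))"
      using even_power_add_le[of "ovl N p q a b \<sigma>" "xm a b \<sigma> - ovl N p q a b \<sigma>" j] by simp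
    ultimately show "xm a b \<sigma> ^ (2 * j) \<le> 4 ^ j * (ovl N p q a b \<sigma> ^ (2 * j) + ((real S)\<^sup>2 / N) ^ (2 * j))"
      by (meson add_left_mono mult_left_mono order_trans zero_le_numeral zero_le_power)
  qed
  also have "\<dots> = 4 ^ j * (nu (\<lambda>\<sigma>. ovl N p q a b \<sigma> ^ (2 * j)) + ((real S)\<^sup>2 / N) ^ (2 * j))"
    unfolding nu_cmult nu_add nu_const ..
  also have "\<dots> \<le> 4 ^ j * (ovm S N \<beta> h D p q j + ((real S)\<^sup>2 / N) ^ (2 * j))"
    using nu_ovl_power_le[OF ab, of j] by simp
  finally show ?thesis .
qed

lemma eps_qab_bound:
  assumes "\<sigma> \<in> PiE {..<12::nat} (\<lambda>_. configs S N)" "a < 12" "b < 12"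
  shows "\<bar>eps a \<sigma> * eps b \<sigma> - qab p q a b\<bar> \<le> 2 * (real S)\<^sup>2"
  using eps_bound[OF assms] qab_bound[of a b] by linarith

end

locale cavity_fp = cavity +
  assumes fp: "fixed_point S \<beta> h D p q"
begin

text \<open>This is where the fixed point equations enter: they say precisely that the product of
  two spins of the decoupled site has mean \<open>p\<close> or \<open>q\<close>.\<close>

lemma W_pair:
  assumes "a < 12" "b < 12"
  shows "W [a, b] = qab p q a b"
proof (cases "a = b")
  case True
  have "(\<Prod>r<12. mom S \<beta> h D p q (cnt [a, b] r) \<eta>) = (\<Prod>r<12. if r = a then mom S \<beta> h D p q 2 \<eta> else 1)" for \<eta>
    by (rule prod.cong) (use True in \<open>auto simp: cnt_def mom_zero numeral_2_eq_2\<close>)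
  then show ?thesis using fp assms True by (simp add: W_def fixed_point_def qab_def)
next
  case False
  have "(\<Prod>r<12. mom S \<beta> h D p q (cnt [a, b] r) \<eta>) =
    (\<Prod>r<12. (if r = a then mom S \<beta> h D p q 1 \<eta> else 1) * (if r = b then mom S \<beta> h D p q 1 \<eta> else 1))" for \<eta>
    by (rule prod.cong) (use False in \<open>auto simp: cnt_def mom_zero\<close>)
  then show ?thesis using fp assms False
    by (simp add: W_def fixed_point_def qab_def prod.distrib power2_eq_square)
qed

lemma nui_zero_centered:
  assumes F: "sindep F" and ab: "a < 12" "b < 12"
  shows "nui 0 (\<lambda>\<sigma>. (eps a \<sigma> * eps b \<sigma> - qab p q a b) * F \<sigma>) = 0"
proof -
  have "nui 0 (\<lambda>\<sigma>. (eps a \<sigma> * eps b \<sigma> - qab p q a b) * F \<sigma>) =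
    nui 0 (\<lambda>\<sigma>. F \<sigma> * mon [a, b] \<sigma>) - nui 0 (\<lambda>\<sigma>. qab p q a b * F \<sigma>)"
    unfolding nui_diff[symmetric] by (simp add: mon_def algebra_simps)
  then show ?thesis
    using ab by (simp add: nui_zero_mon[OF F] W_pair nui_cmult)
qed

text \<open>The factor of site \<open>k\<close> is centred at the decoupled endpoint, so if the
  other factors omit this site, only the first-order term remains, and it costs \<beta>^2 times the
  next even moment. Restoring the site in the odd power costs \<open>1 / N\<close> times the even
  moment below; the assumption on \<open>c\<close> is the Lipschitz estimate for that power.\<close>

lemma site_moment:
  assumes m: "\<And>x y::real. \<bar>x ^ (2 * m + 1) - y ^ (2 * m + 1)\<bar> \<le> c * \<bar>x - y\<bar> * (x ^ (2 * m) + y ^ (2 * m))"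
    and c: "0 \<le> c" and ab: "a < 2" "b < 2"
  shows "nu (\<lambda>\<sigma>. (eps a \<sigma> * eps b \<sigma> - qab p q a b) * ovl N p q a b \<sigma> ^ (2 * m + 1)) \<le>
    \<beta>\<^sup>2 * (8 * (real S)\<^sup>2 * Kc S 2 * 4 ^ Suc m) * (ovm S N \<beta> h D p q (Suc m) + ((real S)\<^sup>2 / N) ^ (2 * Suc m))
    + (4 * c * (real S) ^ 4 * 4 ^ m) / N * (ovm S N \<beta> h D p q m + ((real S)\<^sup>2 / N) ^ (2 * m))"
proof -
  let ?x = "xm a b" and ?o = "ovl N p q a b" and ?s2 = "(real S)\<^sup>2"
  let ?e = "\<lambda>\<sigma>. eps a \<sigma> * eps b \<sigma> - qab p q a b"
  let ?F = "\<lambda>\<sigma>. ?e \<sigma> * ?x \<sigma> ^ (2 * m + 1)"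
  let ?A = "\<lambda>j. ovm S N \<beta> h D p q j + (?s2 / N) ^ (2 * j)"
  have ab': "a < 12" "b < 12" using ab by auto
  have "\<bar>nui (pi / 2) ?F - nui 0 ?F\<bar> \<le> 2 * \<beta>\<^sup>2 * Kc S 2 * (4 * ?s2 * (4 ^ Suc m * ?A (Suc m)))"
  proof (rule first_order)
    show "depn 2 ?F" using ab by (intro depn_mult depn_diff depn_power depn_const depn_eps depn_xm) auto
    fix i j :: nat assume ij: "i \<le> 2" "j \<le> Suc 2"
    have ij': "i < 12" "j < 12" using ij by auto
    have "nu (\<lambda>\<sigma>. \<bar>?F \<sigma>\<bar> * \<bar>xm i j \<sigma>\<bar>) \<le> nu (\<lambda>\<sigma>. 2 * ?s2 * (?x \<sigma> ^ (2 * Suc m) + xm i j \<sigma> ^ (2 * Suc m)))"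
    proof (rule nu_mono)
      fix \<sigma> assume \<sigma>: "\<sigma> \<in> PiE {..<12::nat} (\<lambda>_. configs S N)"
      have "\<bar>?F \<sigma>\<bar> * \<bar>xm i j \<sigma>\<bar> = \<bar>?e \<sigma>\<bar> * (\<bar>?x \<sigma>\<bar> ^ (2 * m + 1) * \<bar>xm i j \<sigma>\<bar>)"
        by (simp add: abs_mult power_abs mult_ac)
      also have "\<dots> \<le> 2 * ?s2 * (?x \<sigma> ^ (2 * Suc m) + xm i j \<sigma> ^ (2 * Suc m))"
        by (intro mult_mono eps_qab_bound[OF \<sigma> ab'] abs_power_mult_le) auto
      finally show "\<bar>?F \<sigma>\<bar> * \<bar>xm i j \<sigma>\<bar> \<le> 2 * ?s2 * (?x \<sigma> ^ (2 * Suc m) + xm i j \<sigma> ^ (2 * Suc m))" .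
    qed
    also have "\<dots> = 2 * ?s2 * (nu (\<lambda>\<sigma>. ?x \<sigma> ^ (2 * Suc m)) + nu (\<lambda>\<sigma>. xm i j \<sigma> ^ (2 * Suc m)))"
      unfolding nu_cmult nu_add ..
    also have "\<dots> \<le> 2 * ?s2 * (4 ^ Suc m * ?A (Suc m) + 4 ^ Suc m * ?A (Suc m))"
      by (intro mult_left_mono add_mono nu_xm_power_le ab' ij') auto
    finally show "nu (\<lambda>\<sigma>. \<bar>?F \<sigma>\<bar> * \<bar>xm i j \<sigma>\<bar>) \<le> 4 * ?s2 * (4 ^ Suc m * ?A (Suc m))"
      by (simp only: mult_2[symmetric] mult.assoc)
  qed auto
  moreover have "nui 0 ?F = 0"
    by (intro nui_zero_centered sindep_power sindep_xm ab')
  ultimately have 1: "nu ?F \<le> \<beta>\<^sup>2 * (8 * ?s2 * Kc S 2 * 4 ^ Suc m) * ?A (Suc m)"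
    unfolding nui_half_pi by (simp add: mult_ac)
  have "nu (\<lambda>\<sigma>. ?e \<sigma> * (?o \<sigma> ^ (2 * m + 1) - ?x \<sigma> ^ (2 * m + 1))) \<le>
    nu (\<lambda>\<sigma>. 2 * ?s2 * c * (?s2 / N) * (?o \<sigma> ^ (2 * m) + ?x \<sigma> ^ (2 * m)))"
  proof (rule nu_mono)
    fix \<sigma> assume \<sigma>: "\<sigma> \<in> PiE {..<12::nat} (\<lambda>_. configs S N)"
    have nn: "0 \<le> ?o \<sigma> ^ (2 * m) + ?x \<sigma> ^ (2 * m)" by simp
    have "\<bar>?o \<sigma> ^ (2 * m + 1) - ?x \<sigma> ^ (2 * m + 1)\<bar> \<le> c * \<bar>?o \<sigma> - ?x \<sigma>\<bar> * (?o \<sigma> ^ (2 * m) + ?x \<sigma> ^ (2 * m))"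
      by (rule m)
    also have "\<dots> \<le> c * (?s2 / N) * (?o \<sigma> ^ (2 * m) + ?x \<sigma> ^ (2 * m))"
      using ovl_xm_diff[OF \<sigma> ab'] c nn by (intro mult_right_mono mult_left_mono) auto
    finally have "\<bar>?e \<sigma>\<bar> * \<bar>?o \<sigma> ^ (2 * m + 1) - ?x \<sigma> ^ (2 * m + 1)\<bar> \<le>
       (2 * ?s2) * (c * (?s2 / N) * (?o \<sigma> ^ (2 * m) + ?x \<sigma> ^ (2 * m)))"
      by (intro mult_mono eps_qab_bound[OF \<sigma> ab']) auto
    then show "?e \<sigma> * (?o \<sigma> ^ (2 * m + 1) - ?x \<sigma> ^ (2 * m + 1)) \<le>
       2 * ?s2 * c * (?s2 / N) * (?o \<sigma> ^ (2 * m) + ?x \<sigma> ^ (2 * m))"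
      unfolding abs_mult[symmetric] by (simp only: mult.assoc abs_le_iff)
  qed
  also have "\<dots> = 2 * ?s2 * c * (?s2 / N) * (nu (\<lambda>\<sigma>. ?o \<sigma> ^ (2 * m)) + nu (\<lambda>\<sigma>. ?x \<sigma> ^ (2 * m)))"
    unfolding nu_cmult nu_add ..
  also have "\<dots> \<le> 2 * ?s2 * c * (?s2 / N) * (4 ^ m * ?A m + 4 ^ m * ?A m)"
  proof (intro mult_left_mono add_mono nu_xm_power_le ab')
    have nn: "0 \<le> ovm S N \<beta> h D p q m" using nu_ovl_power_le[OF ab', of m] nu_nonneg[of "\<lambda>\<sigma>. ?o \<sigma> ^ (2 * m)"] by simp
    have "nu (\<lambda>\<sigma>. ?o \<sigma> ^ (2 * m)) \<le> 1 * ?A m"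
      using nu_ovl_power_le[OF ab', of m] by (simp add: add_increasing2)
    also have "\<dots> \<le> 4 ^ m * ?A m" using nn by (intro mult_right_mono) auto
    finally show "nu (\<lambda>\<sigma>. ?o \<sigma> ^ (2 * m)) \<le> 4 ^ m * ?A m" .
  qed (use c N in auto)
  also have "\<dots> = (4 * c * (real S) ^ 4 * 4 ^ m) / N * ?A m"
    using N by (simp add: field_simps power2_eq_square eval_nat_numeral)
  finally have 2: "nu (\<lambda>\<sigma>. ?e \<sigma> * (?o \<sigma> ^ (2 * m + 1) - ?x \<sigma> ^ (2 * m + 1))) \<le> (4 * c * (real S) ^ 4 * 4 ^ m) / N * ?A m" .
  have "nu (\<lambda>\<sigma>. ?e \<sigma> * ?o \<sigma> ^ (2 * m + 1)) =
    nu ?F + nu (\<lambda>\<sigma>. ?e \<sigma> * (?o \<sigma> ^ (2 * m + 1) - ?x \<sigma> ^ (2 * m + 1)))"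
    unfolding nu_add[symmetric] by (simp add: algebra_simps)
  with 1 2 show ?thesis by linarith
qed

end

section \<open>Cavity expansion of a two-point function\<close>

lemma sqrt_young:
  fixes u v :: real
  assumes "0 < n"
  shows "2 * (u * v) \<le> sqrt n * u\<^sup>2 + v\<^sup>2 / sqrt n"
proof -
  have "0 \<le> (sqrt n * u - v)\<^sup>2 / sqrt n" using assms by simp
  also have "\<dots> = sqrt n * u\<^sup>2 + v\<^sup>2 / sqrt n - 2 * (u * v)"
    using assms by (simp add: power2_diff field_simps power2_eq_square)
  finally show ?thesis by simp
qed

text \<open>The three lines are the second-order remainder, the cost of returning the first-order
  term from the decoupled endpoint to the full system, and the error in the explicit
  \<open>1 / N\<close> term.\<close>

definition KK :: "nat \<Rightarrow> real \<Rightarrow> real" where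
  "KK S C = 8 * rcc 4 * Kc S 6 * (real S) ^ 4 * C
     + rcc 4 * (real S) ^ 4 * (2 * Kc S 6 * C + 2 * (real S)\<^sup>2 * (C + 1))
     + 4 * Kc S 4 * (real S) ^ 4 * (C + 1)"

context cavity
begin

text \<open>Two factors together have size \<open>1 / N\<close> and the third has size
  \<open>1 / sqrt N\<close>. The weight \<open>sqrt N\<close> in \<open>sqrt_young\<close> balances
  these scales, so second and fourth moments control the third-order ones.\<close>

lemma nu_triple:
  assumes C2: "\<And>a b. a < 12 \<Longrightarrow> b < 12 \<Longrightarrow> nu (\<lambda>\<sigma>. (xm a b \<sigma>)\<^sup>2) \<le> C / N"
    and C4: "\<And>a b. a < 12 \<Longrightarrow> b < 12 \<Longrightarrow> nu (\<lambda>\<sigma>. (xm a b \<sigma>) ^ 4) \<le> C / (real N)\<^sup>2"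
    and ab: "a < 12" "b < 12" "c < 12" "d < 12" "e < 12" "f < 12"
  shows "nu (\<lambda>\<sigma>. \<bar>xm a b \<sigma>\<bar> * \<bar>xm c d \<sigma>\<bar> * \<bar>xm e f \<sigma>\<bar>) \<le> C / (N * sqrt N)"
proof -
  have "nu (\<lambda>\<sigma>. 2 * (\<bar>xm a b \<sigma>\<bar> * \<bar>xm c d \<sigma>\<bar> * \<bar>xm e f \<sigma>\<bar>)) \<le>
    nu (\<lambda>\<sigma>. (sqrt N / 2) * (xm a b \<sigma> ^ 4 + xm c d \<sigma> ^ 4) + (1 / sqrt N) * (xm e f \<sigma>)\<^sup>2)"
  proof (rule nu_mono)
    fix \<sigma>
    let ?x = "xm a b \<sigma>" and ?y = "xm c d \<sigma>" and ?z = "xm e f \<sigma>"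
    have "(?x\<^sup>2 - ?y\<^sup>2)\<^sup>2 \<ge> 0" by simp
    then have "(\<bar>?x\<bar> * \<bar>?y\<bar>)\<^sup>2 \<le> (1 / 2) * (?x ^ 4 + ?y ^ 4)"
      by (simp add: power2_diff power_mult_distrib flip: power_mult)
    then have "sqrt N * (\<bar>?x\<bar> * \<bar>?y\<bar>)\<^sup>2 \<le> sqrt N * ((1 / 2) * (?x ^ 4 + ?y ^ 4))"
      by (intro mult_left_mono) auto
    with sqrt_young[OF N, of "\<bar>?x\<bar> * \<bar>?y\<bar>" "\<bar>?z\<bar>"]
    show "2 * (\<bar>?x\<bar> * \<bar>?y\<bar> * \<bar>?z\<bar>) \<le> (sqrt N / 2) * (?x ^ 4 + ?y ^ 4) + (1 / sqrt N) * ?z\<^sup>2"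
      by simp
  qed
  also have "\<dots> = (sqrt N / 2) * (nu (\<lambda>\<sigma>. xm a b \<sigma> ^ 4) + nu (\<lambda>\<sigma>. xm c d \<sigma> ^ 4)) + (1 / sqrt N) * nu (\<lambda>\<sigma>. (xm e f \<sigma>)\<^sup>2)"
    unfolding nu_add nu_cmult ..
  also have "\<dots> \<le> (sqrt N / 2) * (C / (real N)\<^sup>2 + C / (real N)\<^sup>2) + (1 / sqrt N) * (C / N)"
    by (intro add_mono mult_left_mono C2 C4 ab) auto
  also have "\<dots> = 2 * (C / (N * sqrt N))"
  proof -
    have "sqrt N * sqrt N = N" by simp
    then show ?thesis using N by (simp add: field_simps power2_eq_square)
  qed
  finally show ?thesis unfolding nu_cmult by simp
qed

lemma nu_abs_le_sqrt:
  assumes C2: "nu (\<lambda>\<sigma>. (F \<sigma>)\<^sup>2) \<le> C / N" and C: "0 \<le> C"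
  shows "nu (\<lambda>\<sigma>. \<bar>F \<sigma>\<bar>) \<le> (C + 1) / sqrt N"
proof -
  have "nu (\<lambda>\<sigma>. 2 * \<bar>F \<sigma>\<bar>) \<le> nu (\<lambda>\<sigma>. sqrt N * (F \<sigma>)\<^sup>2 + 1 / sqrt N)"
    by (rule nu_mono) (use sqrt_young[OF N, of "\<bar>F _\<bar>" 1] in simp)
  also have "\<dots> = sqrt N * nu (\<lambda>\<sigma>. (F \<sigma>)\<^sup>2) + 1 / sqrt N"
    unfolding nu_add nu_cmult nu_const ..
  also have "\<dots> \<le> sqrt N * (C / N) + 1 / sqrt N"
    by (intro add_right_mono mult_left_mono C2) auto
  also have "\<dots> = (C + 1) / sqrt N"
  proof -
    have "sqrt N * sqrt N = N" by simp
    then show ?thesis using N by (simp add: field_simps)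
  qed
  also have "\<dots> \<le> 2 * ((C + 1) / sqrt N)"
  proof -
    have "0 \<le> (C + 1) / sqrt N" using C by simp
    then show ?thesis by linarith
  qed
  finally show ?thesis unfolding nu_cmult by linarith
qed

end

context cavity_fp
begin

lemma nui_zero_centered_mon:
  assumes F: "sindep F" and abcd: "a < 12" "b < 12" "c < 12" "d < 12"
  shows "nui 0 (\<lambda>\<sigma>. F \<sigma> * ((eps a \<sigma> * eps b \<sigma> - qab p q a b) * (eps c \<sigma> * eps d \<sigma>))) =
    nui 0 F * (W [a, b, c, d] - qab p q a b * qab p q c d)"
proof -
  have "nui 0 (\<lambda>\<sigma>. F \<sigma> * ((eps a \<sigma> * eps b \<sigma> - qab p q a b) * (eps c \<sigma> * eps d \<sigma>))) =
    nui 0 (\<lambda>\<sigma>. F \<sigma> * mon [a, b, c, d] \<sigma> - qab p q a b * (F \<sigma> * mon [c, d] \<sigma>))"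
    by (intro nui_cong) (simp add: mon_def algebra_simps)
  also have "\<dots> = nui 0 F * (W [a, b, c, d] - qab p q a b * qab p q c d)"
    unfolding nui_diff nui_cmult using abcd by (simp add: nui_zero_mon[OF F] W_pair algebra_simps)
  finally show ?thesis .
qed

lemma W_bound:
  assumes abcd: "a < 12" "b < 12" "c < 12" "d < 12"
  shows "\<bar>W [a, b, c, d] - qab p q a b * qab p q c d\<bar> \<le> 2 * (real S) ^ 4"
proof -
  have "\<bar>nui 0 (\<lambda>\<sigma>. 1 * ((eps a \<sigma> * eps b \<sigma> - qab p q a b) * (eps c \<sigma> * eps d \<sigma>)))\<bar> \<le> nui 0 (\<lambda>\<sigma>. 2 * (real S) ^ 4)"
  proof (rule order_trans[OF nui_abs], rule nui_mono)
    fix \<sigma> assume \<sigma>: "\<sigma> \<in> PiE {..<12::nat} (\<lambda>_. configs S N)"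
    have "\<bar>eps a \<sigma> * eps b \<sigma> - qab p q a b\<bar> * \<bar>eps c \<sigma> * eps d \<sigma>\<bar> \<le> (2 * (real S)\<^sup>2) * (real S)\<^sup>2"
      by (intro mult_mono eps_qab_bound[OF \<sigma>] eps_bound[OF \<sigma>] abcd) auto
    then show "\<bar>1 * ((eps a \<sigma> * eps b \<sigma> - qab p q a b) * (eps c \<sigma> * eps d \<sigma>))\<bar> \<le> 2 * (real S) ^ 4"
      by (simp add: abs_mult power2_eq_square power4_eq_xxxx mult_ac)
  qed
  then show ?thesis using nui_zero_centered_mon[OF sindep_const[of 1] abcd] by (simp add: nui_const)
qed

text \<open>Site \<open>k\<close> meets the overlap twice: through its own summand, which is
  explicit and of order \<open>1 / N\<close>, and through the coupling to the other sites, which is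
  the first-order term of the path. At the decoupled end the latter factorises into a one-site
  covariance and a two-point function. Indices below 4 fix \<open>n = 4\<close>, so the derivative
  adds replicas 4 and 5.\<close>

theorem cavity_expansion:
  assumes C: "0 \<le> C"
    and C2: "\<And>a b. a < 12 \<Longrightarrow> b < 12 \<Longrightarrow> nu (\<lambda>\<sigma>. (xm a b \<sigma>)\<^sup>2) \<le> C / N"
    and C4: "\<And>a b. a < 12 \<Longrightarrow> b < 12 \<Longrightarrow> nu (\<lambda>\<sigma>. (xm a b \<sigma>) ^ 4) \<le> C / (real N)\<^sup>2"
    and C2': "\<And>a b. a < 12 \<Longrightarrow> b < 12 \<Longrightarrow> nu (\<lambda>\<sigma>. (ovl N p q a b \<sigma>)\<^sup>2) \<le> C / N"
    and ef: "a < 4" "b < 4" "c < 4" "d < 4"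
  shows "\<bar>nu (\<lambda>\<sigma>. (eps a \<sigma> * eps b \<sigma> - qab p q a b) * ovl N p q c d \<sigma>)
      - (W [a, b, c, d] - qab p q a b * qab p q c d) / N
      - \<beta>\<^sup>2 / 2 * (\<Sum>i\<le>4. \<Sum>j\<le>Suc 4. rc 4 i * rc (Suc 4) j *
          ((W [a, b, i, j] - qab p q a b * qab p q i j) * nu (\<lambda>\<sigma>. ovl N p q i j \<sigma> * ovl N p q c d \<sigma>)))\<bar>
    \<le> KK S C / (N * sqrt N)"
proof -
  let ?s2 = "(real S)\<^sup>2" and ?n = "1 / (N * sqrt N)"
  let ?e = "\<lambda>\<sigma>. eps a \<sigma> * eps b \<sigma> - qab p q a b"
  let ?w = "\<lambda>i j. W [a, b, i, j] - qab p q a b * qab p q i j"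
  let ?F = "\<lambda>\<sigma>. ?e \<sigma> * xm c d \<sigma>"
  have ef': "a < 12" "b < 12" "c < 12" "d < 12" using ef by auto
  have \<beta>2: "\<beta>\<^sup>2 \<le> 1" and \<beta>4: "\<beta> ^ 4 \<le> 1" using \<beta> by (auto simp: power_le_one)
  have nn: "0 \<le> ?n" by simp
  have dF: "depn 4 ?F" using ef by (intro depn_mult depn_diff depn_const depn_eps depn_xm) auto
  \<comment> \<open>The summand of site \<open>k\<close> is separated so that the rest is
    independent of that site.\<close>
  have lin: "nu (\<lambda>\<sigma>. ?e \<sigma> * ovl N p q c d \<sigma>) = nu ?F + (1 / N) * nu (\<lambda>\<sigma>. ?e \<sigma> * (eps c \<sigma> * eps d \<sigma>))"
    unfolding nu_cmult[symmetric] nu_add[symmetric] by (intro nu_cong) (simp add: ovl_xm algebra_simps)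
  have zero: "nui 0 ?F = 0" by (intro nui_zero_centered sindep_xm ef')
  have E1: "\<bar>nu ?F - gen 4 0 ?F\<bar> \<le> 8 * rcc 4 * Kc S 6 * (real S) ^ 4 * C * ?n"
  proof -
    have "\<bar>nu ?F - nui 0 ?F - gen 4 0 ?F\<bar> \<le> 4 * \<beta>^4 * rcc 4 * Kc S (4 + 2) * (2 * ?s2 * ?s2 * (C / (N * sqrt N)))"
    proof (rule second_order[OF _ dF])
      fix i j l m :: nat assume i: "i \<le> 4" "j \<le> Suc 4" "l \<le> 4 + 2" "m \<le> 4 + 3"
      then have i': "i < 12" "j < 12" "l < 12" "m < 12" by auto
      have "nu (\<lambda>\<sigma>. \<bar>?F \<sigma> * (eps i \<sigma> * eps j \<sigma>) * xm i j \<sigma>\<bar> * \<bar>xm l m \<sigma>\<bar>) \<le>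
        nu (\<lambda>\<sigma>. 2 * ?s2 * ?s2 * (\<bar>xm c d \<sigma>\<bar> * \<bar>xm i j \<sigma>\<bar> * \<bar>xm l m \<sigma>\<bar>))"
      proof (rule nu_mono)
        fix \<sigma> assume \<sigma>: "\<sigma> \<in> PiE {..<12::nat} (\<lambda>_. configs S N)"
        have "\<bar>?e \<sigma>\<bar> * \<bar>eps i \<sigma> * eps j \<sigma>\<bar> * (\<bar>xm c d \<sigma>\<bar> * \<bar>xm i j \<sigma>\<bar> * \<bar>xm l m \<sigma>\<bar>) \<le>
          2 * ?s2 * ?s2 * (\<bar>xm c d \<sigma>\<bar> * \<bar>xm i j \<sigma>\<bar> * \<bar>xm l m \<sigma>\<bar>)"
          by (intro mult_mono eps_qab_bound[OF \<sigma>] eps_bound[OF \<sigma>] ef' i') auto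
        then show "\<bar>?F \<sigma> * (eps i \<sigma> * eps j \<sigma>) * xm i j \<sigma>\<bar> * \<bar>xm l m \<sigma>\<bar> \<le>
          2 * ?s2 * ?s2 * (\<bar>xm c d \<sigma>\<bar> * \<bar>xm i j \<sigma>\<bar> * \<bar>xm l m \<sigma>\<bar>)"
          by (simp add: abs_mult mult_ac)
      qed
      also have "\<dots> \<le> 2 * ?s2 * ?s2 * (C / (N * sqrt N))"
        unfolding nu_cmult by (intro mult_left_mono nu_triple C2 C4 ef' i') auto
      finally show "nu (\<lambda>\<sigma>. \<bar>?F \<sigma> * (eps i \<sigma> * eps j \<sigma>) * xm i j \<sigma>\<bar> * \<bar>xm l m \<sigma>\<bar>) \<le> 2 * ?s2 * ?s2 * (C / (N * sqrt N))" .
    qed simp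
    also have "\<dots> = \<beta>^4 * (8 * rcc 4 * Kc S 6 * (real S) ^ 4 * C * ?n)"
      by (simp add: power2_eq_square power4_eq_xxxx)
    also have "\<dots> \<le> 1 * (8 * rcc 4 * Kc S 6 * (real S) ^ 4 * C * ?n)"
      by (intro mult_right_mono \<beta>4 mult_nonneg_nonneg rcc_nonneg Kc_nonneg C nn) auto
    finally show ?thesis by (simp add: zero)
  qed
  \<comment> \<open>The endpoint average of a product of two overlaps is moved to the full system by
    a first-order estimate with third moments; putting site \<open>k\<close> back costs
    \<open>1 / N\<close> times a first absolute moment. Both are of order N^(-3/2).\<close>
  have E2: "\<bar>nui 0 (\<lambda>\<sigma>. xm c d \<sigma> * xm i j \<sigma>) - nu (\<lambda>\<sigma>. ovl N p q i j \<sigma> * ovl N p q c d \<sigma>)\<bar>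
      \<le> (2 * Kc S 6 * C + 2 * ?s2 * (C + 1)) * ?n" if ij: "i \<le> 4" "j \<le> Suc 4" for i j
  proof -
    let ?G = "\<lambda>\<sigma>. xm c d \<sigma> * xm i j \<sigma>" and ?o = "ovl N p q"
    have ij': "i < 12" "j < 12" using ij by auto
    have "\<bar>nui (pi / 2) ?G - nui 0 ?G\<bar> \<le> 2 * \<beta>\<^sup>2 * Kc S 6 * (C / (N * sqrt N))"
    proof (rule first_order)
      show "depn 6 ?G" using ef ij by (intro depn_mult depn_xm) auto
      fix l m :: nat assume "l \<le> 6" "m \<le> Suc 6"
      then have "l < 12" "m < 12" by auto
      with nu_triple[OF C2 C4, of c d i j l m] show "nu (\<lambda>\<sigma>. \<bar>?G \<sigma>\<bar> * \<bar>xm l m \<sigma>\<bar>) \<le> C / (N * sqrt N)"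
        using ef' ij' by (simp add: abs_mult)
    qed auto
    also have "\<dots> = \<beta>\<^sup>2 * (2 * Kc S 6 * C * ?n)" by simp
    also have "\<dots> \<le> 1 * (2 * Kc S 6 * C * ?n)"
      by (intro mult_right_mono \<beta>2 mult_nonneg_nonneg Kc_nonneg C nn) auto
    finally have 1: "\<bar>nu ?G - nui 0 ?G\<bar> \<le> 2 * Kc S 6 * C * ?n" by (simp add: nui_half_pi)
    have "\<bar>nu (\<lambda>\<sigma>. ?G \<sigma> - ?o i j \<sigma> * ?o c d \<sigma>)\<bar> \<le> nu (\<lambda>\<sigma>. ?s2 / N * (\<bar>xm i j \<sigma>\<bar> + \<bar>?o c d \<sigma>\<bar>))"
    proof (rule order_trans[OF nu_abs], rule nu_mono)
      fix \<sigma> assume \<sigma>: "\<sigma> \<in> PiE {..<12::nat} (\<lambda>_. configs S N)"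
      have "?G \<sigma> - ?o i j \<sigma> * ?o c d \<sigma> = - (?o c d \<sigma> - xm c d \<sigma>) * xm i j \<sigma> - (?o i j \<sigma> - xm i j \<sigma>) * ?o c d \<sigma>"
        by (simp add: algebra_simps)
      also have "\<bar>\<dots>\<bar> \<le> \<bar>?o c d \<sigma> - xm c d \<sigma>\<bar> * \<bar>xm i j \<sigma>\<bar> + \<bar>?o i j \<sigma> - xm i j \<sigma>\<bar> * \<bar>?o c d \<sigma>\<bar>"
        by (rule order_trans[OF abs_triangle_ineq4]) (simp add: abs_mult abs_minus_commute)
      also have "\<dots> \<le> ?s2 / N * \<bar>xm i j \<sigma>\<bar> + ?s2 / N * \<bar>?o c d \<sigma>\<bar>"
        by (intro add_mono mult_right_mono ovl_xm_diff[OF \<sigma>] ij' ef') auto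
      finally show "\<bar>?G \<sigma> - ?o i j \<sigma> * ?o c d \<sigma>\<bar> \<le> ?s2 / N * (\<bar>xm i j \<sigma>\<bar> + \<bar>?o c d \<sigma>\<bar>)"
        by (simp add: distrib_left)
    qed
    also have "\<dots> \<le> ?s2 / N * ((C + 1) / sqrt N + (C + 1) / sqrt N)"
      unfolding nu_cmult nu_add
      by (intro mult_left_mono add_mono nu_abs_le_sqrt C C2 C2' ij' ef') auto
    also have "\<dots> = 2 * ?s2 * (C + 1) * ?n" by simp
    finally show ?thesis using 1 unfolding nu_diff distrib_right by linarith
  qed
  have gen: "gen 4 0 ?F = \<beta>\<^sup>2 / 2 * (\<Sum>i\<le>4. \<Sum>j\<le>Suc 4. rc 4 i * rc (Suc 4) j * (?w i j * nui 0 (\<lambda>\<sigma>. xm c d \<sigma> * xm i j \<sigma>)))"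
    unfolding gen_def
  proof (intro arg_cong2[where f = "(*)"] sum.cong refl)
    fix i j :: nat assume ij: "i \<in> {..4}" "j \<in> {..Suc 4}"
    have "nui 0 (\<lambda>\<sigma>. ?F \<sigma> * (eps i \<sigma> * eps j \<sigma>) * xm i j \<sigma>) =
      nui 0 (\<lambda>\<sigma>. (xm c d \<sigma> * xm i j \<sigma>) * (?e \<sigma> * (eps i \<sigma> * eps j \<sigma>)))"
      by (simp add: mult_ac)
    also have "\<dots> = ?w i j * nui 0 (\<lambda>\<sigma>. xm c d \<sigma> * xm i j \<sigma>)"
      using ij ef by (subst nui_zero_centered_mon) (auto intro!: sindep_mult sindep_xm)
    finally show "nui 0 (\<lambda>\<sigma>. ?F \<sigma> * (eps i \<sigma> * eps j \<sigma>) * xm i j \<sigma>) = ?w i j * nui 0 (\<lambda>\<sigma>. xm c d \<sigma> * xm i j \<sigma>)" .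
  qed
  define Y where "Y = (\<Sum>i\<le>4. \<Sum>j\<le>Suc 4. rc 4 i * rc (Suc 4) j * (?w i j *
      (nui 0 (\<lambda>\<sigma>. xm c d \<sigma> * xm i j \<sigma>) - nu (\<lambda>\<sigma>. ovl N p q i j \<sigma> * ovl N p q c d \<sigma>))))"
  define Z where "Z = (\<Sum>i\<le>4. \<Sum>j\<le>Suc 4. rc 4 i * rc (Suc 4) j * (?w i j * nu (\<lambda>\<sigma>. ovl N p q i j \<sigma> * ovl N p q c d \<sigma>)))"
  have YZ: "gen 4 0 ?F - \<beta>\<^sup>2 / 2 * Z = \<beta>\<^sup>2 / 2 * Y"
    unfolding gen Y_def Z_def right_diff_distrib sum_subtractf ..
  have "\<bar>Y\<bar> \<le> (\<Sum>i\<le>4. \<Sum>j\<le>Suc 4. \<bar>rc 4 i\<bar> * \<bar>rc (Suc 4) j\<bar> * (2 * (real S) ^ 4 * ((2 * Kc S 6 * C + 2 * ?s2 * (C + 1)) * ?n)))"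
    unfolding Y_def
    by (rule order_trans[OF sum_abs], rule sum_mono, rule order_trans[OF sum_abs], rule sum_mono,
      unfold abs_mult, intro mult_mono W_bound E2) (use ef in auto)
  also have "\<dots> = 2 * (rcc 4 * (real S) ^ 4 * (2 * Kc S 6 * C + 2 * ?s2 * (C + 1)) * ?n)"
    unfolding rcc_def sum_distrib_right[symmetric] by simp
  finally have "\<beta>\<^sup>2 / 2 * \<bar>Y\<bar> \<le> 1 / 2 * (2 * (rcc 4 * (real S) ^ 4 * (2 * Kc S 6 * C + 2 * ?s2 * (C + 1)) * ?n))"
    using \<beta>2 by (intro mult_mono) auto
  then have E3: "\<bar>gen 4 0 ?F - \<beta>\<^sup>2 / 2 * Z\<bar> \<le> rcc 4 * (real S) ^ 4 * (2 * Kc S 6 * C + 2 * ?s2 * (C + 1)) * ?n"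
    unfolding YZ by (simp add: abs_mult)
  \<comment> \<open>This term carries a prefactor \<open>1 / N\<close>, so an error of order
    N^(-1/2) suffices.\<close>
  let ?H = "\<lambda>\<sigma>. ?e \<sigma> * (eps c \<sigma> * eps d \<sigma>)"
  have "\<bar>nui (pi / 2) ?H - nui 0 ?H\<bar> \<le> 2 * \<beta>\<^sup>2 * Kc S 4 * (2 * ?s2 * ?s2 * ((C + 1) / sqrt N))"
  proof (rule first_order)
    show "depn 4 ?H" using ef by (intro depn_mult depn_diff depn_const depn_eps) auto
    fix i j :: nat assume "i \<le> 4" "j \<le> Suc 4"
    then have ij: "i < 12" "j < 12" by auto
    have "nu (\<lambda>\<sigma>. \<bar>?H \<sigma>\<bar> * \<bar>xm i j \<sigma>\<bar>) \<le> nu (\<lambda>\<sigma>. 2 * ?s2 * ?s2 * \<bar>xm i j \<sigma>\<bar>)"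
      unfolding abs_mult
    proof (rule nu_mono)
      fix \<sigma> assume \<sigma>: "\<sigma> \<in> PiE {..<12::nat} (\<lambda>_. configs S N)"
      show "\<bar>?e \<sigma>\<bar> * (\<bar>eps c \<sigma>\<bar> * \<bar>eps d \<sigma>\<bar>) * \<bar>xm i j \<sigma>\<bar> \<le> 2 * ?s2 * ?s2 * \<bar>xm i j \<sigma>\<bar>"
        by (intro mult_mono eps_qab_bound[OF \<sigma>] eps_bound[OF \<sigma>, unfolded abs_mult] ef') auto
    qed
    also have "\<dots> \<le> 2 * ?s2 * ?s2 * ((C + 1) / sqrt N)"
      unfolding nu_cmult by (intro mult_left_mono nu_abs_le_sqrt C C2 ij) auto
    finally show "nu (\<lambda>\<sigma>. \<bar>?H \<sigma>\<bar> * \<bar>xm i j \<sigma>\<bar>) \<le> 2 * ?s2 * ?s2 * ((C + 1) / sqrt N)" .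
  qed auto
  also have "\<dots> = \<beta>\<^sup>2 * (4 * Kc S 4 * (real S) ^ 4 * (C + 1) / sqrt N)"
    by (simp add: power2_eq_square power4_eq_xxxx)
  also have "\<dots> \<le> 1 * (4 * Kc S 4 * (real S) ^ 4 * (C + 1) / sqrt N)"
    by (intro mult_right_mono \<beta>2 divide_nonneg_nonneg mult_nonneg_nonneg Kc_nonneg) (use C in auto)
  finally have "\<bar>nu ?H - ?w c d\<bar> \<le> 4 * Kc S 4 * (real S) ^ 4 * (C + 1) / sqrt N"
    using nui_zero_centered_mon[OF sindep_const[of 1] ef'] by (simp add: nui_half_pi nui_const)
  then have "(1 / N) * \<bar>nu ?H - ?w c d\<bar> \<le> (1 / N) * (4 * Kc S 4 * (real S) ^ 4 * (C + 1) / sqrt N)"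
    by (intro mult_left_mono) auto
  then have E4: "\<bar>(1 / N) * nu ?H - ?w c d / N\<bar> \<le> 4 * Kc S 4 * (real S) ^ 4 * (C + 1) * ?n"
    using N by (simp add: abs_mult diff_divide_distrib[symmetric])
  have "KK S C / (N * sqrt N) = 8 * rcc 4 * Kc S 6 * (real S) ^ 4 * C * ?n
     + rcc 4 * (real S) ^ 4 * (2 * Kc S 6 * C + 2 * (real S)\<^sup>2 * (C + 1)) * ?n
     + 4 * Kc S 4 * (real S) ^ 4 * (C + 1) * ?n"
    unfolding KK_def by (simp add: add_divide_distrib)
  then show ?thesis using E1 E3 E4 unfolding lin Z_def[symmetric] by linarith
qed

end

section \<open>The fixed point\<close>

lemma mom_abs_le: "\<bar>mom S \<beta> h D p q j \<eta>\<bar> \<le> real S ^ j"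
proof -
  have b: "\<bar>real_of_int s ^ j\<bar> \<le> real S ^ j" if "s \<in> spins S" for s
    using spins_bound[OF that] by (simp add: power_abs power_mono)
  then have "mom S \<beta> h D p q j \<eta> \<le> site_avg S \<beta> h D p q \<eta> (\<lambda>_. real S ^ j)"
    unfolding mom_def by (intro site_avg_mono) (auto simp: abs_le_iff)
  moreover have "site_avg S \<beta> h D p q \<eta> (\<lambda>_. - (real S ^ j)) \<le> mom S \<beta> h D p q j \<eta>"
    unfolding mom_def using b by (intro site_avg_mono) (force simp: abs_le_iff)
  ultimately show ?thesis by (simp add: site_avg_const abs_le_iff)
qed

lemma mom_two_nonneg: "0 \<le> mom S \<beta> h D p q 2 \<eta>"
  using site_avg_mono[of S "\<lambda>_. 0" "\<lambda>s. real_of_int s ^ 2"] by (simp add: mom_def site_avg_const)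

lemma measurable_mom [measurable]: "mom S \<beta> h D p q j \<in> borel_measurable borel"
  unfolding mom_def site_avg_def wsite_def by measurable

lemma integrable_stdN_bounded:
  fixes f :: "real \<Rightarrow> real"
  assumes "f \<in> borel_measurable borel" "\<And>x. \<bar>f x\<bar> \<le> B"
  shows "integrable stdN f"
proof -
  interpret prob_space stdN by (rule prob_space_stdN)
  show ?thesis by (rule integrable_const_bound[where B = B]) (use assms in auto)
qed

lemma Eeta_bounds:
  assumes f: "f \<in> borel_measurable borel" and b: "\<And>x. 0 \<le> f x" "\<And>x. f x \<le> B"
  shows "0 \<le> Eeta f" "Eeta f \<le> B"
proof -
  interpret prob_space stdN by (rule prob_space_stdN)
  have i: "integrable stdN f" by (rule integrable_stdN_bounded[OF f, of B]) (use b in \<open>simp add: abs_le_iff order_trans[OF _ b(1)]\<close>)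
  show "0 \<le> Eeta f" unfolding Eeta_def using b by simp
  show "Eeta f \<le> B" unfolding Eeta_def by (rule integral_le_const[OF i]) (simp add: b)
qed

lemma fixed_point_maps_bounds:
  "0 \<le> Eeta (\<lambda>\<eta>. (mom S \<beta> h D p q 1 \<eta>)\<^sup>2)" "Eeta (\<lambda>\<eta>. (mom S \<beta> h D p q 1 \<eta>)\<^sup>2) \<le> (real S)\<^sup>2"
  "0 \<le> Eeta (mom S \<beta> h D p q 2)" "Eeta (mom S \<beta> h D p q 2) \<le> (real S)\<^sup>2"
proof -
  have "(mom S \<beta> h D p q 1 \<eta>)\<^sup>2 \<le> (real S)\<^sup>2" for \<eta>
    using mom_abs_le[of S \<beta> h D p q 1 \<eta>] by (intro abs_le_square_iff[THEN iffD1]) simp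
  then show "0 \<le> Eeta (\<lambda>\<eta>. (mom S \<beta> h D p q 1 \<eta>)\<^sup>2)" "Eeta (\<lambda>\<eta>. (mom S \<beta> h D p q 1 \<eta>)\<^sup>2) \<le> (real S)\<^sup>2"
    by (auto intro!: Eeta_bounds)
  show "0 \<le> Eeta (mom S \<beta> h D p q 2)" "Eeta (mom S \<beta> h D p q 2) \<le> (real S)\<^sup>2"
    by (rule Eeta_bounds[OF measurable_mom mom_two_nonneg], rule abs_le_D1[OF mom_abs_le])+
qed

lemma fixed_point_bounds:
  assumes "fixed_point S \<beta> h D p q"
  shows "0 \<le> q" "q \<le> (real S)\<^sup>2" "0 \<le> p" "p \<le> (real S)\<^sup>2"
  using assms fixed_point_maps_bounds[of S \<beta> h D p q] by (simp_all add: fixed_point_def)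

text \<open>\<open>144 = 9 * 16\<close> and \<open>18 = 2 * 9\<close>: the numbers 9 and 16 come
  from \<open>rsum_abs_le\<close> for 2 and 3 replicas, and the leading square bounds the test
  function.\<close>

definition Kf :: "nat \<Rightarrow> real" where
  "Kf S = (real S)\<^sup>2 * (144 * (\<Sum>s\<in>spins S. \<bar>real_of_int s\<bar>)\<^sup>2 + 18 * (\<Sum>s\<in>spins S. \<bar>real_of_int s ^ 2\<bar>))"

lemma Kf_nonneg: "0 \<le> Kf S"
  unfolding Kf_def by (intro mult_nonneg_nonneg add_nonneg_nonneg sum_nonneg) auto

text \<open>A single spin is treated as a whole configuration, so the general interpolation applies.
  Two independent Gaussians carry the variances \<open>q\<close> and \<open>q'\<close>; the path
  leads from \<open>(p', q')\<close> at angle 0 to \<open>(p, q)\<close> at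
  \<open>pi / 2\<close>.\<close>

locale two_points =
  fixes S :: nat and \<beta> h D p q p' q' :: real
  assumes q: "0 \<le> q" and q': "0 \<le> q'"
begin

definition amp :: "real \<Rightarrow> nat \<Rightarrow> real" where
  "amp \<theta> j = (if j = 0 then sin \<theta> else cos \<theta>)"

definition amp' :: "real \<Rightarrow> nat \<Rightarrow> real" where
  "amp' \<theta> j = (if j = 0 then cos \<theta> else - sin \<theta>)"

definition cpl :: "nat \<Rightarrow> int \<Rightarrow> real" where
  "cpl j s = \<beta> * sqrt (if j = 0 then q else q') * s"

definition fld :: "real \<Rightarrow> int \<Rightarrow> real" where
  "fld \<theta> s = h * s + (D + \<beta>\<^sup>2 / 2 * ((sin \<theta>)\<^sup>2 * (p - q) + (cos \<theta>)\<^sup>2 * (p' - q'))) * real_of_int s ^ 2"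

definition fld' :: "real \<Rightarrow> int \<Rightarrow> real" where
  "fld' \<theta> s = sin \<theta> * cos \<theta> * (\<beta>\<^sup>2 * ((p - q) - (p' - q'))) * real_of_int s ^ 2"

sublocale gaussian_family 12 "spins S" "{0, 1::nat}" amp amp' cpl fld fld'
  "\<Sum>s\<in>spins S. \<bar>\<beta>\<^sup>2 * ((p - q) - (p' - q')) * real_of_int s ^ 2\<bar>"
proof
  fix t :: real and j
  show "((\<lambda>t. amp t j) has_real_derivative amp' t j) (at t)"
    unfolding amp_def amp'_def by (auto intro!: derivative_eq_intros)
  show "\<bar>amp' t j\<bar> \<le> 1" unfolding amp'_def by simp
next
  fix t :: real and s assume s: "s \<in> spins S"
  show "((\<lambda>t. fld t s) has_real_derivative fld' t s) (at t)"
    unfolding fld_def fld'_def by (auto intro!: derivative_eq_intros simp: algebra_simps)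
  have "\<bar>sin t * cos t\<bar> \<le> 1 * 1" unfolding abs_mult by (intro mult_mono) auto
  then have "\<bar>sin t * cos t\<bar> * \<bar>\<beta>\<^sup>2 * ((p - q) - (p' - q')) * real_of_int s ^ 2\<bar> \<le>
     1 * \<bar>\<beta>\<^sup>2 * ((p - q) - (p' - q')) * real_of_int s ^ 2\<bar>"
    by (intro mult_right_mono) auto
  then have "\<bar>fld' t s\<bar> \<le> \<bar>\<beta>\<^sup>2 * ((p - q) - (p' - q')) * real_of_int s ^ 2\<bar>"
    unfolding fld'_def abs_mult by (simp add: mult_ac)
  also have "\<dots> \<le> (\<Sum>s\<in>spins S. \<bar>\<beta>\<^sup>2 * ((p - q) - (p' - q')) * real_of_int s ^ 2\<bar>)"
    using finite_spins s by (intro member_le_sum[where f = "\<lambda>s. \<bar>\<beta>\<^sup>2 * ((p - q) - (p' - q')) * real_of_int s ^ 2\<bar>"]) auto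
  finally show "\<bar>fld' t s\<bar> \<le> (\<Sum>s\<in>spins S. \<bar>\<beta>\<^sup>2 * ((p - q) - (p' - q')) * real_of_int s ^ 2\<bar>)" .
qed (use finite_spins zero_in_spins in auto)

lemma gav_product:
  "gav 12 (spins S) H (\<lambda>\<sigma>. \<phi> (\<sigma> 0) * \<psi> (\<sigma> 1)) =
    (\<Sum>x\<in>spins S. prb (spins S) H x * \<phi> x) * (\<Sum>x\<in>spins S. prb (spins S) H x * \<psi> x)"
proof -
  have w: "(\<Sum>x\<in>spins S. prb (spins S) H x) = 1" by (rule sum_prb[OF X])
  have "gav 12 (spins S) H (\<lambda>\<sigma>. \<phi> (\<sigma> 0) * \<psi> (\<sigma> 1)) =
    gav 12 (spins S) H (\<lambda>\<sigma>. 1 * \<phi> (\<sigma> 0)) * (\<Sum>x\<in>spins S. prb (spins S) H x * \<psi> x)"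
    unfolding gav_def by (subst rep_indep[where b = 1]) (auto simp: w)
  also have "gav 12 (spins S) H (\<lambda>\<sigma>. 1 * \<phi> (\<sigma> 0)) = 1 * (\<Sum>x\<in>spins S. prb (spins S) H x * \<phi> x)"
    unfolding gav_def by (subst rep_indep[where b = 0]) (auto simp: w rep_one)
  finally show ?thesis by simp
qed

lemma ham_eq: "ham t g s = amp t 0 * g 0 * cpl 0 s + amp t 1 * g 1 * cpl 1 s + fld t s"
  unfolding ham_def by simp

lemma prb_ham:
  "(\<Sum>x\<in>spins S. prb (spins S) (ham (pi / 2) g) x * \<phi> x) = site_avg S \<beta> h D p q (g 0) \<phi>"
  "(\<Sum>x\<in>spins S. prb (spins S) (ham 0 g) x * \<phi> x) = site_avg S \<beta> h D p' q' (g 1) \<phi>"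
proof -
  have 1: "exp (ham (pi / 2) g s) = wsite \<beta> h D p q (g 0) s" for s
    unfolding ham_eq by (simp add: wsite_def amp_def cpl_def fld_def algebra_simps)
  have 2: "exp (ham 0 g s) = wsite \<beta> h D p' q' (g 1) s" for s
    unfolding ham_eq by (simp add: wsite_def amp_def cpl_def fld_def algebra_simps)
  show "(\<Sum>x\<in>spins S. prb (spins S) (ham (pi / 2) g) x * \<phi> x) = site_avg S \<beta> h D p q (g 0) \<phi>"
    "(\<Sum>x\<in>spins S. prb (spins S) (ham 0 g) x * \<phi> x) = site_avg S \<beta> h D p' q' (g 1) \<phi>"
    unfolding prb_def 1 2 site_avg_def by (simp_all add: mult.commute flip: sum_divide_distrib)
qed

lemma nui_product:
  "nui (pi / 2) (\<lambda>\<sigma>. real_of_int (\<sigma> 0) ^ i * real_of_int (\<sigma> 1) ^ j) = Eeta (\<lambda>\<eta>. mom S \<beta> h D p q i \<eta> * mom S \<beta> h D p q j \<eta>)"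
  "nui 0 (\<lambda>\<sigma>. real_of_int (\<sigma> 0) ^ i * real_of_int (\<sigma> 1) ^ j) = Eeta (\<lambda>\<eta>. mom S \<beta> h D p' q' i \<eta> * mom S \<beta> h D p' q' j \<eta>)"
proof -
  show "nui (pi / 2) (\<lambda>\<sigma>. real_of_int (\<sigma> 0) ^ i * real_of_int (\<sigma> 1) ^ j) = Eeta (\<lambda>\<eta>. mom S \<beta> h D p q i \<eta> * mom S \<beta> h D p q j \<eta>)"
    unfolding nui_def gav_product[of _ "\<lambda>s. real_of_int s ^ i" "\<lambda>s. real_of_int s ^ j"] prb_ham Eeta_def mom_def[symmetric]
    by (rule integral_gaussians_component) (auto intro!: borel_measurable_times measurable_mom)
  show "nui 0 (\<lambda>\<sigma>. real_of_int (\<sigma> 0) ^ i * real_of_int (\<sigma> 1) ^ j) = Eeta (\<lambda>\<eta>. mom S \<beta> h D p' q' i \<eta> * mom S \<beta> h D p' q' j \<eta>)"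
    unfolding nui_def gav_product[of _ "\<lambda>s. real_of_int s ^ i" "\<lambda>s. real_of_int s ^ j"] prb_ham Eeta_def mom_def[symmetric]
    by (rule integral_gaussians_component) (auto intro!: borel_measurable_times measurable_mom)
qed

text \<open>The derivative along the path is proportional to \<beta>^2 and to the parameter
  differences. The exponents \<open>(1, 1)\<close> belong to the equation for \<open>q\<close>; with
  \<open>(2, 0)\<close> the second factor is 1 and the equation for \<open>p\<close>
  results.\<close>

lemma Eeta_lipschitz:
  assumes ij: "(i, j) = (1, 1) \<or> (i, j) = (2, 0)"
  shows "\<bar>Eeta (\<lambda>\<eta>. mom S \<beta> h D p q i \<eta> * mom S \<beta> h D p q j \<eta>) - Eeta (\<lambda>\<eta>. mom S \<beta> h D p' q' i \<eta> * mom S \<beta> h D p' q' j \<eta>)\<bar>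
    \<le> 2 * \<beta>\<^sup>2 * Kf S * (\<bar>p - p'\<bar> + \<bar>q - q'\<bar>)"
proof -
  let ?F = "\<lambda>\<sigma>. real_of_int (\<sigma> (0::nat)) ^ i * real_of_int (\<sigma> 1) ^ j"
  let ?d = "\<bar>p - p'\<bar> + \<bar>q - q'\<bar>"
  let ?s1 = "\<Sum>s\<in>spins S. \<bar>real_of_int s\<bar>" and ?s2 = "\<Sum>s\<in>spins S. \<bar>real_of_int s ^ 2\<bar>"
  define G where "G t \<sigma> = (\<Sum>j\<in>{0, 1}. amp t j * amp' t j * (rsum 2 (cpl j) \<sigma> * rsum (Suc 2) (cpl j) \<sigma>)) + rsum 2 (fld' t) \<sigma>" for t \<sigma>
  have F: "depn 2 ?F" by (simp add: depn_def)
  have der: "((\<lambda>t. nui t ?F) has_real_derivative nui t (\<lambda>\<sigma>. ?F \<sigma> * G t \<sigma>)) (at t)" for t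
    unfolding G_def by (rule nui_DERIV[OF _ F]) simp
  have nn: "0 \<le> ?s1" "0 \<le> ?s2" by (intro sum_nonneg; simp)+
  have bound: "\<bar>nui t (\<lambda>\<sigma>. ?F \<sigma> * G t \<sigma>)\<bar> \<le> \<beta>\<^sup>2 * Kf S * ?d" for t
  proof -
    have "\<bar>nui t (\<lambda>\<sigma>. ?F \<sigma> * G t \<sigma>)\<bar> \<le> nui t (\<lambda>\<sigma>. \<beta>\<^sup>2 * Kf S * ?d)"
    proof (rule order_trans[OF nui_abs], rule nui_mono)
      fix \<sigma> assume \<sigma>: "\<sigma> \<in> PiE {..<12::nat} (\<lambda>_. spins S)"
      have sp: "\<bar>real_of_int (\<sigma> r)\<bar> \<le> real S" if "r < 12" for r
        by (rule spins_bound, rule PiE_mem[OF \<sigma>]) (use that in simp)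
      have Fb: "\<bar>?F \<sigma>\<bar> \<le> (real S)\<^sup>2"
      proof -
        have "\<bar>?F \<sigma>\<bar> \<le> real S ^ i * real S ^ j"
          unfolding abs_mult power_abs by (intro mult_mono power_mono sp) auto
        then show ?thesis using ij by (auto simp: power2_eq_square)
      qed
      have r1: "rsum n (cpl l) \<sigma> = \<beta> * sqrt (if l = 0 then q else q') * rsum n real_of_int \<sigma>" for n l
        unfolding cpl_def by (rule rsum_cmult)
      have r2: "rsum n (fld' t) \<sigma> = sin t * cos t * (\<beta>\<^sup>2 * ((p - q) - (p' - q'))) * rsum n (\<lambda>s. real_of_int s ^ 2) \<sigma>" for n
        unfolding fld'_def by (rule rsum_cmult)
      define P where "P = rsum 2 real_of_int \<sigma> * rsum (Suc 2) real_of_int \<sigma>"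
      define Q where "Q = rsum 2 (\<lambda>s. real_of_int s ^ 2) \<sigma>"
      have sq: "(\<beta> * sqrt x * a) * (\<beta> * sqrt x * b) = \<beta>\<^sup>2 * x * (a * b)" if "0 \<le> x" for x a b
      proof -
        have s: "x = (sqrt x)\<^sup>2" using that by simp
        show ?thesis by (subst (3) s) (simp only: power2_eq_square mult_ac)
      qed
      have c0: "rsum 2 (cpl 0) \<sigma> * rsum (Suc 2) (cpl 0) \<sigma> = \<beta>\<^sup>2 * q * P"
        unfolding r1 P_def using sq[OF q] by (simp only: if_True refl)
      have c1: "rsum 2 (cpl 1) \<sigma> * rsum (Suc 2) (cpl 1) \<sigma> = \<beta>\<^sup>2 * q' * P"
        unfolding r1 P_def using sq[OF q'] by (simp only: if_False one_neq_zero)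
      have "G t \<sigma> = amp t 0 * amp' t 0 * (rsum 2 (cpl 0) \<sigma> * rsum (Suc 2) (cpl 0) \<sigma>)
          + amp t 1 * amp' t 1 * (rsum 2 (cpl 1) \<sigma> * rsum (Suc 2) (cpl 1) \<sigma>) + rsum 2 (fld' t) \<sigma>"
        unfolding G_def by simp
      \<comment> \<open>The amplitudes satisfy sin^2 + cos^2 = 1, so their products with the
        derivatives are opposite and only the difference of the variances survives.\<close>
      then have G: "G t \<sigma> = sin t * cos t * \<beta>\<^sup>2 * ((q - q') * P + ((p - q) - (p' - q')) * Q)"
        unfolding c0 c1 r2 Q_def[symmetric] by (simp add: amp_def amp'_def algebra_simps)
      have P: "\<bar>P\<bar> \<le> (9 * ?s1) * (16 * ?s1)"
        unfolding P_def abs_mult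
        using rsum_abs_le[OF finite_spins \<sigma>, of 2 real_of_int] rsum_abs_le[OF finite_spins \<sigma>, of "Suc 2" real_of_int] nn
        by (intro mult_mono) auto
      have Q: "\<bar>Q\<bar> \<le> 9 * ?s2"
        unfolding Q_def using rsum_abs_le[OF finite_spins \<sigma>, of 2 "\<lambda>s. real_of_int s ^ 2"] by simp
      have "\<bar>(q - q') * P + ((p - q) - (p' - q')) * Q\<bar> \<le> \<bar>q - q'\<bar> * \<bar>P\<bar> + \<bar>(p - q) - (p' - q')\<bar> * \<bar>Q\<bar>"
        by (rule order_trans[OF abs_triangle_ineq]) (simp add: abs_mult)
      also have "\<dots> \<le> ?d * ((9 * ?s1) * (16 * ?s1)) + (2 * ?d) * (9 * ?s2)"
      proof (intro add_mono mult_mono P Q)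
        have "(p - q) - (p' - q') = (p - p') - (q - q')" by simp
        then have "\<bar>(p - q) - (p' - q')\<bar> \<le> ?d" by (simp only: abs_triangle_ineq4)
        then show "\<bar>(p - q) - (p' - q')\<bar> \<le> 2 * ?d" by (rule order_trans) simp
      qed auto
      finally have 1: "\<bar>(q - q') * P + ((p - q) - (p' - q')) * Q\<bar> \<le> ?d * (144 * ?s1\<^sup>2 + 18 * ?s2)"
        by (simp add: algebra_simps power2_eq_square)
      have "\<bar>sin t * cos t\<bar> \<le> 1 * 1" unfolding abs_mult by (intro mult_mono) auto
      then have "\<bar>sin t * cos t\<bar> * (\<beta>\<^sup>2 * \<bar>(q - q') * P + ((p - q) - (p' - q')) * Q\<bar>) \<le> 1 * (\<beta>\<^sup>2 * (?d * (144 * ?s1\<^sup>2 + 18 * ?s2)))"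
        using 1 by (intro mult_mono) auto
      then have "\<bar>G t \<sigma>\<bar> \<le> \<beta>\<^sup>2 * (?d * (144 * ?s1\<^sup>2 + 18 * ?s2))"
        unfolding G by (simp add: abs_mult mult_ac)
      then have "\<bar>?F \<sigma>\<bar> * \<bar>G t \<sigma>\<bar> \<le> (real S)\<^sup>2 * (\<beta>\<^sup>2 * (?d * (144 * ?s1\<^sup>2 + 18 * ?s2)))"
        by (intro mult_mono Fb) auto
      then show "\<bar>?F \<sigma> * G t \<sigma>\<bar> \<le> \<beta>\<^sup>2 * Kf S * ?d"
        unfolding Kf_def by (simp add: abs_mult mult_ac)
    qed
    then show ?thesis unfolding nui_const .
  qed
  have "norm (nui (pi / 2) ?F - nui 0 ?F) \<le> \<beta>\<^sup>2 * Kf S * ?d * norm (pi / 2 - 0)"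
    by (rule field_differentiable_bound[where S = UNIV and f' = "\<lambda>t. nui t (\<lambda>\<sigma>. ?F \<sigma> * G t \<sigma>)"])
      (use der bound in auto)
  also have "\<dots> \<le> \<beta>\<^sup>2 * Kf S * ?d * 2"
    using Kf_nonneg[of S] pi_half_less_two by (intro mult_left_mono) auto
  finally show ?thesis unfolding nui_product by (simp add: mult_ac)
qed

end

text \<open>A contraction on the compact square of admissible overlap values. Every solution lies in
  this square, so uniqueness holds among all pairs of reals.\<close>

theorem fixed_point_ex1:
  assumes "16 * \<beta>\<^sup>2 * Kf S \<le> 1"
  shows "\<exists>!pq. fixed_point S \<beta> h D (fst pq) (snd pq)"
proof -
  define \<Phi> where "\<Phi> pq = (Eeta (mom S \<beta> h D (fst pq) (snd pq) 2), Eeta (\<lambda>\<eta>. (mom S \<beta> h D (fst pq) (snd pq) 1 \<eta>)\<^sup>2))" for pq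
  define B where "B = {0..(real S)\<^sup>2} \<times> {0..(real S)\<^sup>2}"
  have fp: "fixed_point S \<beta> h D (fst pq) (snd pq) \<longleftrightarrow> \<Phi> pq = pq" for pq
    by (auto simp: fixed_point_def \<Phi>_def prod_eq_iff)
  have B: "fixed_point S \<beta> h D (fst pq) (snd pq) \<Longrightarrow> pq \<in> B" for pq
    using fixed_point_bounds[of S \<beta> h D "fst pq" "snd pq"] by (simp add: B_def mem_Times_iff)
  have "compact B" unfolding B_def by (intro compact_Times compact_Icc)
  then have "\<exists>!pq\<in>B. \<Phi> pq = pq"
  proof (rule Banach_fix[OF compact_imp_complete, where c = "1 / 2"])
    show "B \<noteq> {}" by (simp add: B_def)
    show "\<Phi> ` B \<subseteq> B"
      using fixed_point_maps_bounds by (auto simp: \<Phi>_def B_def)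
    fix x y assume xy: "x \<in> B" "y \<in> B"
    show "dist (\<Phi> x) (\<Phi> y) \<le> 1 / 2 * dist x y"
    proof -
      obtain p q p' q' where eq: "x = (p, q)" "y = (p', q')" by (metis surj_pair)
      interpret two_points S \<beta> h D p q p' q'
        using xy by unfold_locales (auto simp: eq B_def)
      let ?d = "\<bar>p - p'\<bar> + \<bar>q - q'\<bar>"
      have le: "\<bar>p - p'\<bar> \<le> dist x y" "\<bar>q - q'\<bar> \<le> dist x y"
        unfolding eq dist_Pair_Pair dist_real_def by (simp_all add: real_le_rsqrt)
      have "dist (\<Phi> x) (\<Phi> y) \<le> dist (fst (\<Phi> x)) (fst (\<Phi> y)) + dist (snd (\<Phi> x)) (snd (\<Phi> y))"
        unfolding dist_prod_def by (rule sqrt_sum_squares_le_sum) auto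
      also have "\<dots> \<le> 2 * \<beta>\<^sup>2 * Kf S * ?d + 2 * \<beta>\<^sup>2 * Kf S * ?d"
        using Eeta_lipschitz[of 2 0] Eeta_lipschitz[of 1 1]
        by (intro add_mono) (simp_all add: \<Phi>_def eq dist_real_def mom_zero power2_eq_square)
      \<comment> \<open>The two Lipschitz bounds add up to
        \<open>4 * \<beta>\<^sup>2 * Kf S * ?d\<close>, and the l1 distance \<open>?d\<close> is at
        most twice the Euclidean one; 16 leaves the contraction factor \<open>1 / 2\<close>.\<close>
      also have "\<dots> = (16 * \<beta>\<^sup>2 * Kf S) * (?d / 4)" by simp
      also have "\<dots> \<le> 1 * (?d / 4)" using assms by (intro mult_right_mono) auto
      also have "\<dots> \<le> 1 / 2 * dist x y" using le by simp
      finally show ?thesis .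
    qed
  qed auto
  then show ?thesis unfolding fp using B[unfolded fp] by blast
qed

section \<open>Two-point functions of overlaps\<close>

text \<open>Neither \<open>N\<close> nor the site is fixed here: each pair gets its own instance of
  \<open>cavity_fp\<close>, and the constants of those estimates depend on neither.\<close>

locale gs_model =
  fixes S :: nat and \<beta> h D p q :: real
  assumes \<beta>: "0 \<le> \<beta>" "\<beta> \<le> 1" and fp: "fixed_point S \<beta> h D p q"
begin

lemma cavity_fp: "k < N \<Longrightarrow> cavity_fp S N k \<beta> h D p q"
  using \<beta> fp fixed_point_bounds[OF fp] by unfold_locales auto

abbreviation nuN :: "nat \<Rightarrow> ((nat \<Rightarrow> nat \<Rightarrow> int) \<Rightarrow> real) \<Rightarrow> real" where
  "nuN N \<equiv> nuR S N \<beta> h D"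

abbreviation om :: "nat \<Rightarrow> nat \<Rightarrow> real" where
  "om N \<equiv> ovm S N \<beta> h D p q"

lemma ovl_site_average:
  assumes "0 < N"
  shows "ovl N p q a b \<sigma> * F = (1 / real N) * (\<Sum>k<N. (real_of_int (\<sigma> a k) * real_of_int (\<sigma> b k) - qab p q a b) * F)"
  unfolding ovl_def sum_distrib_right[symmetric] sum_subtractf using assms by (simp add: field_simps)

lemma nuN_site_average:
  assumes N: "0 < N"
  shows "nuN N (\<lambda>\<sigma>. ovl N p q a b \<sigma> * F \<sigma>) =
    (1 / real N) * (\<Sum>k<N. nuN N (\<lambda>\<sigma>. (real_of_int (\<sigma> a k) * real_of_int (\<sigma> b k) - qab p q a b) * F \<sigma>))"
proof -
  interpret c: cavity_fp S N 0 \<beta> h D p q by (rule cavity_fp[OF N])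
  show ?thesis unfolding ovl_site_average[OF N] c.nu_cmult c.nu_sum ..
qed

text \<open>One factor of the even power is written as an average over sites and
  \<open>site_moment\<close> is applied to each site. The next moment then occurs on both sides;
  smallness of \<beta> absorbs it, and the lower moment divided by \<open>N\<close> supplies the
  gain.\<close>

lemma moment_step:
  assumes m: "\<And>x y::real. \<bar>x ^ (2 * m + 1) - y ^ (2 * m + 1)\<bar> \<le> c * \<bar>x - y\<bar> * (x ^ (2 * m) + y ^ (2 * m))"
    and c: "0 \<le> c"
    and small: "\<beta>\<^sup>2 * (32 * (real S)\<^sup>2 * Kc S 2 * 4 ^ Suc m) \<le> 1"
    and IH: "\<exists>C\<ge>0. \<forall>N>0. om N m \<le> C / real N ^ m"
  shows "\<exists>C\<ge>0. \<forall>N>0. om N (Suc m) \<le> C / real N ^ Suc m"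
proof -
  obtain C where C: "0 \<le> C" "\<And>N. 0 < N \<Longrightarrow> om N m \<le> C / real N ^ m" using IH by blast
  let ?s2 = "(real S)\<^sup>2"
  define Kb where "Kb = 4 * c * (real S) ^ 4 * 4 ^ m"
  define C' where "C' = ?s2 ^ (2 * Suc m) + 4 * Kb * (C + ?s2 ^ (2 * m))"
  have Kb: "0 \<le> Kb" unfolding Kb_def using c by simp
  have "om N (Suc m) \<le> C' / real N ^ Suc m" if N: "0 < N" for N
  proof -
    interpret c: cavity_fp S N 0 \<beta> h D p q by (rule cavity_fp[OF N])
    define A where "A j = om N j + (?s2 / N) ^ (2 * j)" for j
    define T where "T = \<beta>\<^sup>2 * (8 * ?s2 * Kc S 2 * 4 ^ Suc m) * A (Suc m) + Kb / N * A m"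
    have le: "nuN N (\<lambda>\<sigma>. ovl N p q a b \<sigma> ^ (2 * Suc m)) \<le> T" if ab: "a < 2" "b < 2" for a b
    proof -
      have "nuN N (\<lambda>\<sigma>. ovl N p q a b \<sigma> ^ (2 * Suc m)) = nuN N (\<lambda>\<sigma>. ovl N p q a b \<sigma> * ovl N p q a b \<sigma> ^ (2 * m + 1))"
        by simp
      also have "\<dots> = (1 / real N) * (\<Sum>k<N. nuN N (\<lambda>\<sigma>. (real_of_int (\<sigma> a k) * real_of_int (\<sigma> b k) - qab p q a b) * ovl N p q a b \<sigma> ^ (2 * m + 1)))"
        by (rule nuN_site_average[OF N])
      also have "\<dots> \<le> (1 / real N) * (\<Sum>k<N. T)"
      proof (intro mult_left_mono sum_mono)
        fix k assume "k \<in> {..<N}"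
        then interpret k: cavity_fp S N k \<beta> h D p q by (intro cavity_fp) simp
        show "nuN N (\<lambda>\<sigma>. (real_of_int (\<sigma> a k) * real_of_int (\<sigma> b k) - qab p q a b) * ovl N p q a b \<sigma> ^ (2 * m + 1)) \<le> T"
          using k.site_moment[OF m c ab] unfolding T_def A_def Kb_def k.eps_def .
      qed simp
      also have "\<dots> = T" using N by simp
      finally show ?thesis .
    qed
    have A0: "0 \<le> om N (Suc m)" unfolding ovm_def by (intro add_nonneg_nonneg c.nu_nonneg zero_le_even_power) auto
    have "om N (Suc m) \<le> 2 * T" using le[of 0 0] le[of 0 1] by (simp add: ovm_def)
    \<comment> \<open>Adding the diagonal and the off-diagonal case doubles 8 to 16; the assumption
      with 32 bounds the coefficient of the moment by \<open>1 / 2\<close>, so the term can be moved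
      to the left.\<close>
    also have "2 * T = \<beta>\<^sup>2 * (32 * ?s2 * Kc S 2 * 4 ^ Suc m) * (A (Suc m) / 2) + 2 * Kb / N * A m"
      by (simp add: T_def)
    also have "\<dots> \<le> 1 * (A (Suc m) / 2) + 2 * Kb / N * A m"
    proof (intro add_right_mono mult_right_mono small)
      show "0 \<le> A (Suc m) / 2" unfolding A_def using A0 by simp
    qed
    finally have 1: "om N (Suc m) \<le> (?s2 / N) ^ (2 * Suc m) + 4 * (Kb / N * A m)"
      by (simp add: A_def field_simps)
    have pw: "(?s2 / N) ^ (2 * j) \<le> ?s2 ^ (2 * j) / real N ^ j" for j
    proof -
      have "real N ^ j \<le> real N ^ (2 * j)" using N by (intro power_increasing) auto
      then show ?thesis unfolding power_divide using N by (intro divide_left_mono) auto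
    qed
    have "A m \<le> (C + ?s2 ^ (2 * m)) / real N ^ m"
      unfolding A_def add_divide_distrib by (intro add_mono C(2)[OF N] pw)
    then have "Kb / N * A m \<le> Kb / N * ((C + ?s2 ^ (2 * m)) / real N ^ m)"
      using Kb by (intro mult_left_mono) auto
    also have "\<dots> = Kb * (C + ?s2 ^ (2 * m)) / real N ^ Suc m" by simp
    finally have "om N (Suc m) \<le> ?s2 ^ (2 * Suc m) / real N ^ Suc m + 4 * (Kb * (C + ?s2 ^ (2 * m)) / real N ^ Suc m)"
      using 1 pw[of "Suc m"] by linarith
    also have "\<dots> = C' / real N ^ Suc m" unfolding C'_def add_divide_distrib by simp
    finally show ?thesis .
  qed
  moreover have "0 \<le> C'" unfolding C'_def using C Kb by simp
  ultimately show ?thesis by blast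
qed

text \<open>The step is made from order 0 to 2 and from 2 to 4. The second is the more demanding
  one: \<open>512 = 32 * 4^2\<close>.\<close>

lemma moments:
  assumes small: "\<beta>\<^sup>2 * (512 * (real S)\<^sup>2 * Kc S 2) \<le> 1"
  shows "\<exists>C\<ge>0. \<forall>N>0. om N 1 \<le> C / real N \<and> om N 2 \<le> C / (real N)\<^sup>2"
proof -
  have "om N 0 = 2" if N: "0 < N" for N
  proof -
    interpret c: cavity_fp S N 0 \<beta> h D p q by (rule cavity_fp[OF N])
    show ?thesis by (simp add: ovm_def c.nu_const)
  qed
  then have 0: "\<exists>C\<ge>0. \<forall>N>0. om N 0 \<le> C / real N ^ 0" by (intro exI[of _ 2]) auto
  have nn: "0 \<le> \<beta>\<^sup>2 * ((real S)\<^sup>2 * Kc S 2)" by (intro mult_nonneg_nonneg Kc_nonneg) auto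
  have 1: "\<exists>C\<ge>0. \<forall>N>0. om N (Suc 0) \<le> C / real N ^ Suc 0"
  proof (rule moment_step[OF _ _ _ 0, where c = 1])
    show "\<beta>\<^sup>2 * (32 * (real S)\<^sup>2 * Kc S 2 * 4 ^ Suc 0) \<le> 1" using small nn by simp
  qed auto
  \<comment> \<open>The Lipschitz estimate for the cube; the constant 2 comes from bounding
    \<open>x\<^sup>2 + x * y + y\<^sup>2\<close> by twice the sum of squares.\<close>
  have cube: "\<bar>x ^ (2 * Suc 0 + 1) - y ^ (2 * Suc 0 + 1)\<bar> \<le> 2 * \<bar>x - y\<bar> * (x ^ (2 * Suc 0) + y ^ (2 * Suc 0))" for x y :: real
  proof -
    have "x ^ (2 * Suc 0 + 1) - y ^ (2 * Suc 0 + 1) = (x - y) * (x\<^sup>2 + x * y + y\<^sup>2)"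
      by (simp add: power2_eq_square eval_nat_numeral algebra_simps)
    moreover have "\<bar>x\<^sup>2 + x * y + y\<^sup>2\<bar> \<le> 2 * (x\<^sup>2 + y\<^sup>2)"
      using zero_le_power2[of "x + y"] zero_le_power2[of "x - y"] zero_le_power2[of x] zero_le_power2[of y]
      unfolding power2_sum power2_diff abs_le_iff by (simp add: algebra_simps)
    ultimately have "\<bar>x ^ (2 * Suc 0 + 1) - y ^ (2 * Suc 0 + 1)\<bar> \<le> \<bar>x - y\<bar> * (2 * (x\<^sup>2 + y\<^sup>2))"
      unfolding abs_mult by (simp add: abs_mult mult_left_mono)
    moreover have "x ^ (2 * Suc 0) = x\<^sup>2" "y ^ (2 * Suc 0) = y\<^sup>2" by simp_all
    ultimately show ?thesis by (simp only: mult_ac)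
  qed
  have 2: "\<exists>C\<ge>0. \<forall>N>0. om N (Suc (Suc 0)) \<le> C / real N ^ Suc (Suc 0)"
    by (rule moment_step[OF cube _ _ 1]) (use small in \<open>simp_all add: mult_ac\<close>)
  obtain C1 C2 where C: "0 \<le> C1" "0 \<le> C2" "\<And>N. 0 < N \<Longrightarrow> om N 1 \<le> C1 / real N"
    "\<And>N. 0 < N \<Longrightarrow> om N 2 \<le> C2 / (real N)\<^sup>2"
    using 1 2 by (auto simp: numeral_2_eq_2)
  show ?thesis
  proof (intro exI[of _ "C1 + C2"] conjI allI impI)
    fix N :: nat assume N: "0 < N"
    show "om N 1 \<le> (C1 + C2) / real N" "om N 2 \<le> (C1 + C2) / (real N)\<^sup>2"
      by (rule order_trans[OF C(3)[OF N]] order_trans[OF C(4)[OF N]], rule divide_right_mono, use C in simp_all)+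
  qed (use C in simp)
qed

text \<open>The covariance, in the limiting one-site law, of two products of spins; the subtracted
  terms are their means by \<open>W_pair\<close>.\<close>

definition cov0 :: "nat \<Rightarrow> nat \<Rightarrow> nat \<Rightarrow> nat \<Rightarrow> real" where
  "cov0 a b c d = cavity.W S \<beta> h D p q [a, b, c, d] - qab p q a b * qab p q c d"

definition cov :: "nat \<Rightarrow> nat \<Rightarrow> nat \<Rightarrow> nat \<Rightarrow> nat \<Rightarrow> real" where
  "cov N a b c d = nuN N (\<lambda>\<sigma>. ovl N p q a b \<sigma> * ovl N p q c d \<sigma>)"

text \<open>The first overlap is an average over sites, and the cavity expansion of each site has
  the same main term with an error uniform in the site.\<close>

theorem averaged_expansion:
  assumes small: "\<beta>\<^sup>2 * (512 * (real S)\<^sup>2 * Kc S 2) \<le> 1"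
  shows "\<exists>K. \<forall>N>0. \<forall>a<4. \<forall>b<4. \<forall>c<4. \<forall>d<4.
    \<bar>cov N a b c d - cov0 a b c d / N
      - \<beta>\<^sup>2 / 2 * (\<Sum>i\<le>4. \<Sum>j\<le>Suc 4. rc 4 i * rc (Suc 4) j * (cov0 a b i j * cov N i j c d))\<bar>
    \<le> K / (real N * sqrt N)"
proof -
  obtain C where C: "0 \<le> C" "\<And>N. 0 < N \<Longrightarrow> om N 1 \<le> C / real N" "\<And>N. 0 < N \<Longrightarrow> om N 2 \<le> C / (real N)\<^sup>2"
    using moments[OF small] by blast
  \<comment> \<open>Serves all three moment hypotheses of \<open>cavity_expansion\<close>: 4 and 16
    are the factors of \<open>nu_xm_power_le\<close> for the second and fourth moment, and the
    powers of \<open>S\<close> account for the omitted site.\<close>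
  define C' where "C' = 16 * (C + (real S) ^ 4 + (real S) ^ 8)"
  have C': "0 \<le> C'" "C \<le> C'" using C(1) by (auto simp: C'_def)
  have "\<bar>cov N a b c d - cov0 a b c d / N
      - \<beta>\<^sup>2 / 2 * (\<Sum>i\<le>4. \<Sum>j\<le>Suc 4. rc 4 i * rc (Suc 4) j * (cov0 a b i j * cov N i j c d))\<bar>
    \<le> KK S C' / (real N * sqrt N)"
    if N: "0 < N" and abcd: "a < 4" "b < 4" "c < 4" "d < 4" for N a b c d
  proof -
    let ?B = "KK S C' / (real N * sqrt N)"
    define L where "L = cov0 a b c d / N
      + \<beta>\<^sup>2 / 2 * (\<Sum>i\<le>4. \<Sum>j\<le>Suc 4. rc 4 i * rc (Suc 4) j * (cov0 a b i j * cov N i j c d))"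
    define g where "g k = nuN N (\<lambda>\<sigma>. (real_of_int (\<sigma> a k) * real_of_int (\<sigma> b k) - qab p q a b) * ovl N p q c d \<sigma>)" for k
    have N1: "1 \<le> real N" using N by simp
    have each: "\<bar>g k - L\<bar> \<le> ?B" if k: "k < N" for k
    proof -
      interpret c: cavity_fp S N k \<beta> h D p q by (rule cavity_fp[OF k])
      have x2: "nuN N (\<lambda>\<sigma>. (c.xm i j \<sigma>)\<^sup>2) \<le> C' / N" if "i < 12" "j < 12" for i j
      proof -
        have "nuN N (\<lambda>\<sigma>. (c.xm i j \<sigma>)\<^sup>2) \<le> 4 * (om N 1 + ((real S)\<^sup>2 / N)\<^sup>2)"
          using c.nu_xm_power_le[OF that, of 1] by simp
        also have "\<dots> \<le> 4 * (C / N + (real S) ^ 4 / N)"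
        proof -
          have "((real S)\<^sup>2 / N)\<^sup>2 = (real S) ^ 4 / (real N * real N)"
            by (simp add: power_divide power2_eq_square power4_eq_xxxx mult.assoc)
          also have "\<dots> \<le> (real S) ^ 4 / (real N * 1)"
            using N1 by (intro divide_left_mono mult_left_mono) auto
          finally show ?thesis using C(2)[OF N] by simp
        qed
        also have "\<dots> = (4 * (C + (real S) ^ 4)) / N" by (simp add: add_divide_distrib)
        also have "\<dots> \<le> C' / N" unfolding C'_def using C(1) by (intro divide_right_mono) auto
        finally show ?thesis .
      qed
      have x4: "nuN N (\<lambda>\<sigma>. c.xm i j \<sigma> ^ 4) \<le> C' / (real N)\<^sup>2" if "i < 12" "j < 12" for i j
      proof -
        have "nuN N (\<lambda>\<sigma>. c.xm i j \<sigma> ^ 4) \<le> 16 * (om N 2 + ((real S)\<^sup>2 / N) ^ 4)"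
          using c.nu_xm_power_le[OF that, of 2] by simp
        also have "\<dots> \<le> 16 * (C / (real N)\<^sup>2 + (real S) ^ 8 / (real N)\<^sup>2)"
        proof -
          have "((real S)\<^sup>2 / N) ^ 4 = (real S) ^ 8 / real N ^ 4"
            by (simp add: power_divide flip: power_mult)
          also have "\<dots> \<le> (real S) ^ 8 / (real N)\<^sup>2"
            using N1 by (intro divide_left_mono power_increasing) auto
          finally show ?thesis using C(3)[OF N] by simp
        qed
        also have "\<dots> = (16 * (C + (real S) ^ 8)) / (real N)\<^sup>2" by (simp add: add_divide_distrib)
        also have "\<dots> \<le> C' / (real N)\<^sup>2" unfolding C'_def by (intro divide_right_mono) auto
        finally show ?thesis .
      qed
      have o2: "nuN N (\<lambda>\<sigma>. (ovl N p q i j \<sigma>)\<^sup>2) \<le> C' / N" if "i < 12" "j < 12" for i j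
      proof -
        have "nuN N (\<lambda>\<sigma>. (ovl N p q i j \<sigma>)\<^sup>2) \<le> om N 1"
          using c.nu_ovl_power_le[OF that, of 1] by simp
        also have "\<dots> \<le> C / N" by (rule C(2)[OF N])
        also have "\<dots> \<le> C' / N" using C'(2) by (intro divide_right_mono) auto
        finally show ?thesis .
      qed
      show ?thesis
        using c.cavity_expansion[OF C'(1) x2 x4 o2 abcd]
        unfolding g_def L_def cov_def cov0_def c.eps_def by (simp only: diff_diff_eq)
    qed
    have "cov N a b c d = (1 / real N) * (\<Sum>k<N. g k)"
      unfolding cov_def g_def by (rule nuN_site_average[OF N])
    then have "cov N a b c d - L = (1 / real N) * (\<Sum>k<N. g k - L)"
      using N by (simp add: sum_subtractf field_simps)
    also have "\<bar>\<dots>\<bar> \<le> (1 / real N) * (\<Sum>k<N. ?B)"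
      unfolding abs_mult by (intro mult_mono order_trans[OF sum_abs] sum_mono each sum_nonneg) auto
    also have "\<dots> = ?B" using N by simp
    finally show ?thesis unfolding L_def by (simp only: diff_diff_eq)
  qed
  then show ?thesis by blast
qed

end

section \<open>Moments of \<open>T1\<close> and \<open>S1\<close> as differences of two-point
  functions\<close>

lemma sum_prb_eq_gibbs:
  "(\<Sum>x\<in>configs S N. prb (configs S N) (Ham N \<beta> h D g) x * f x) = gibbs S N \<beta> h D g f"
  by (simp add: prb_def gibbs_def mult.commute flip: sum_divide_distrib)

context
  fixes S N :: nat and \<beta> h D :: real and g :: "nat \<times> nat \<Rightarrow> real"
begin

abbreviation (input) ga :: "((nat \<Rightarrow> nat \<Rightarrow> int) \<Rightarrow> real) \<Rightarrow> real" where
  "ga \<equiv> gav 12 (configs S N) (Ham N \<beta> h D g)"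

abbreviation (input) gb :: "((nat \<Rightarrow> int) \<Rightarrow> real) \<Rightarrow> real" where
  "gb \<equiv> gibbs S N \<beta> h D g"

definition rlz :: "nat \<Rightarrow> nat \<Rightarrow> (nat \<Rightarrow> nat \<Rightarrow> int) \<Rightarrow> real" where
  "rlz a b \<sigma> = (1 / real N) * (\<Sum>i<N. real_of_int (\<sigma> a i) * real_of_int (\<sigma> b i))"

text \<open>What is left of the overlap of \<open>x\<close> with another replica after averaging out
  the latter; \<open>T1\<close> is its centred version.\<close>

definition tav :: "(nat \<Rightarrow> int) \<Rightarrow> real" where
  "tav x = (1 / real N) * (\<Sum>i<N. real_of_int (x i) * bmag S N \<beta> h D g i)"

definition sav :: "(nat \<Rightarrow> int) \<Rightarrow> real" where
  "sav x = (1 / real N) * (\<Sum>i<N. real_of_int (x i) ^ 2)"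

lemma gibbs_linear:
  "gb (\<lambda>x. f x + f' x) = gb f + gb f'" "gb (\<lambda>x. f x - f' x) = gb f - gb f'" "gb (\<lambda>x. c * f x) = c * gb f"
  "gb (\<lambda>x. f x * c) = gb f * c" "gb (\<lambda>x. \<Sum>i\<in>I. F i x) = (\<Sum>i\<in>I. gb (F i))" "gb (\<lambda>_. c) = c"
proof -
  show "gb (\<lambda>x. \<Sum>i\<in>I. F i x) = (\<Sum>i\<in>I. gb (F i))"
    unfolding sum_prb_eq_gibbs[symmetric] sum_distrib_left by (rule sum.swap)
  show "gb (\<lambda>_. c) = c"
    unfolding sum_prb_eq_gibbs[symmetric]
    by (simp add: sum_prb finite_configs configs_nonempty flip: sum_distrib_right)
qed (simp_all add: sum_distrib_left sum.distrib sum_subtractf algebra_simps flip: sum_prb_eq_gibbs)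

lemma ga_linear:
  "ga (\<lambda>\<sigma>. F \<sigma> + G \<sigma>) = ga F + ga G" "ga (\<lambda>\<sigma>. F \<sigma> - G \<sigma>) = ga F - ga G"
  "ga (\<lambda>\<sigma>. c * F \<sigma>) = c * ga F" "ga (\<lambda>\<sigma>. \<Sum>i\<in>I. H i \<sigma>) = (\<Sum>i\<in>I. ga (H i))"
  by (simp_all add: gav_def rep_add rep_diff rep_cmult rep_sum)

lemma ga_indep:
  assumes "b < 12" "\<And>\<sigma> x. F (\<sigma>(b := x)) = F \<sigma>"
  shows "ga (\<lambda>\<sigma>. F \<sigma> * \<phi> (\<sigma> b)) = ga F * gb \<phi>"
  unfolding gav_def sum_prb_eq_gibbs[symmetric]
  by (rule rep_indep) (use assms in \<open>auto simp: sum_prb finite_configs configs_nonempty\<close>)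

lemma ga_single: "b < 12 \<Longrightarrow> ga (\<lambda>\<sigma>. \<phi> (\<sigma> b)) = gb \<phi>"
  using ga_indep[of b "\<lambda>_. 1" \<phi>] gav_const[OF finite_configs configs_nonempty] by simp

lemma ga_average_overlap:
  assumes "a \<noteq> b" "b < 12" "\<And>\<sigma> x. F (\<sigma>(b := x)) = F \<sigma>"
  shows "ga (\<lambda>\<sigma>. F \<sigma> * rlz a b \<sigma>) = ga (\<lambda>\<sigma>. F \<sigma> * tav (\<sigma> a))"
proof -
  have "ga (\<lambda>\<sigma>. F \<sigma> * rlz a b \<sigma>) = ga (\<lambda>\<sigma>. (1 / real N) * (\<Sum>i<N. (F \<sigma> * real_of_int (\<sigma> a i)) * real_of_int (\<sigma> b i)))"
    by (simp add: rlz_def sum_distrib_left mult_ac)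
  also have "\<dots> = (1 / real N) * (\<Sum>i<N. ga (\<lambda>\<sigma>. F \<sigma> * real_of_int (\<sigma> a i)) * bmag S N \<beta> h D g i)"
    unfolding ga_linear bmag_def using assms
    by (intro arg_cong2[where f = "(*)"] sum.cong refl ga_indep[where \<phi> = "\<lambda>x. real_of_int (x _)"]) auto
  also have "\<dots> = ga (\<lambda>\<sigma>. (1 / real N) * (\<Sum>i<N. bmag S N \<beta> h D g i * (F \<sigma> * real_of_int (\<sigma> a i))))"
    unfolding ga_linear by (simp add: mult.commute)
  also have "\<dots> = ga (\<lambda>\<sigma>. F \<sigma> * tav (\<sigma> a))"
    by (simp add: tav_def sum_distrib_left mult_ac)
  finally show ?thesis .
qed

lemma ga_product: "ga (\<lambda>\<sigma>. \<phi> (\<sigma> 0) * \<psi> (\<sigma> 1)) = gb \<phi> * gb \<psi>"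
  using ga_indep[of 1 "\<lambda>\<sigma>. \<phi> (\<sigma> 0)" \<psi>] ga_single[of 0 \<phi>] by simp

lemma T1_eq: "T1 S N \<beta> h D g x = tav x - gb tav"
proof -
  have "gb tav = (1 / real N) * (\<Sum>i<N. bmag S N \<beta> h D g i * bmag S N \<beta> h D g i)"
    unfolding tav_def gibbs_linear bmag_def ..
  then show ?thesis by (simp add: T1_def tav_def algebra_simps sum_subtractf diff_divide_distrib)
qed

lemma S1_eq: "S1 S N \<beta> h D g x = sav x - gb sav"
proof -
  have "gb sav = (1 / real N) * (\<Sum>i<N. bsq S N \<beta> h D g i)"
    unfolding sav_def gibbs_linear bsq_def ..
  then show ?thesis by (simp add: S1_def sav_def algebra_simps sum_subtractf diff_divide_distrib)
qed

lemma rlz_diag: "rlz a a \<sigma> = sav (\<sigma> a)"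
  by (simp add: rlz_def sav_def power2_eq_square)

lemma ovl_rlz: "ovl N p q a b \<sigma> = rlz a b \<sigma> - qab p q a b"
  by (simp add: ovl_def rlz_def)

lemma gb_covariance: "gb (\<lambda>x. (\<phi> x - gb \<phi>) * (\<psi> x - gb \<psi>)) = gb (\<lambda>x. \<phi> x * \<psi> x) - gb \<phi> * gb \<psi>"
proof -
  have "gb (\<lambda>x. (\<phi> x - gb \<phi>) * (\<psi> x - gb \<psi>)) = gb (\<lambda>x. (\<phi> x * \<psi> x - gb \<phi> * \<psi> x) - (\<phi> x * gb \<psi> - gb \<phi> * gb \<psi>))"
    by (simp add: algebra_simps)
  then show ?thesis unfolding gibbs_linear by simp
qed

text \<open>Replica 1 is an independent copy of replica 0, so the difference in the second factor
  carries out the centring; the constants \<open>p\<close> cancel.\<close>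

lemma ga_S1_S1: "ga (\<lambda>\<sigma>. ovl N p q 0 0 \<sigma> * (ovl N p q 0 0 \<sigma> - ovl N p q 1 1 \<sigma>)) = gb (\<lambda>x. (S1 S N \<beta> h D g x)\<^sup>2)"
proof -
  have "ga (\<lambda>\<sigma>. ovl N p q 0 0 \<sigma> * (ovl N p q 0 0 \<sigma> - ovl N p q 1 1 \<sigma>)) =
    ga (\<lambda>\<sigma>. (sav (\<sigma> 0) * sav (\<sigma> 0) - sav (\<sigma> 0) * sav (\<sigma> 1)) - p * (sav (\<sigma> 0) - sav (\<sigma> 1)))"
    unfolding rlz_diag[symmetric] by (simp add: ovl_rlz qab_def algebra_simps)
  also have "\<dots> = gb (\<lambda>x. sav x * sav x) - gb sav * gb sav"
    unfolding ga_linear ga_product using ga_single[of 0 "\<lambda>x. sav x * sav x"] ga_single[of 0 sav] ga_single[of 1 sav] by simp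
  finally show ?thesis unfolding S1_eq power2_eq_square gb_covariance .
qed

lemma ga_S1_T1: "ga (\<lambda>\<sigma>. ovl N p q 0 2 \<sigma> * (ovl N p q 0 0 \<sigma> - ovl N p q 1 1 \<sigma>)) = gb (\<lambda>x. S1 S N \<beta> h D g x * T1 S N \<beta> h D g x)"
proof -
  have "ga (\<lambda>\<sigma>. ovl N p q 0 2 \<sigma> * (ovl N p q 0 0 \<sigma> - ovl N p q 1 1 \<sigma>)) =
    ga (\<lambda>\<sigma>. (sav (\<sigma> 0) - sav (\<sigma> 1)) * rlz 0 2 \<sigma> - q * (sav (\<sigma> 0) - sav (\<sigma> 1)))"
    unfolding rlz_diag[symmetric] by (simp add: ovl_rlz qab_def algebra_simps)
  also have "\<dots> = ga (\<lambda>\<sigma>. (sav (\<sigma> 0) - sav (\<sigma> 1)) * tav (\<sigma> 0)) - q * (gb sav - gb sav)"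
    unfolding ga_linear using ga_average_overlap[of 0 2 "\<lambda>\<sigma>. sav (\<sigma> 0) - sav (\<sigma> 1)"]
      ga_single[of 0 sav] ga_single[of 1 sav] by simp
  also have "ga (\<lambda>\<sigma>. (sav (\<sigma> 0) - sav (\<sigma> 1)) * tav (\<sigma> 0)) = ga (\<lambda>\<sigma>. sav (\<sigma> 0) * tav (\<sigma> 0) - tav (\<sigma> 0) * sav (\<sigma> 1))"
    by (simp add: algebra_simps)
  also have "\<dots> = gb (\<lambda>x. sav x * tav x) - gb tav * gb sav"
    unfolding ga_linear ga_product using ga_single[of 0 "\<lambda>x. sav x * tav x"] by simp
  finally show ?thesis unfolding S1_eq T1_eq gb_covariance by simp
qed

text \<open>Replicas 2 and 3 stand for the magnetisation in the two factors and must be distinct to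
  average out separately; replica 1 is the copy of replica 0 that centres. This is why four replicas
  are needed.\<close>

lemma ga_T1_T1: "ga (\<lambda>\<sigma>. ovl N p q 0 2 \<sigma> * (ovl N p q 0 3 \<sigma> - ovl N p q 1 3 \<sigma>)) = gb (\<lambda>x. (T1 S N \<beta> h D g x)\<^sup>2)"
proof -
  have ind: "rlz a b (\<sigma>(c := x)) = rlz a b \<sigma>" if "a \<noteq> c" "b \<noteq> c" for a b c \<sigma> x
    using that by (simp add: rlz_def)
  have "ga (\<lambda>\<sigma>. ovl N p q 0 2 \<sigma> * (ovl N p q 0 3 \<sigma> - ovl N p q 1 3 \<sigma>)) =
    ga (\<lambda>\<sigma>. (rlz 0 2 \<sigma> * rlz 0 3 \<sigma> - rlz 0 2 \<sigma> * rlz 1 3 \<sigma>) - q * (1 * rlz 0 3 \<sigma> - 1 * rlz 1 3 \<sigma>))"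
    by (simp add: ovl_rlz qab_def algebra_simps)
  also have "\<dots> = (ga (\<lambda>\<sigma>. rlz 0 2 \<sigma> * tav (\<sigma> 0)) - ga (\<lambda>\<sigma>. rlz 0 2 \<sigma> * tav (\<sigma> 1))) - q * (gb tav - gb tav)"
    unfolding ga_linear
    using ga_average_overlap[of 0 3 "rlz 0 2"] ga_average_overlap[of 1 3 "rlz 0 2"]
      ga_average_overlap[of 0 3 "\<lambda>_. 1"] ga_average_overlap[of 1 3 "\<lambda>_. 1"] ga_single[of 0 tav] ga_single[of 1 tav] ind
    by simp
  also have "ga (\<lambda>\<sigma>. rlz 0 2 \<sigma> * tav (\<sigma> 0)) = gb (\<lambda>x. tav x * tav x)"
    using ga_average_overlap[of 0 2 "\<lambda>\<sigma>. tav (\<sigma> 0)"] ga_single[of 0 "\<lambda>x. tav x * tav x"] by (simp add: mult.commute)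
  also have "ga (\<lambda>\<sigma>. rlz 0 2 \<sigma> * tav (\<sigma> 1)) = gb tav * gb tav"
    using ga_average_overlap[of 0 2 "\<lambda>\<sigma>. tav (\<sigma> 1)"] ga_product[of tav tav] by (simp add: mult.commute)
  finally show ?thesis unfolding T1_eq power2_eq_square gb_covariance by simp
qed

end

section \<open>Replica symmetry and the linear system\<close>

text \<open>By the symmetry between replicas, a two-point function of overlaps takes only nine values.\<close>

definition pattern :: "(nat \<Rightarrow> nat \<Rightarrow> nat \<Rightarrow> nat \<Rightarrow> 'a) \<Rightarrow> nat \<Rightarrow> nat \<Rightarrow> nat \<Rightarrow> nat \<Rightarrow> 'a" where
  "pattern V a b c d =
    (if a = b then
       if c = d then if a = c then V 0 0 0 0 else V 0 0 1 1
       else if a = c \<or> a = d then V 0 0 0 1 else V 0 0 1 2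
     else if c = d then if a = c \<or> b = c then V 0 1 0 0 else V 0 1 2 2
     else if a = c \<and> b = d \<or> a = d \<and> b = c then V 0 1 0 1
     else if a = c \<or> a = d \<or> b = c \<or> b = d then V 0 1 0 2 else V 0 1 2 3)"

text \<open>A permutation of replicas moves the distinct indices to 0, 1, 2, 3, and the two indices
  within each pair may be swapped. The two pairs themselves are not exchanged, so there are nine
  classes instead of seven.\<close>

lemma pattern_classification:
  fixes V :: "nat \<Rightarrow> nat \<Rightarrow> nat \<Rightarrow> nat \<Rightarrow> 'a"
  assumes perm: "\<And>\<pi> a b c d. \<pi> permutes {..<R} \<Longrightarrow> V (\<pi> a) (\<pi> b) (\<pi> c) (\<pi> d) = V a b c d"
    and sym: "\<And>a b c d. V b a c d = V a b c d" "\<And>a b c d. V a b d c = V a b c d"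
    and R: "a < R" "b < R" "c < R" "d < R"
  shows "V a b c d = pattern V a b c d"
proof -
  have one: "V i i i i = V 0 0 0 0" if lt: "i < R" for i
  proof -
    obtain \<pi> where \<pi>: "\<pi> permutes {..<R}" "\<forall>l<length [i]. \<pi> l = [i] ! l"
      using permutes_extend[of "[i]" R] lt by auto
    from \<pi>(2) have "\<pi> 0 = i" by auto
    with perm[OF \<pi>(1), of 0 0 0 0] show ?thesis by simp
  qed
  have two: "V i i j j = V 0 0 1 1" "V i i i j = V 0 0 0 1" "V i j i i = V 0 1 0 0" "V i j i j = V 0 1 0 1"
    if lt: "i < R" "j < R" "i \<noteq> j" for i j
  proof -
    obtain \<pi> where \<pi>: "\<pi> permutes {..<R}" "\<forall>l<length [i, j]. \<pi> l = [i, j] ! l"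
      using permutes_extend[of "[i, j]" R] lt by auto
    from \<pi>(2) have "\<pi> 0 = i" "\<pi> 1 = j" by auto
    with perm[OF \<pi>(1), of 0 0 1 1] perm[OF \<pi>(1), of 0 0 0 1] perm[OF \<pi>(1), of 0 1 0 0] perm[OF \<pi>(1), of 0 1 0 1]
    show "V i i j j = V 0 0 1 1" "V i i i j = V 0 0 0 1" "V i j i i = V 0 1 0 0" "V i j i j = V 0 1 0 1"
      by simp_all
  qed
  have three: "V i i j l = V 0 0 1 2" "V i j l l = V 0 1 2 2" "V i j i l = V 0 1 0 2"
    if lt: "i < R" "j < R" "l < R" "i \<noteq> j" "i \<noteq> l" "j \<noteq> l" for i j l
  proof -
    obtain \<pi> where \<pi>: "\<pi> permutes {..<R}" "\<forall>m<length [i, j, l]. \<pi> m = [i, j, l] ! m"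
      using permutes_extend[of "[i, j, l]" R] lt by auto
    have "\<pi> 0 = [i, j, l] ! 0" "\<pi> 1 = [i, j, l] ! 1" "\<pi> 2 = [i, j, l] ! 2"
      using \<pi>(2) by (auto simp del: nth.simps)
    then have "\<pi> 0 = i" "\<pi> 1 = j" "\<pi> 2 = l" by simp_all
    with perm[OF \<pi>(1), of 0 0 1 2] perm[OF \<pi>(1), of 0 1 2 2] perm[OF \<pi>(1), of 0 1 0 2]
    show "V i i j l = V 0 0 1 2" "V i j l l = V 0 1 2 2" "V i j i l = V 0 1 0 2"
      by simp_all
  qed
  have four: "V i j l m = V 0 1 2 3"
    if lt: "i < R" "j < R" "l < R" "m < R" "i \<noteq> j" "i \<noteq> l" "j \<noteq> l" "i \<noteq> m" "j \<noteq> m" "l \<noteq> m" for i j l m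
  proof -
    obtain \<pi> where \<pi>: "\<pi> permutes {..<R}" "\<forall>r<length [i, j, l, m]. \<pi> r = [i, j, l, m] ! r"
      using permutes_extend[of "[i, j, l, m]" R] lt by auto
    have "\<pi> 0 = [i, j, l, m] ! 0" "\<pi> 1 = [i, j, l, m] ! 1" "\<pi> 2 = [i, j, l, m] ! 2" "\<pi> 3 = [i, j, l, m] ! 3"
      using \<pi>(2) by (auto simp del: nth.simps)
    then have "\<pi> 0 = i" "\<pi> 1 = j" "\<pi> 2 = l" "\<pi> 3 = m" by simp_all
    with perm[OF \<pi>(1), of 0 1 2 3] show ?thesis by simp
  qed
  consider (c1) "a = b" "c = d" "a = c" | (c2) "a = b" "c = d" "a \<noteq> c"
    | (c3) "a = b" "c \<noteq> d" "a = c" | (c3b) "a = b" "c \<noteq> d" "a = d" | (c4) "a = b" "c \<noteq> d" "a \<noteq> c" "a \<noteq> d"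
    | (c5) "a \<noteq> b" "c = d" "a = c" | (c5b) "a \<noteq> b" "c = d" "b = c" | (c6) "a \<noteq> b" "c = d" "a \<noteq> c" "b \<noteq> c"
    | (c7) "a \<noteq> b" "c \<noteq> d" "a = c" "b = d" | (c7b) "a \<noteq> b" "c \<noteq> d" "a = d" "b = c"
    | (c8) "a \<noteq> b" "c \<noteq> d" "a = c" "b \<noteq> d" | (c8b) "a \<noteq> b" "c \<noteq> d" "a = d" "b \<noteq> c"
    | (c8c) "a \<noteq> b" "c \<noteq> d" "b = c" "a \<noteq> d" | (c8d) "a \<noteq> b" "c \<noteq> d" "b = d" "a \<noteq> c"
    | (c9) "a \<noteq> b" "c \<noteq> d" "a \<noteq> c" "a \<noteq> d" "b \<noteq> c" "b \<noteq> d"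
    by metis
  then show ?thesis
  proof cases
    case c1 then show ?thesis using one[of a] R by (simp add: pattern_def)
  next
    case c2 then show ?thesis using two(1)[of a c] R by (simp add: pattern_def)
  next
    case c3 then show ?thesis using two(2)[of a d] R by (simp add: pattern_def)
  next
    case c3b then show ?thesis using two(2)[of a c] sym(2)[of a a a c] R by (simp add: pattern_def)
  next
    case c4 then show ?thesis using three(1)[of a c d] R by (simp add: pattern_def)
  next
    case c5 then show ?thesis using two(3)[of a b] R by (simp add: pattern_def)
  next
    case c5b then show ?thesis using two(3)[of b a] sym(1)[of b a b b] R by (simp add: pattern_def)
  next
    case c6 then show ?thesis using three(2)[of a b c] R by (simp add: pattern_def)
  next
    case c7 then show ?thesis using two(4)[of a b] R by (simp add: pattern_def)
  next
    case c7b then show ?thesis using two(4)[of a b] sym(2)[of a b a b] R by (simp add: pattern_def)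
  next
    case c8 then show ?thesis using three(3)[of a b d] R by (simp add: pattern_def)
  next
    case c8b then show ?thesis using three(3)[of a b c] sym(2)[of a b a c] R by (simp add: pattern_def)
  next
    case c8c then show ?thesis using three(3)[of b a d] sym(1)[of b a b d] R by (simp add: pattern_def)
  next
    case c8d then show ?thesis using three(3)[of b a c] sym(1)[of b a b c] sym(2)[of a b b c] R by (simp add: pattern_def)
  next
    case c9 then show ?thesis using four[of a b c d] R by (simp add: pattern_def)
  qed
qed

text \<open>A finite evaluation over five by six replicas. The coefficients \<open>rc n\<close> sum
  to zero, and the differences on the left are those that represent centred variables; they
  reproduce differences of the same kind, so the system closes.\<close>

lemma pattern_sums:
  fixes C V :: "nat \<Rightarrow> nat \<Rightarrow> nat \<Rightarrow> nat \<Rightarrow> real"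
  defines "Y \<equiv> \<lambda>a b c d. \<Sum>i\<le>4. \<Sum>j\<le>Suc 4. rc 4 i * rc (Suc 4) j * (pattern C a b i j * pattern V i j c d)"
  shows "Y 0 0 0 0 - Y 0 0 1 1 =
      (C 0 0 0 0 - C 0 0 1 1) * (V 0 0 0 0 - V 0 0 1 1) - 4 * (C 0 0 0 1 - C 0 0 1 2) * (V 0 1 0 0 - V 0 1 2 2)"
    and "Y 0 2 0 0 - Y 0 2 1 1 = (C 0 1 0 0 - C 0 1 2 2) * (V 0 0 0 0 - V 0 0 1 1)
      + 2 * (C 0 1 0 1 - 4 * C 0 1 0 2 + 3 * C 0 1 2 3) * (V 0 1 0 0 - V 0 1 2 2)"
    and "Y 0 2 0 3 - Y 0 2 1 3 = (C 0 1 0 0 - C 0 1 2 2) * (V 0 0 0 1 - V 0 0 1 2)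
      + 2 * (C 0 1 0 1 - 4 * C 0 1 0 2 + 3 * C 0 1 2 3) * (V 0 1 0 2 - V 0 1 2 3)
      + 2 * (C 0 1 0 2 - C 0 1 2 3) * (V 0 1 0 1 - 2 * V 0 1 0 2 + V 0 1 2 3)"
    and "Y 0 2 0 2 - Y 0 2 1 2 - Y 0 2 0 3 + Y 0 2 1 3 =
      2 * (C 0 1 0 1 - 2 * C 0 1 0 2 + C 0 1 2 3) * (V 0 1 0 1 - 2 * V 0 1 0 2 + V 0 1 2 3)"
  unfolding Y_def by (simp_all add: pattern_def rc_def eval_nat_numeral algebra_simps)

lemma cnt_map: "inj \<pi> \<Longrightarrow> cnt (map \<pi> l) (\<pi> r) = cnt l r"
  by (induction l) (auto simp: cnt_def dest: injD)

context gs_model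
begin

abbreviation W :: "nat list \<Rightarrow> real" where "W \<equiv> cavity.W S \<beta> h D p q"

abbreviation mm :: "nat \<Rightarrow> real \<Rightarrow> real" where "mm \<equiv> mom S \<beta> h D p q"

lemma W_def: "W l = Eeta (\<lambda>\<eta>. \<Prod>r<12. mm (cnt l r) \<eta>)"
proof -
  interpret c: cavity_fp S 1 0 \<beta> h D p q by (rule cavity_fp) simp
  show ?thesis by (rule c.W_def)
qed

lemma W_permute:
  assumes "\<pi> permutes {..<12}"
  shows "W (map \<pi> l) = W l"
proof -
  have "(\<Prod>r<12. mm (cnt (map \<pi> l) r) \<eta>) = (\<Prod>r<12. mm (cnt l r) \<eta>)" for \<eta>
    using prod.permute[OF assms, of "\<lambda>r. mm (cnt (map \<pi> l) r) \<eta>"] permutes_inj[OF assms]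
    by (simp add: comp_def cnt_map)
  then show ?thesis by (simp add: W_def)
qed

lemma W_diff: "W l - W l' = Eeta (\<lambda>\<eta>. (\<Prod>r<12. mm (cnt l r) \<eta>) - (\<Prod>r<12. mm (cnt l' r) \<eta>))"
proof -
  have "integrable stdN (\<lambda>\<eta>. \<Prod>r<12. mm (cnt l r) \<eta>)" for l
  proof (rule integrable_stdN_bounded)
    show "\<bar>\<Prod>r<12. mm (cnt l r) \<eta>\<bar> \<le> (\<Prod>r<12. real S ^ cnt l r)" for \<eta>
      unfolding abs_prod by (intro prod_mono conjI mom_abs_le) auto
  qed (intro borel_measurable_prod measurable_mom)
  then show ?thesis unfolding W_def Eeta_def by simp
qed

lemma cov0_permute:
  assumes "\<pi> permutes {..<12}"
  shows "cov0 (\<pi> a) (\<pi> b) (\<pi> c) (\<pi> d) = cov0 a b c d"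
  using W_permute[OF assms, of "[a, b, c, d]"] permutes_inj[OF assms]
  by (auto simp: cov0_def qab_def dest: injD)

lemma cov0_sym: "cov0 b a c d = cov0 a b c d" "cov0 a b d c = cov0 a b c d"
proof -
  have "cnt [b, a, c, d] = cnt [a, b, c, d]" "cnt [a, b, d, c] = cnt [a, b, c, d]"
    by (auto simp: cnt_def fun_eq_iff)
  then show "cov0 b a c d = cov0 a b c d" "cov0 a b d c = cov0 a b c d"
    by (simp_all add: cov0_def W_def qab_def)
qed

lemma cov_permute:
  assumes N: "0 < N" and \<pi>: "\<pi> permutes {..<12}"
  shows "cov N (\<pi> a) (\<pi> b) (\<pi> c) (\<pi> d) = cov N a b c d"
proof -
  interpret c: cavity_fp S N 0 \<beta> h D p q by (rule cavity_fp[OF N])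
  show ?thesis
    using c.nu_permute[OF \<pi>, of "\<lambda>\<sigma>. ovl N p q a b \<sigma> * ovl N p q c d \<sigma>"]
    by (simp only: cov_def ovl_permute[OF \<pi>])
qed

lemma cov_sym: "cov N b a c d = cov N a b c d" "cov N a b d c = cov N a b c d" "cov N c d a b = cov N a b c d"
  by (simp_all add: cov_def ovl_def qab_def mult.commute eq_commute)

text \<open>In each difference one replica is split into two independent ones without changing the
  type of either pair, so the products of \<open>p\<close> and \<open>q\<close> cancel and the
  one-site moments give the constants.\<close>

lemma cov0_differences:
  "cov0 0 0 0 0 - cov0 0 0 1 1 = cD S \<beta> h D p q"
  "cov0 0 0 0 1 - cov0 0 0 1 2 = cE S \<beta> h D p q"
  "cov0 0 1 0 0 - cov0 0 1 2 2 = cE S \<beta> h D p q"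
  "cov0 0 1 0 1 - cov0 0 1 0 2 = cF S \<beta> h D p q"
  "cov0 0 1 0 2 - cov0 0 1 2 3 = cG S \<beta> h D p q"
proof -
  have "W [0, 0, 0, 0] - W [0, 0, 1, 1] = cD S \<beta> h D p q"
    "W [0, 0, 0, 1] - W [0, 0, 1, 2] = cE S \<beta> h D p q"
    "W [0, 1, 0, 0] - W [0, 1, 2, 2] = cE S \<beta> h D p q"
    "W [0, 1, 0, 1] - W [0, 1, 0, 2] = cF S \<beta> h D p q"
    "W [0, 1, 0, 2] - W [0, 1, 2, 3] = cG S \<beta> h D p q"
    unfolding W_diff cD_def cE_def cF_def cG_def Let_def
    by (simp_all add: cnt_def eval_nat_numeral mom_zero algebra_simps)
  then show "cov0 0 0 0 0 - cov0 0 0 1 1 = cD S \<beta> h D p q"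
    "cov0 0 0 0 1 - cov0 0 0 1 2 = cE S \<beta> h D p q"
    "cov0 0 1 0 0 - cov0 0 1 2 2 = cE S \<beta> h D p q"
    "cov0 0 1 0 1 - cov0 0 1 0 2 = cF S \<beta> h D p q"
    "cov0 0 1 0 2 - cov0 0 1 2 3 = cG S \<beta> h D p q"
    by (simp_all add: cov0_def qab_def)
qed

lemma constants_bound:
  "\<bar>cD S \<beta> h D p q\<bar> \<le> 4 * (real S) ^ 4" "\<bar>cE S \<beta> h D p q\<bar> \<le> 4 * (real S) ^ 4"
  "\<bar>cF S \<beta> h D p q\<bar> \<le> 4 * (real S) ^ 4" "\<bar>cG S \<beta> h D p q\<bar> \<le> 4 * (real S) ^ 4"
proof -
  interpret c: cavity_fp S 1 0 \<beta> h D p q by (rule cavity_fp) simp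
  have b: "\<bar>cov0 a b c d\<bar> \<le> 2 * (real S) ^ 4" if "a < 12" "b < 12" "c < 12" "d < 12" for a b c d
    unfolding cov0_def by (rule c.W_bound[OF that])
  have "\<bar>cov0 a b c d - cov0 a' b' c' d'\<bar> \<le> 4 * (real S) ^ 4"
    if "a < 12" "b < 12" "c < 12" "d < 12" "a' < 12" "b' < 12" "c' < 12" "d' < 12" for a b c d a' b' c' d'
    using b[of a b c d] b[of a' b' c' d'] that by linarith
  from this[of 0 0 0 0 0 0 1 1] this[of 0 0 0 1 0 0 1 2] this[of 0 1 0 1 0 1 0 2] this[of 0 1 0 2 0 1 2 3]
  show "\<bar>cD S \<beta> h D p q\<bar> \<le> 4 * (real S) ^ 4" "\<bar>cE S \<beta> h D p q\<bar> \<le> 4 * (real S) ^ 4"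
    "\<bar>cF S \<beta> h D p q\<bar> \<le> 4 * (real S) ^ 4" "\<bar>cG S \<beta> h D p q\<bar> \<le> 4 * (real S) ^ 4"
    unfolding cov0_differences[symmetric] by simp_all
qed

text \<open>The unknowns \<open>s\<close>, \<open>e\<close>, \<open>t\<close> are the averages of
  S1^2, S1 T1 and T1^2. The equation for \<open>t\<close> involves \<open>r\<close>, the second
  moment of the overlap of two centred replicas, i.e. of 1/N times the sum over i of (\<sigma>^0_i -
  b_i)(\<sigma>^2_i - b_i). The system is triangular in blocks: \<open>s\<close> and
  \<open>e\<close> together, \<open>r\<close> alone, then \<open>t\<close>.\<close>

lemma linear_system:
  assumes small: "\<beta>\<^sup>2 * (512 * (real S)\<^sup>2 * Kc S 2) \<le> 1"
  shows "\<exists>K\<ge>0. \<forall>N>0. \<exists>\<delta>1 \<delta>2 \<delta>3 \<delta>4.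
    (\<forall>\<delta>\<in>{\<delta>1, \<delta>2, \<delta>3, \<delta>4}. \<bar>\<delta>\<bar> \<le> K / (real N * sqrt N)) \<and>
    (let s = cov N 0 0 0 0 - cov N 0 0 1 1; e = cov N 0 2 0 0 - cov N 0 2 1 1;
         t = cov N 0 2 0 3 - cov N 0 2 1 3; r = cov N 0 2 0 2 - 2 * cov N 0 2 0 3 + cov N 0 2 1 3
     in cM2 S \<beta> h D p q * s + 2 * \<beta>\<^sup>2 * cE S \<beta> h D p q * e = cD S \<beta> h D p q / N + \<delta>1 \<and>
        cM1 S \<beta> h D p q * e - \<beta>\<^sup>2 / 2 * cE S \<beta> h D p q * s = cE S \<beta> h D p q / N + \<delta>2 \<and>
        cM1 S \<beta> h D p q * t - \<beta>\<^sup>2 / 2 * cE S \<beta> h D p q * e - \<beta>\<^sup>2 * cG S \<beta> h D p q * r = cG S \<beta> h D p q / N + \<delta>3 \<and>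
        cM3 S \<beta> h D p q * r = (cF S \<beta> h D p q - cG S \<beta> h D p q) / N + \<delta>4)"
proof -
  obtain K where K': "\<forall>N>0. \<forall>a<4. \<forall>b<4. \<forall>c<4. \<forall>d<4.
    \<bar>cov N a b c d - cov0 a b c d / N
      - \<beta>\<^sup>2 / 2 * (\<Sum>i\<le>4. \<Sum>j\<le>Suc 4. rc 4 i * rc (Suc 4) j * (cov0 a b i j * cov N i j c d))\<bar>
    \<le> K / (real N * sqrt N)"
    using averaged_expansion[OF small] by (rule exE)
  note K = K'[rule_format]
  have K0: "0 \<le> K" using order_trans[OF abs_ge_zero K[of 1 0 0 0 0]] by simp
  show ?thesis
  \<comment> \<open>Each error combines at most four expansions, the fourth equation being the
    worst.\<close>
  proof (rule exI[of _ "4 * K"], intro conjI allI impI)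
    show "0 \<le> 4 * K" using K0 by simp
    fix N :: nat assume N: "0 < N"
    define B where "B = K / (real N * sqrt N)"
    define Y where "Y a b c d = (\<Sum>i\<le>4. \<Sum>j\<le>Suc 4. rc 4 i * rc (Suc 4) j * (cov0 a b i j * cov N i j c d))" for a b c d
    define X where "X a b c d = cov N a b c d - cov0 a b c d / N - \<beta>\<^sup>2 / 2 * Y a b c d" for a b c d
    have X: "\<bar>X a b c d\<bar> \<le> B" if "a < 4" "b < 4" "c < 4" "d < 4" for a b c d
      unfolding X_def B_def Y_def by (rule K[OF N that])
    have V: "cov N a b c d = X a b c d + cov0 a b c d / N + \<beta>\<^sup>2 / 2 * Y a b c d" for a b c d
      by (simp add: X_def)
    have pc0: "cov0 a b c d = pattern cov0 a b c d" if "a < 12" "b < 12" "c < 12" "d < 12" for a b c d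
      by (rule pattern_classification[where V = cov0, OF cov0_permute cov0_sym that])
    have pc: "cov N a b c d = pattern (cov N) a b c d" if "a < 12" "b < 12" "c < 12" "d < 12" for a b c d
      by (rule pattern_classification[where V = "cov N", OF cov_permute[OF N] cov_sym(1,2) that])
    have Y: "Y a b c d = (\<Sum>i\<le>4. \<Sum>j\<le>Suc 4. rc 4 i * rc (Suc 4) j * (pattern cov0 a b i j * pattern (cov N) i j c d))"
      if abcd: "a < 4" "b < 4" "c < 4" "d < 4" for a b c d
      unfolding Y_def
    proof (intro sum.cong refl arg_cong2[where f = "(*)"])
      fix i j :: nat assume "i \<in> {..4}" "j \<in> {..Suc 4}"
      then have ij: "i < 12" "j < 12" by auto
      have abcd': "a < 12" "b < 12" "c < 12" "d < 12" using abcd by auto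
      show "cov0 a b i j = pattern cov0 a b i j" by (rule pc0) (fact abcd' ij)+
      show "cov N i j c d = pattern (cov N) i j c d" by (rule pc) (fact abcd' ij)+
    qed
    note ps = pattern_sums[of cov0 "cov N"]
    define s where "s = cov N 0 0 0 0 - cov N 0 0 1 1"
    define e where "e = cov N 0 2 0 0 - cov N 0 2 1 1"
    define t where "t = cov N 0 2 0 3 - cov N 0 2 1 3"
    define r where "r = cov N 0 2 0 2 - 2 * cov N 0 2 0 3 + cov N 0 2 1 3"
    let ?D = "cD S \<beta> h D p q" and ?E = "cE S \<beta> h D p q" and ?F = "cF S \<beta> h D p q" and ?G = "cG S \<beta> h D p q"
    have lt: "(0::nat) < 4" "(1::nat) < 4" "(2::nat) < 4" "(3::nat) < 4" by auto
    \<comment> \<open>The unknowns keep replica 1 free as the copy of replica 0, so their indices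
      are brought back to the standard representatives.\<close>
    have cc: "cov0 0 2 0 0 = cov0 0 1 0 0" "cov0 0 2 1 1 = cov0 0 1 2 2"
      "cov0 0 2 0 3 = cov0 0 1 0 2" "cov0 0 2 1 3 = cov0 0 1 2 3" "cov0 0 2 0 2 = cov0 0 1 0 1" "cov0 0 2 1 2 = cov0 0 1 0 2"
      using pc0[of 0 2 0 0] pc0[of 0 2 1 1] pc0[of 0 2 0 3] pc0[of 0 2 1 3] pc0[of 0 2 0 2] pc0[of 0 2 1 2]
      by (simp_all add: pattern_def)
    have vv: "cov N 0 2 0 0 = cov N 0 1 0 0" "cov N 0 2 1 1 = cov N 0 1 2 2"
      "cov N 0 2 0 3 = cov N 0 1 0 2" "cov N 0 2 1 3 = cov N 0 1 2 3" "cov N 0 2 0 2 = cov N 0 1 0 1" "cov N 0 2 1 2 = cov N 0 1 0 2" "cov N 2 2 0 1 = cov N 0 0 1 2"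
      using pc[of 0 2 0 0] pc[of 0 2 1 1] pc[of 0 2 0 3] pc[of 0 2 1 3] pc[of 0 2 0 2] pc[of 0 2 1 2] pc[of 2 2 0 1]
      by (simp_all add: pattern_def)
    have c: "cov0 0 2 0 0 - cov0 0 2 1 1 = ?E" "cov0 0 2 0 3 - cov0 0 2 1 3 = ?G"
      "cov0 0 2 0 2 - cov0 0 2 1 2 = ?F"
      unfolding cc by (rule cov0_differences)+
    have e': "cov N 0 1 0 0 - cov N 0 1 2 2 = e" "cov N 0 0 0 1 - cov N 0 0 1 2 = e"
      using cov_sym(3)[of N 0 1 0 0] cov_sym(3)[of N 0 1 2 2] unfolding e_def vv by simp_all
    have t': "cov N 0 1 0 2 - cov N 0 1 2 3 = t"
      unfolding t_def vv ..
    have r': "cov N 0 1 0 1 - 2 * cov N 0 1 0 2 + cov N 0 1 2 3 = r"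
      unfolding r_def vv ..
    have FG: "cov0 0 1 0 1 - 4 * cov0 0 1 0 2 + 3 * cov0 0 1 2 3 = ?F - 3 * ?G"
      "cov0 0 1 0 1 - 2 * cov0 0 1 0 2 + cov0 0 1 2 3 = ?F - ?G"
      unfolding cov0_differences[symmetric] by simp_all
    have r2: "r = cov N 0 2 0 2 - cov N 0 2 1 2 - cov N 0 2 0 3 + cov N 0 2 1 3"
      unfolding r_def vv by simp
    have Y1: "Y 0 0 0 0 - Y 0 0 1 1 = ?D * s - 4 * ?E * e"
      using ps(1) unfolding Y[OF lt(1,1,1,1)] Y[OF lt(1,1,2,2)] e' cov0_differences s_def[symmetric] .
    have Y2: "Y 0 2 0 0 - Y 0 2 1 1 = ?E * s + 2 * (?F - 3 * ?G) * e"
      using ps(2) unfolding Y[OF lt(1,3,1,1)] Y[OF lt(1,3,2,2)] e' FG cov0_differences s_def[symmetric] .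
    have Y3: "Y 0 2 0 3 - Y 0 2 1 3 = ?E * e + 2 * (?F - 3 * ?G) * t + 2 * ?G * r"
      using ps(3) unfolding Y[OF lt(1,3,1,4)] Y[OF lt(1,3,2,4)] e' t' r' FG cov0_differences .
    have Y4: "Y 0 2 0 2 - Y 0 2 1 2 - Y 0 2 0 3 + Y 0 2 1 3 = 2 * (?F - ?G) * r"
      using ps(4) unfolding Y[OF lt(1,3,1,3)] Y[OF lt(1,3,2,3)] Y[OF lt(1,3,1,4)] Y[OF lt(1,3,2,4)] r' FG .
    define \<delta>1 where "\<delta>1 = X 0 0 0 0 - X 0 0 1 1"
    define \<delta>2 where "\<delta>2 = X 0 2 0 0 - X 0 2 1 1"
    define \<delta>3 where "\<delta>3 = X 0 2 0 3 - X 0 2 1 3"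
    define \<delta>4 where "\<delta>4 = X 0 2 0 2 - X 0 2 1 2 - X 0 2 0 3 + X 0 2 1 3"
    have "s = \<delta>1 + (cov0 0 0 0 0 - cov0 0 0 1 1) / N + \<beta>\<^sup>2 / 2 * (Y 0 0 0 0 - Y 0 0 1 1)"
      unfolding s_def \<delta>1_def V[of 0 0 0 0] V[of 0 0 1 1] by (simp add: diff_divide_distrib right_diff_distrib)
    then have eq1: "cM2 S \<beta> h D p q * s + 2 * \<beta>\<^sup>2 * ?E * e = ?D / N + \<delta>1"
      unfolding Y1 cov0_differences cM2_def by (simp add: algebra_simps)
    have "e = \<delta>2 + (cov0 0 2 0 0 - cov0 0 2 1 1) / N + \<beta>\<^sup>2 / 2 * (Y 0 2 0 0 - Y 0 2 1 1)"
      unfolding e_def \<delta>2_def V[of 0 2 0 0] V[of 0 2 1 1] by (simp add: diff_divide_distrib right_diff_distrib)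
    then have eq2: "cM1 S \<beta> h D p q * e - \<beta>\<^sup>2 / 2 * ?E * s = ?E / N + \<delta>2"
      unfolding Y2 c cM1_def by (simp add: algebra_simps)
    have "t = \<delta>3 + (cov0 0 2 0 3 - cov0 0 2 1 3) / N + \<beta>\<^sup>2 / 2 * (Y 0 2 0 3 - Y 0 2 1 3)"
      unfolding t_def \<delta>3_def V[of 0 2 0 3] V[of 0 2 1 3] by (simp add: diff_divide_distrib right_diff_distrib)
    then have eq3: "cM1 S \<beta> h D p q * t - \<beta>\<^sup>2 / 2 * ?E * e - \<beta>\<^sup>2 * ?G * r = ?G / N + \<delta>3"
      unfolding Y3 c cM1_def by (simp add: algebra_simps)
    have "r = \<delta>4 + ((cov0 0 2 0 2 - cov0 0 2 1 2) - (cov0 0 2 0 3 - cov0 0 2 1 3)) / N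
        + \<beta>\<^sup>2 / 2 * (Y 0 2 0 2 - Y 0 2 1 2 - Y 0 2 0 3 + Y 0 2 1 3)"
      unfolding r2 \<delta>4_def V[of 0 2 0 2] V[of 0 2 1 2] V[of 0 2 0 3] V[of 0 2 1 3]
      by (simp add: diff_divide_distrib right_diff_distrib distrib_left)
    then have eq4: "cM3 S \<beta> h D p q * r = (?F - ?G) / N + \<delta>4"
      unfolding Y4 c cM3_def by (simp add: algebra_simps)
    have B0: "0 \<le> B" unfolding B_def using K0 by simp
    have d: "\<bar>\<delta>1\<bar> \<le> 4 * B" "\<bar>\<delta>2\<bar> \<le> 4 * B" "\<bar>\<delta>3\<bar> \<le> 4 * B" "\<bar>\<delta>4\<bar> \<le> 4 * B"
      unfolding \<delta>1_def \<delta>2_def \<delta>3_def \<delta>4_def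
      using X[OF lt(1,1,1,1)] X[OF lt(1,1,2,2)] X[OF lt(1,3,1,1)] X[OF lt(1,3,2,2)] X[OF lt(1,3,1,4)] X[OF lt(1,3,2,4)]
        X[OF lt(1,3,1,3)] X[OF lt(1,3,2,3)] B0 by linarith+
    have dd: "\<forall>\<delta>\<in>{\<delta>1, \<delta>2, \<delta>3, \<delta>4}. \<bar>\<delta>\<bar> \<le> 4 * K / (real N * sqrt N)"
      using d by (simp add: B_def)
    show "\<exists>\<delta>1 \<delta>2 \<delta>3 \<delta>4.
      (\<forall>\<delta>\<in>{\<delta>1, \<delta>2, \<delta>3, \<delta>4}. \<bar>\<delta>\<bar> \<le> 4 * K / (real N * sqrt N)) \<and>
      (let s = cov N 0 0 0 0 - cov N 0 0 1 1; e = cov N 0 2 0 0 - cov N 0 2 1 1;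
         t = cov N 0 2 0 3 - cov N 0 2 1 3; r = cov N 0 2 0 2 - 2 * cov N 0 2 0 3 + cov N 0 2 1 3
       in cM2 S \<beta> h D p q * s + 2 * \<beta>\<^sup>2 * ?E * e = ?D / N + \<delta>1 \<and>
        cM1 S \<beta> h D p q * e - \<beta>\<^sup>2 / 2 * ?E * s = ?E / N + \<delta>2 \<and>
        cM1 S \<beta> h D p q * t - \<beta>\<^sup>2 / 2 * ?E * e - \<beta>\<^sup>2 * ?G * r = ?G / N + \<delta>3 \<and>
        cM3 S \<beta> h D p q * r = (?F - ?G) / N + \<delta>4)"
      unfolding Let_def s_def[symmetric] e_def[symmetric] t_def[symmetric] r_def[symmetric]
      by (rule exI[of _ \<delta>1], rule exI[of _ \<delta>2], rule exI[of _ \<delta>3], rule exI[of _ \<delta>4], intro conjI dd eq1 eq2 eq3 eq4)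
  qed
qed

end

section \<open>The limiting variances\<close>

text \<open>Elimination in the block for \<open>s\<close> and \<open>e\<close> has determinant
  \<open>M\<close>, then \<open>r\<close> costs a division by \<open>M3\<close> and \<open>t\<close>
  one by \<open>M1\<close>. The right-hand sides are linear in the errors, with coefficients free of
  \<open>n\<close>.\<close>

lemma solve_linear_system:
  fixes s e t r D E F G M M1 M2 M3 b n d1 d2 d3 d4 :: real
  assumes eq1: "M2 * s + 2 * b * E * e = D / n + d1"
    and eq2: "M1 * e - b / 2 * E * s = E / n + d2"
    and eq3: "M1 * t - b / 2 * E * e - b * G * r = G / n + d3"
    and eq4: "M3 * r = (F - G) / n + d4"
    and M: "M = M1 * M2 + b\<^sup>2 * E\<^sup>2" and M1: "M1 = 1 - b * (F - 3 * G)"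
    and M2: "M2 = 1 - b / 2 * D" and M3: "M3 = 1 - b * (F - G)"
    and nz: "M \<noteq> 0" "M1 \<noteq> 0" "M3 \<noteq> 0" "n \<noteq> 0"
  shows "s - (D * M1 - 2 * b * E\<^sup>2) / (n * M) = (M1 * d1 - 2 * b * E * d2) / M"
    and "e - E / (n * M) = (M2 * d2 + b / 2 * E * d1) / M"
    and "t - (G * M2 + b / 2 * E\<^sup>2) / (n * M * M3) =
      (d3 + b / 2 * E * ((M2 * d2 + b / 2 * E * d1) / M) + b * G * (d4 / M3)) / M1"
proof -
  have "M * s = M1 * (M2 * s + 2 * b * E * e) - 2 * b * E * (M1 * e - b / 2 * E * s)"
    unfolding M by (simp add: algebra_simps power2_eq_square)
  also have "\<dots> = (D * M1 - 2 * b * E\<^sup>2) / n + (M1 * d1 - 2 * b * E * d2)"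
    unfolding eq1 eq2 using nz by (simp add: field_simps power2_eq_square)
  finally have "s = ((D * M1 - 2 * b * E\<^sup>2) / n + (M1 * d1 - 2 * b * E * d2)) / M"
    using nz by (simp add: field_simps)
  then show "s - (D * M1 - 2 * b * E\<^sup>2) / (n * M) = (M1 * d1 - 2 * b * E * d2) / M"
    by (simp add: add_divide_distrib)
  have "M * e = M2 * (M1 * e - b / 2 * E * s) + b / 2 * E * (M2 * s + 2 * b * E * e)"
    unfolding M by (simp add: algebra_simps power2_eq_square)
  also have "\<dots> = E * (M2 + b / 2 * D) / n + (M2 * d2 + b / 2 * E * d1)"
    unfolding eq1 eq2 using nz by (simp add: field_simps)
  \<comment> \<open>This collapse makes the covariance of \<open>S1\<close> and \<open>T1\<close> as
    simple as \<open>E / (n * M)\<close>.\<close>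
  also have "M2 + b / 2 * D = 1" unfolding M2 by simp
  finally have "e = (E / n + (M2 * d2 + b / 2 * E * d1)) / M"
    using nz by (simp add: field_simps)
  then have e: "e = E / (n * M) + (M2 * d2 + b / 2 * E * d1) / M"
    by (simp add: add_divide_distrib)
  then show "e - E / (n * M) = (M2 * d2 + b / 2 * E * d1) / M" by simp
  have "r = ((F - G) / n + d4) / M3" using eq4 nz by (simp add: field_simps)
  then have r: "r = (F - G) / (n * M3) + d4 / M3" by (simp add: add_divide_distrib)
  \<comment> \<open>The three sources of \<open>t\<close> recombine because
    \<open>b * (F - G) = 1 - M3\<close> and \<open>M3 = M1 - 2 * b * G\<close>: the terms in
    \<open>b\<^sup>2 * E\<^sup>2 * G\<close> cancel and a factor \<open>M1\<close> comes out, which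
    the equation for \<open>t\<close> divides away.\<close>
  have main: "G / n + b / 2 * E * (E / (n * M)) + b * G * ((F - G) / (n * M3)) =
    M1 * ((G * M2 + b / 2 * E\<^sup>2) / (n * M * M3))"
  proof -
    have h: "b * G * (F - G) = G * (1 - M3)" unfolding M3 by simp
    have M31: "M3 = M1 - 2 * b * G" unfolding M1 M3 by (simp add: algebra_simps)
    have "G * M * M3 + b / 2 * E\<^sup>2 * M3 + b * G * (F - G) * M = G * M + b / 2 * E\<^sup>2 * M3"
      unfolding h by (simp add: algebra_simps)
    also have "\<dots> = M1 * (G * M2 + b / 2 * E\<^sup>2)"
      unfolding M31 M by (simp add: field_simps power2_eq_square)
    finally have fin: "G * M * M3 + b / 2 * E\<^sup>2 * M3 + b * G * (F - G) * M = M1 * (G * M2 + b / 2 * E\<^sup>2)" .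
    have "G / n + b / 2 * E * (E / (n * M)) + b * G * ((F - G) / (n * M3)) =
      (G * M * M3 + b / 2 * E\<^sup>2 * M3 + b * G * (F - G) * M) / (n * M * M3)"
      using nz by (simp add: add_divide_distrib power2_eq_square)
    then show ?thesis unfolding fin by simp
  qed
  have "M1 * t = (G / n + b / 2 * E * (E / (n * M)) + b * G * ((F - G) / (n * M3)))
      + (d3 + b / 2 * E * ((M2 * d2 + b / 2 * E * d1) / M) + b * G * (d4 / M3))"
    using eq3 unfolding e r by (simp add: algebra_simps)
  then have "M1 * (t - (G * M2 + b / 2 * E\<^sup>2) / (n * M * M3)) =
      d3 + b / 2 * E * ((M2 * d2 + b / 2 * E * d1) / M) + b * G * (d4 / M3)"
    unfolding main right_diff_distrib by simp
  then show "t - (G * M2 + b / 2 * E\<^sup>2) / (n * M * M3) =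
      (d3 + b / 2 * E * ((M2 * d2 + b / 2 * E * d1) / M) + b * G * (d4 / M3)) / M1"
    using nz(2) by (simp add: eq_divide_eq mult.commute)
qed

lemma abs_linear_comb_le:
  fixes u v x y B :: real
  assumes "\<bar>x\<bar> \<le> B" "\<bar>y\<bar> \<le> B"
  shows "\<bar>u * x + v * y\<bar> \<le> (\<bar>u\<bar> + \<bar>v\<bar>) * B"
proof -
  have "\<bar>u * x + v * y\<bar> \<le> \<bar>u\<bar> * \<bar>x\<bar> + \<bar>v\<bar> * \<bar>y\<bar>"
    by (rule order_trans[OF abs_triangle_ineq]) (simp add: abs_mult)
  also have "\<dots> \<le> \<bar>u\<bar> * B + \<bar>v\<bar> * B" using assms by (intro add_mono mult_left_mono) auto
  finally show ?thesis by (simp add: distrib_right)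
qed

lemma powr_three_halves:
  assumes "0 < x" shows "x powr (-3/2) = 1 / (x * sqrt x)"
proof -
  have "x powr (-3/2) = 1 / x powr (1 + 1/2)" by (simp add: powr_minus_divide[symmetric])
  also have "x powr (1 + 1/2) = x * sqrt x"
    unfolding powr_add using assms by (simp add: powr_half_sqrt)
  finally show ?thesis .
qed

context gs_model
begin

lemma nu_eq_cov:
  assumes N: "0 < N"
  shows "nu S N \<beta> h D (\<lambda>g \<sigma>. (S1 S N \<beta> h D g \<sigma>)\<^sup>2) = cov N 0 0 0 0 - cov N 0 0 1 1"
    and "nu S N \<beta> h D (\<lambda>g \<sigma>. S1 S N \<beta> h D g \<sigma> * T1 S N \<beta> h D g \<sigma>) = cov N 0 2 0 0 - cov N 0 2 1 1"
    and "nu S N \<beta> h D (\<lambda>g \<sigma>. (T1 S N \<beta> h D g \<sigma>)\<^sup>2) = cov N 0 2 0 3 - cov N 0 2 1 3"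
proof -
  interpret c: cavity_fp S N 0 \<beta> h D p q by (rule cavity_fp[OF N])
  show "nu S N \<beta> h D (\<lambda>g \<sigma>. (S1 S N \<beta> h D g \<sigma>)\<^sup>2) = cov N 0 0 0 0 - cov N 0 0 1 1"
    unfolding cov_def unfolding c.nu_diff[symmetric] unfolding right_diff_distrib[symmetric] nuR_def nu_def ga_S1_S1 ..
  show "nu S N \<beta> h D (\<lambda>g \<sigma>. S1 S N \<beta> h D g \<sigma> * T1 S N \<beta> h D g \<sigma>) = cov N 0 2 0 0 - cov N 0 2 1 1"
    unfolding cov_def unfolding c.nu_diff[symmetric] unfolding right_diff_distrib[symmetric] nuR_def nu_def ga_S1_T1 ..
  show "nu S N \<beta> h D (\<lambda>g \<sigma>. (T1 S N \<beta> h D g \<sigma>)\<^sup>2) = cov N 0 2 0 3 - cov N 0 2 1 3"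
    unfolding cov_def unfolding c.nu_diff[symmetric] unfolding right_diff_distrib[symmetric] nuR_def nu_def ga_T1_T1 ..
qed

lemma variances:
  assumes small: "\<beta>\<^sup>2 * (512 * (real S)\<^sup>2 * Kc S 2) \<le> 1" and small': "\<beta>\<^sup>2 * (32 * (real S) ^ 4) \<le> 1"
  shows "\<exists>K. \<forall>N\<ge>2.
    \<bar>nu S N \<beta> h D (\<lambda>g \<sigma>. (T1 S N \<beta> h D g \<sigma>)\<^sup>2) - A1sq S N \<beta> h D p q\<bar> \<le> K * real N powr (-3/2) \<and>
    \<bar>nu S N \<beta> h D (\<lambda>g \<sigma>. (S1 S N \<beta> h D g \<sigma>)\<^sup>2) - B1sq S N \<beta> h D p q\<bar> \<le> K * real N powr (-3/2) \<and>
    \<bar>nu S N \<beta> h D (\<lambda>g \<sigma>. S1 S N \<beta> h D g \<sigma> * T1 S N \<beta> h D g \<sigma>) - C1sq S N \<beta> h D p q\<bar> \<le> K * real N powr (-3/2)"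
proof -
  define D' E F G M M1 M2 M3 where defs: "D' = cD S \<beta> h D p q" "E = cE S \<beta> h D p q" "F = cF S \<beta> h D p q"
    "G = cG S \<beta> h D p q" "M = cM S \<beta> h D p q" "M1 = cM1 S \<beta> h D p q" "M2 = cM2 S \<beta> h D p q" "M3 = cM3 S \<beta> h D p q"
  have bounds: "\<bar>D'\<bar> \<le> 4 * (real S) ^ 4" "\<bar>F\<bar> \<le> 4 * (real S) ^ 4" "\<bar>G\<bar> \<le> 4 * (real S) ^ 4"
    unfolding defs by (rule constants_bound)+
  \<comment> \<open>The worst case is \<open>F - 3 * G\<close>, bounded by
    \<open>(4 + 12) * S^4\<close>; the 32 in the assumption keeps \<open>M1\<close>,
    \<open>M2\<close> and \<open>M3\<close> above \<open>1 / 2\<close>.\<close>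
  have scaled: "\<beta>\<^sup>2 * x \<le> 1 / 2" if "\<bar>x\<bar> \<le> 16 * (real S) ^ 4" for x
  proof -
    have "\<beta>\<^sup>2 * x \<le> \<beta>\<^sup>2 * (16 * (real S) ^ 4)" using that by (intro mult_left_mono) auto
    then show ?thesis using small' by simp
  qed
  have Ms: "M = M1 * M2 + (\<beta>\<^sup>2)\<^sup>2 * E\<^sup>2" "M1 = 1 - \<beta>\<^sup>2 * (F - 3 * G)" "M2 = 1 - \<beta>\<^sup>2 / 2 * D'" "M3 = 1 - \<beta>\<^sup>2 * (F - G)"
    unfolding defs cM_def cM1_def cM2_def cM3_def by (simp_all flip: power_mult)
  have pos: "1 / 2 \<le> M1" "1 / 2 \<le> M2" "1 / 2 \<le> M3"
    using scaled[of "F - 3 * G"] scaled[of "D' / 2"] scaled[of "F - G"] bounds unfolding Ms by auto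
  have "0 < M1 * M2" using pos by (intro mult_pos_pos) auto
  then have "0 < M" unfolding Ms(1) by (intro add_pos_nonneg) auto
  with pos have nz: "M \<noteq> 0" "M1 \<noteq> 0" "M3 \<noteq> 0" by auto
  obtain K where K: "0 \<le> K" "\<forall>N>0. \<exists>\<delta>1 \<delta>2 \<delta>3 \<delta>4.
    (\<forall>\<delta>\<in>{\<delta>1, \<delta>2, \<delta>3, \<delta>4}. \<bar>\<delta>\<bar> \<le> K / (real N * sqrt N)) \<and>
    (let s = cov N 0 0 0 0 - cov N 0 0 1 1; e = cov N 0 2 0 0 - cov N 0 2 1 1;
         t = cov N 0 2 0 3 - cov N 0 2 1 3; r = cov N 0 2 0 2 - 2 * cov N 0 2 0 3 + cov N 0 2 1 3
     in M2 * s + 2 * \<beta>\<^sup>2 * E * e = D' / N + \<delta>1 \<and>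
        M1 * e - \<beta>\<^sup>2 / 2 * E * s = E / N + \<delta>2 \<and>
        M1 * t - \<beta>\<^sup>2 / 2 * E * e - \<beta>\<^sup>2 * G * r = G / N + \<delta>3 \<and>
        M3 * r = (F - G) / N + \<delta>4)"
    using linear_system[OF small] unfolding defs by (elim exE conjE)
  \<comment> \<open>These sum the absolute coefficients of the errors in the solved system;
    \<open>kt\<close> contains \<open>ke\<close> because \<open>t\<close> inherits the error of
    \<open>e\<close>.\<close>
  define ks where "ks = (\<bar>M1 / M\<bar> + \<bar>- 2 * \<beta>\<^sup>2 * E / M\<bar>)"
  define ke where "ke = (\<bar>M2 / M\<bar> + \<bar>\<beta>\<^sup>2 / 2 * E / M\<bar>)"
  define kt where "kt = \<bar>1 / M1\<bar> + (\<bar>\<beta>\<^sup>2 / 2 * E / M1\<bar> * ke + \<bar>\<beta>\<^sup>2 * G / (M1 * M3)\<bar>)"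
  have k0: "0 \<le> ks" "0 \<le> ke" "0 \<le> kt" unfolding ks_def ke_def kt_def by auto
  show ?thesis
  proof (rule exI[of _ "K * (ks + ke + kt)"], intro allI impI)
    fix N :: nat assume "2 \<le> N"
    then have N: "0 < N" by simp
    let ?B = "K / (real N * sqrt N)"
    obtain \<delta>1 \<delta>2 \<delta>3 \<delta>4 where \<delta>: "\<bar>\<delta>1\<bar> \<le> ?B" "\<bar>\<delta>2\<bar> \<le> ?B" "\<bar>\<delta>3\<bar> \<le> ?B" "\<bar>\<delta>4\<bar> \<le> ?B"
      and eqs: "M2 * (cov N 0 0 0 0 - cov N 0 0 1 1) + 2 * \<beta>\<^sup>2 * E * (cov N 0 2 0 0 - cov N 0 2 1 1) = D' / N + \<delta>1"
        "M1 * (cov N 0 2 0 0 - cov N 0 2 1 1) - \<beta>\<^sup>2 / 2 * E * (cov N 0 0 0 0 - cov N 0 0 1 1) = E / N + \<delta>2"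
        "M1 * (cov N 0 2 0 3 - cov N 0 2 1 3) - \<beta>\<^sup>2 / 2 * E * (cov N 0 2 0 0 - cov N 0 2 1 1)
          - \<beta>\<^sup>2 * G * (cov N 0 2 0 2 - 2 * cov N 0 2 0 3 + cov N 0 2 1 3) = G / N + \<delta>3"
        "M3 * (cov N 0 2 0 2 - 2 * cov N 0 2 0 3 + cov N 0 2 1 3) = (F - G) / N + \<delta>4"
      using K(2)[rule_format, OF N] unfolding Let_def by (elim exE conjE) simp
    have N0: "real N \<noteq> 0" using N by simp
    note sol = solve_linear_system[OF eqs Ms nz N0]
    have B0: "0 \<le> ?B" using K(1) by simp
    have s: "\<bar>(cov N 0 0 0 0 - cov N 0 0 1 1) - (D' * M1 - 2 * \<beta>\<^sup>2 * E\<^sup>2) / (N * M)\<bar> \<le> ks * ?B"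
      unfolding sol(1) ks_def using abs_linear_comb_le[OF \<delta>(1,2), of "M1 / M" "- 2 * \<beta>\<^sup>2 * E / M"]
      by (simp add: diff_divide_distrib)
    have e: "\<bar>(M2 * \<delta>2 + \<beta>\<^sup>2 / 2 * E * \<delta>1) / M\<bar> \<le> ke * ?B"
      unfolding ke_def using abs_linear_comb_le[OF \<delta>(2,1), of "M2 / M" "\<beta>\<^sup>2 / 2 * E / M"]
      by (simp add: add_divide_distrib)
    have t: "\<bar>(\<delta>3 + \<beta>\<^sup>2 / 2 * E * ((M2 * \<delta>2 + \<beta>\<^sup>2 / 2 * E * \<delta>1) / M) + \<beta>\<^sup>2 * G * (\<delta>4 / M3)) / M1\<bar> \<le> kt * ?B"
    proof -
      define x where "x = (M2 * \<delta>2 + \<beta>\<^sup>2 / 2 * E * \<delta>1) / M"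
      have "\<bar>(\<delta>3 + \<beta>\<^sup>2 / 2 * E * x + \<beta>\<^sup>2 * G * (\<delta>4 / M3)) / M1\<bar> =
        \<bar>(1 / M1) * \<delta>3 + ((\<beta>\<^sup>2 / 2 * E / M1) * x + (\<beta>\<^sup>2 * G / (M1 * M3)) * \<delta>4)\<bar>"
        by (simp add: add_divide_distrib mult.commute)
      also have "\<dots> \<le> \<bar>1 / M1\<bar> * \<bar>\<delta>3\<bar> + (\<bar>\<beta>\<^sup>2 / 2 * E / M1\<bar> * \<bar>x\<bar> + \<bar>\<beta>\<^sup>2 * G / (M1 * M3)\<bar> * \<bar>\<delta>4\<bar>)"
        unfolding abs_mult[symmetric] by (intro order_trans[OF abs_triangle_ineq] add_mono order_refl)
      also have "\<dots> \<le> \<bar>1 / M1\<bar> * ?B + (\<bar>\<beta>\<^sup>2 / 2 * E / M1\<bar> * (ke * ?B) + \<bar>\<beta>\<^sup>2 * G / (M1 * M3)\<bar> * ?B)"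
        using e \<delta> unfolding x_def by (intro add_mono mult_left_mono) auto
      also have "\<dots> = kt * ?B" unfolding kt_def by (simp only: distrib_right mult.assoc)
      finally show ?thesis unfolding x_def .
    qed
    have up: "y * ?B \<le> K * (ks + ke + kt) * real N powr (-3/2)" if "y \<le> ks + ke + kt" for y
    proof -
      have "y * ?B \<le> (ks + ke + kt) * ?B" using that B0 by (intro mult_right_mono) auto
      moreover have "real N powr (-3/2) = 1 / (real N * sqrt N)" using N by (intro powr_three_halves) simp
      ultimately show ?thesis by (simp only: times_divide_eq_right mult_1_right mult.commute)
    qed
    have "A1sq S N \<beta> h D p q = (G * M2 + \<beta>\<^sup>2 / 2 * E\<^sup>2) / (N * M * M3)"
      "B1sq S N \<beta> h D p q = (D' * M1 - 2 * \<beta>\<^sup>2 * E\<^sup>2) / (N * M)" "C1sq S N \<beta> h D p q = E / (N * M)"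
      unfolding A1sq_def B1sq_def C1sq_def defs by simp_all
    then show "\<bar>nu S N \<beta> h D (\<lambda>g \<sigma>. (T1 S N \<beta> h D g \<sigma>)\<^sup>2) - A1sq S N \<beta> h D p q\<bar> \<le> K * (ks + ke + kt) * real N powr (-3/2) \<and>
      \<bar>nu S N \<beta> h D (\<lambda>g \<sigma>. (S1 S N \<beta> h D g \<sigma>)\<^sup>2) - B1sq S N \<beta> h D p q\<bar> \<le> K * (ks + ke + kt) * real N powr (-3/2) \<and>
      \<bar>nu S N \<beta> h D (\<lambda>g \<sigma>. S1 S N \<beta> h D g \<sigma> * T1 S N \<beta> h D g \<sigma>) - C1sq S N \<beta> h D p q\<bar> \<le> K * (ks + ke + kt) * real N powr (-3/2)"
      using order_trans[OF t[folded sol(3)] up[of kt]] order_trans[OF s up[of ks]] order_trans[OF e[folded sol(2)] up[of ke]] k0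
      by (simp only: nu_eq_cov[OF N])
  qed
qed

end

theorem theorem3p15:
  fixes S :: nat and h D :: real
  assumes "S \<ge> 1" and "h \<ge> 0"
  shows "\<exists>\<beta>0>0. \<forall>\<beta>. 0 < \<beta> \<and> \<beta> < \<beta>0 \<longrightarrow>
     (\<exists>!pq. fixed_point S \<beta> h D (fst pq) (snd pq)) \<and>
     (\<forall>p q. fixed_point S \<beta> h D p q \<longrightarrow>
        (\<exists>K. \<forall>N\<ge>2.
           \<bar>nu S N \<beta> h D (\<lambda>g \<sigma>. (T1 S N \<beta> h D g \<sigma>)^2) - A1sq S N \<beta> h D p q\<bar>
              \<le> K * real N powr (-3/2) \<and>
           \<bar>nu S N \<beta> h D (\<lambda>g \<sigma>. (S1 S N \<beta> h D g \<sigma>)^2) - B1sq S N \<beta> h D p q\<bar>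
              \<le> K * real N powr (-3/2) \<and>
           \<bar>nu S N \<beta> h D (\<lambda>g \<sigma>. S1 S N \<beta> h D g \<sigma> * T1 S N \<beta> h D g \<sigma>) - C1sq S N \<beta> h D p q\<bar>
              \<le> K * real N powr (-3/2)))"
proof -
  \<comment> \<open>The summands guarantee, in this order, \<open>\<beta> \<le> 1\<close>,
    absorption of the moments, contraction for the fixed point, and nonvanishing
    determinants.\<close>
  define L where "L = 1 + 512 * (real S)\<^sup>2 * Kc S 2 + 16 * Kf S + 32 * (real S) ^ 4"
  have nn: "0 \<le> 512 * (real S)\<^sup>2 * Kc S 2" "0 \<le> 16 * Kf S" "0 \<le> 32 * (real S) ^ 4"
    using Kc_nonneg[of S 2] Kf_nonneg[of S] by auto
  have L: "1 \<le> L" unfolding L_def using nn by linarith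
  show ?thesis
  proof (rule exI[of _ "1 / L"], intro conjI allI impI)
    show "0 < 1 / L" using L by simp
    fix \<beta> assume \<beta>: "0 < \<beta> \<and> \<beta> < 1 / L"
    have "\<beta> * L \<le> 1" using \<beta> L by (simp add: field_simps)
    moreover have "\<beta> * 1 \<le> \<beta> * L" using \<beta> L by (intro mult_left_mono) auto
    ultimately have \<beta>1: "\<beta> \<le> 1" by simp
    \<comment> \<open>One factor \<beta> is spent on \<open>\<beta> \<le> 1\<close>, the other on
      \<open>\<beta> * L \<le> 1\<close>.\<close>
    have small: "\<beta>\<^sup>2 * x \<le> 1" if "0 \<le> x" "x \<le> L" for x
    proof -
      have "\<beta>\<^sup>2 * x \<le> \<beta> * L" unfolding power2_eq_square
        using \<beta> \<beta>1 that by (intro mult_mono) (auto simp: mult_left_le)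
      then show ?thesis using \<open>\<beta> * L \<le> 1\<close> by simp
    qed
    show "\<exists>!pq. fixed_point S \<beta> h D (fst pq) (snd pq)"
      using small[OF nn(2)] nn by (intro fixed_point_ex1) (simp add: L_def mult_ac)
    fix p q assume "fixed_point S \<beta> h D p q"
    then interpret gs_model S \<beta> h D p q using \<beta> \<beta>1 by unfold_locales auto
    show "\<exists>K. \<forall>N\<ge>2.
           \<bar>nu S N \<beta> h D (\<lambda>g \<sigma>. (T1 S N \<beta> h D g \<sigma>)^2) - A1sq S N \<beta> h D p q\<bar>
              \<le> K * real N powr (-3/2) \<and>
           \<bar>nu S N \<beta> h D (\<lambda>g \<sigma>. (S1 S N \<beta> h D g \<sigma>)^2) - B1sq S N \<beta> h D p q\<bar>
              \<le> K * real N powr (-3/2) \<and>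
           \<bar>nu S N \<beta> h D (\<lambda>g \<sigma>. S1 S N \<beta> h D g \<sigma> * T1 S N \<beta> h D g \<sigma>) - C1sq S N \<beta> h D p q\<bar>
              \<le> K * real N powr (-3/2)"
      using nn by (intro variances small) (simp_all add: L_def)
  qed
qed

end
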